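(* Let $G_1, G_2, G_3, \ldots$ be finite connected graphs that all have the same universal cover tree $T$, and suppose they are weakly Ramanujan, i.e. counting eigenvalues of the adjacency matrix with multiplicity, $$\frac{\#\{\text{eigenvalues } \lambda \text{ of } G_n \text{ with } |\lambda| \le \rho(T)\}}{|G_n|} \longrightarrow 1 \quad (n\to\infty).$$ Suppose moreover that $|G_n| \to \infty$. Then for every $r > 0$, $$\frac{\#\{v \in V(G_n) : \text{the } r\text{-neighbourhood } B_r(G_n,v) \text{ is a tree}\}}{|G_n|} \longrightarrow 1 \quad (n \to \infty).$$
   Context: $|G|$ denotes the number of vertices of $G$. The universal cover of a connected graph $G$ is the (unique up to isomorphism) tree $T$ admitting a surjective graph homomorphism $\pi: T \to G$ (the cover map) that is locally bijective: for each vertex $\hat v$ of $T$, $\pi$ restricts to a bijection from the 1-neighbourhood of $\hat v$ in $T$ onto the 1-neighbourhood of $\pi(\hat v)$ in $G$. For a (possibly infinite, locally finite) graph $T$, $\rho(T)$ denotes its spectral radius, the operator norm of the adjacency operator of $T$ acting on $\ell^2(V(T))$. $B_r(G,v)$ is the subgraph induced by the vertices at graph distance at most $r$ from $v$. *)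

theory Defs
  imports
    "HOL-Analysis.Infinite_Sum"
    "HOL-Library.Extended_Nat"
    "Jordan_Normal_Form.Char_Poly"
begin

section \<open>Simple graphs, possibly infinite\<close>

record 'a sgraph =
  verts :: "'a set"
  adj :: "'a \<Rightarrow> 'a \<Rightarrow> bool"

definition simple_graph :: "'a sgraph \<Rightarrow> bool" where
  "simple_graph G \<longleftrightarrow>
     (\<forall>u v. adj G u v \<longrightarrow> u \<in> verts G \<and> v \<in> verts G \<and> u \<noteq> v \<and> adj G v u)"

text \<open>A walk is the nonempty list of its vertices; its length is the number of edges,
  i.e. one less than the length of the list.\<close>

definition walk :: "'a sgraph \<Rightarrow> 'a \<Rightarrow> 'a list \<Rightarrow> 'a \<Rightarrow> bool" where
  "walk G u p v \<longleftrightarrow>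
     p \<noteq> [] \<and> set p \<subseteq> verts G \<and> successively (adj G) p \<and> hd p = u \<and> last p = v"

definition graph_connected :: "'a sgraph \<Rightarrow> bool" where
  "graph_connected G \<longleftrightarrow>
     verts G \<noteq> {} \<and> (\<forall>u \<in> verts G. \<forall>v \<in> verts G. \<exists>p. walk G u p v)"

text \<open>A cycle is the list of its distinct vertices, the first one not being repeated at the end.\<close>

definition graph_cycle :: "'a sgraph \<Rightarrow> 'a list \<Rightarrow> bool" where
  "graph_cycle G p \<longleftrightarrow>
     length p \<ge> 3 \<and> distinct p \<and> walk G (hd p) p (last p) \<and> adj G (last p) (hd p)"

definition is_tree :: "'a sgraph \<Rightarrow> bool" where
  "is_tree G \<longleftrightarrow> simple_graph G \<and> graph_connected G \<and> (\<nexists>p. graph_cycle G p)"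

definition graph_dist :: "'a sgraph \<Rightarrow> 'a \<Rightarrow> 'a \<Rightarrow> enat" where
  "graph_dist G u v = (INF p \<in> {p. walk G u p v}. enat (length p - 1))"

definition induced :: "'a sgraph \<Rightarrow> 'a set \<Rightarrow> 'a sgraph" where
  "induced G S = \<lparr>verts = verts G \<inter> S, adj = (\<lambda>u v. adj G u v \<and> u \<in> S \<and> v \<in> S)\<rparr>"

definition nbhd :: "nat \<Rightarrow> 'a sgraph \<Rightarrow> 'a \<Rightarrow> 'a sgraph" where
  "nbhd r G v = induced G {u \<in> verts G. graph_dist G v u \<le> enat r}"


section \<open>Universal covers\<close>

definition cover_map :: "('b \<Rightarrow> 'a) \<Rightarrow> 'b sgraph \<Rightarrow> 'a sgraph \<Rightarrow> bool" where
  "cover_map \<pi> T G \<longleftrightarrow>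
     \<pi> ` verts T = verts G \<and>
     (\<forall>u v. adj T u v \<longrightarrow> adj G (\<pi> u) (\<pi> v)) \<and>
     (\<forall>v \<in> verts T. bij_betw \<pi> (verts (nbhd 1 T v)) (verts (nbhd 1 G (\<pi> v))))"

definition universal_cover :: "'b sgraph \<Rightarrow> 'a sgraph \<Rightarrow> bool" where
  "universal_cover T G \<longleftrightarrow> is_tree T \<and> (\<exists>\<pi>. cover_map \<pi> T G)"


section \<open>Spectra\<close>

definition ell2 :: "'a set \<Rightarrow> ('a \<Rightarrow> real) set" where
  "ell2 V = {f. (\<forall>v. v \<notin> V \<longrightarrow> f v = 0) \<and> (\<lambda>v. (f v)\<^sup>2) summable_on V}"

definition ell2_norm :: "'a set \<Rightarrow> ('a \<Rightarrow> real) \<Rightarrow> real" where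
  "ell2_norm V f = sqrt (\<Sum>\<^sub>\<infinity>v\<in>V. (f v)\<^sup>2)"

definition adj_op :: "'a sgraph \<Rightarrow> ('a \<Rightarrow> real) \<Rightarrow> 'a \<Rightarrow> real" where
  "adj_op G f v = (\<Sum>u \<in> {u. adj G v u}. f u)"

text \<open>The operator norm, written as in \<open>onorm\<close> (so \<open>0 / 0 = 0\<close>). It has this meaning only if
  the adjacency operator is defined and bounded on \<open>\<ell>\<^sup>2\<close>, in particular if vertex degrees are
  bounded, as they are for any cover of a finite graph.\<close>

definition graph_spectral_radius :: "'a sgraph \<Rightarrow> real" where
  "graph_spectral_radius G =
     (SUP f \<in> ell2 (verts G). ell2_norm (verts G) (adj_op G f) / ell2_norm (verts G) f)"

text \<open>The vertices of a finite graph are enumerated in an arbitrary order; the characteristic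
  polynomial does not depend on it.\<close>

definition adj_matrix :: "'a sgraph \<Rightarrow> real mat" where
  "adj_matrix G =
     (let vs = (SOME vs. distinct vs \<and> set vs = verts G)
      in Matrix.mat (length vs) (length vs) (\<lambda>(i, j). if adj G (vs ! i) (vs ! j) then 1 else 0))"

text \<open>The adjacency matrix is symmetric, so the real roots of its characteristic polynomial are
  all its eigenvalues.\<close>

definition eigenvalues_mset :: "'a sgraph \<Rightarrow> real multiset" where
  "eigenvalues_mset G = proots (char_poly (adj_matrix G))"

end

theory Submission
  imports Defs
    "HOL-Analysis.Convex"
    "HOL-Analysis.L2_Norm"
    "HOL-Real_Asymp.Real_Asymp"
    "Jordan_Normal_Form.Schur_Decomposition"
begin

text \<open>
  For an energy \<open>l\<close> above the spectral radius \<open>\<rho>\<close> of \<open>T\<close>, the Green function of a graph covered by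
  \<open>T\<close> is a sum over non-backtracking walks \<open>p\<close> whose weight is the product of the first passage
  functions \<open>m\<close> of the arcs of \<open>p\<close>; these functions only see the branch of \<open>T\<close> behind the arc.
  If the branch sums \<open>H\<close> of products of \<open>m\<^sup>2\<close> are bounded by \<open>B\<close> at energy \<open>l\<close>, then \<open>m + 2 \<eta> H\<close>
  with \<open>\<eta> \<approx> B\<^sup>-\<^sup>2\<close> is a positive supersolution at energy \<open>l - \<eta>\<close>, so \<open>\<rho> \<le> l - \<eta>\<close>. Hence \<open>B\<close> grows
  at least like \<open>(l - \<rho>)\<^sup>-\<^sup>1\<^sup>/\<^sup>2\<close> as \<open>l \<rightarrow> \<rho>\<close>, and by a Harnack inequality the branch sums of all arcs of the
  core (arcs with infinite branches on both sides) at its branching points are comparable to \<open>B\<close>.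

  Suppose a positive fraction of the vertices of \<open>G\<^sub>n\<close> is close to a short cycle. Each time a
  non-backtracking walk passes from such a cycle to a branch off it, one more turn around the cycle
  can be inserted, at the cost of a constant factor in the weight. Under the weights \<open>m\<^sup>2\<close> a walk
  makes on average about \<open>B\<close> such passages (mass transport), so by Jensen's inequality the normalised
  Hilbert-Schmidt norm of a truncated resolvent of \<open>G\<^sub>n\<close> is at least \<open>exp (c B)\<close>. The weak Ramanujan
  property bounds it by \<open>(l - \<rho>)\<^sup>-\<^sup>2 + o(1)\<close>, which is at most of order \<open>B\<^sup>4\<close>: a contradiction for
  \<open>l\<close> close to \<open>\<rho>\<close>.
\<close>

section \<open>Neighbours, covers and non-backtracking walks\<close>

text \<open>Everything is truncated because \<open>l\<close> lies above \<rho> but possibly below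
  some eigenvalues of \<open>G n\<close>, where the resolvent series diverges. Cut after
  \<open>M\<close> terms it is a polynomial, and the exceptional eigenvalues contribute at most
  their proportion times a constant that depends on \<open>l\<close>, \<open>M\<close> and the
  degree only. The choices are therefore made in the order \<open>l\<close>, \<open>B\<close>,
  \<open>N\<close>, \<open>K\<close>, \<open>M\<close>, and \<open>n\<close> comes last: constants
  must come from \<open>T\<close> or from the single finite graph \<open>G 0\<close>, to which
  functions of arcs are transported through \<open>T\<close>. A passage inside a walk has a past and
  a future. The future is weighed by a branch sum of m^2, the past by one with reversed arcs, about
  which the spectral gap argument says nothing. Reversing all paths of \<open>G 0\<close> compares
  the two at the price of the number \<open>A\<close> of its arcs. Past and future are each of order
  \<open>B\<close> and the paths have mass of order \<open>B\<close> per vertex, so the constant in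
  front of \<open>B\<close> in the mean number of passages does not depend on \<open>l\<close>. This
  lets exp (c B) beat the fourth power, which is the square of the bound of order B^2 for 1 / (l -
  \<rho>).\<close>

definition nbrs :: "'a sgraph \<Rightarrow> 'a \<Rightarrow> 'a set" where
  "nbrs G x = {u. adj G x u}"

definition succs :: "'a sgraph \<Rightarrow> 'a \<Rightarrow> 'a \<Rightarrow> 'a set" where
  "succs G x b = nbrs G b - {x}"

lemma mem_nbrs [simp]: "u \<in> nbrs G x \<longleftrightarrow> adj G x u"
  by (simp add: nbrs_def)

lemma mem_succs [simp]: "c \<in> succs G x b \<longleftrightarrow> adj G b c \<and> c \<noteq> x"
  by (auto simp: succs_def)

lemma simple_graph_adjD:
  assumes "simple_graph G" "adj G u v"
  shows "u \<in> verts G" "v \<in> verts G" "u \<noteq> v" "adj G v u"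
  using assms by (auto simp: simple_graph_def)

lemma nbrs_subset_verts: "simple_graph G \<Longrightarrow> nbrs G x \<subseteq> verts G"
  by (auto dest: simple_graph_adjD)

lemma graph_dist_le_iff:
  "graph_dist G u v \<le> enat r \<longleftrightarrow> (\<exists>p. walk G u p v \<and> length p - 1 \<le> r)"
proof
  assume le: "graph_dist G u v \<le> enat r"
  show "\<exists>p. walk G u p v \<and> length p - 1 \<le> r"
  proof (rule ccontr)
    assume "\<nexists>p. walk G u p v \<and> length p - 1 \<le> r"
    then have "enat (Suc r) \<le> graph_dist G u v"
      unfolding graph_dist_def by (intro INF_greatest) (auto simp: not_le Suc_le_eq)
    with le have "enat (Suc r) \<le> enat r" by (rule order_trans[rotated])
    then show False by simp
  qed
next
  assume "\<exists>p. walk G u p v \<and> length p - 1 \<le> r"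
  then obtain p where p: "walk G u p v" "length p - 1 \<le> r" by blast
  then have "graph_dist G u v \<le> enat (length p - 1)"
    unfolding graph_dist_def by (intro INF_lower) auto
  also have "\<dots> \<le> enat r" using p by simp
  finally show "graph_dist G u v \<le> enat r" .
qed

lemma verts_nbhd: "verts (nbhd r G v) = {u \<in> verts G. graph_dist G v u \<le> enat r}"
  by (auto simp: nbhd_def induced_def)

lemma walk_single: "v \<in> verts G \<Longrightarrow> walk G v [v] v"
  by (simp add: walk_def)

lemma walk_Cons:
  assumes "simple_graph G" "adj G u w" "walk G w p v"
  shows "walk G u (u # p) v"
  using assms by (cases p) (auto simp: walk_def dest: simple_graph_adjD)

lemma verts_nbhd_1:
  assumes "simple_graph G" "v \<in> verts G"
  shows "verts (nbhd 1 G v) = insert v (nbrs G v)"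
proof -
  have "graph_dist G v u \<le> enat 1 \<longleftrightarrow> u = v \<or> adj G v u" if "u \<in> verts G" for u
    unfolding graph_dist_le_iff
  proof
    assume "\<exists>p. walk G v p u \<and> length p - 1 \<le> 1"
    then obtain p where p: "walk G v p u" "length p \<le> 2" by auto
    then show "u = v \<or> adj G v u"
      by (cases p rule: remdups_adj.cases) (auto simp: walk_def)
  next
    assume "u = v \<or> adj G v u"
    then show "\<exists>p. walk G v p u \<and> length p - 1 \<le> 1"
    proof
      assume "u = v" then show ?thesis
        using walk_single[OF assms(2)] by (intro exI[of _ "[v]"]) auto
    next
      assume "adj G v u" then show ?thesis
        using walk_Cons[OF assms(1) _ walk_single[of u G]] that
        by (intro exI[of _ "[v, u]"]) auto
    qed
  qed
  then show ?thesis
    using assms simple_graph_adjD(2)[OF assms(1)] by (auto simp: verts_nbhd)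
qed

section \<open>Local bijectivity of cover maps\<close>

lemma cover_map_bij_nbrs:
  assumes "simple_graph T" "simple_graph G" "cover_map \<pi> T G" "v \<in> verts T"
  shows "bij_betw \<pi> (nbrs T v) (nbrs G (\<pi> v))"
proof -
  have v: "\<pi> v \<in> verts G" using assms by (auto simp: cover_map_def)
  have "bij_betw \<pi> (insert v (nbrs T v)) (insert (\<pi> v) (nbrs G (\<pi> v)))"
    using assms v unfolding cover_map_def
    by (metis verts_nbhd_1)
  moreover have "v \<notin> nbrs T v" "\<pi> v \<notin> nbrs G (\<pi> v)"
    using assms by (auto dest: simple_graph_adjD)
  ultimately show ?thesis
    using notIn_Un_bij_betw3[of v "nbrs T v" \<pi> "nbrs G (\<pi> v)"] by simp
qed

lemma cover_map_adj: "cover_map \<pi> T G \<Longrightarrow> adj T u v \<Longrightarrow> adj G (\<pi> u) (\<pi> v)"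
  by (auto simp: cover_map_def)

lemma cover_map_bij_succs:
  assumes "simple_graph T" "simple_graph G" "cover_map \<pi> T G" "adj T x b"
  shows "bij_betw \<pi> (succs T x b) (succs G (\<pi> x) (\<pi> b))"
proof -
  have "bij_betw \<pi> (nbrs T b) (nbrs G (\<pi> b))"
    using assms by (intro cover_map_bij_nbrs) (auto dest: simple_graph_adjD)
  moreover have "x \<in> nbrs T b" using assms by (auto dest: simple_graph_adjD)
  ultimately show ?thesis
    unfolding succs_def bij_betw_def by (auto simp: inj_on_def)
qed

lemma cover_map_lift_vertex:
  assumes "cover_map \<pi> T G" "x \<in> verts G"
  obtains x' where "x' \<in> verts T" "\<pi> x' = x"
  using assms unfolding cover_map_def by (metis imageE)

lemma cover_map_lift_nbr:
  assumes "simple_graph T" "simple_graph G" "cover_map \<pi> T G" "x' \<in> verts T" "adj G (\<pi> x') u"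
  obtains u' where "adj T x' u'" "\<pi> u' = u"
  using cover_map_bij_nbrs[OF assms(1-4)] assms(5) unfolding bij_betw_def by force

text \<open>The head is the current end of the walk and the last element its start, so a walk grows
  by \<open>#\<close> and sums over walks can recurse on the most recent step.\<close>

fun nb_walk :: "'a sgraph \<Rightarrow> 'a list \<Rightarrow> bool" where
  "nb_walk G [] = False"
| "nb_walk G [v] = (v \<in> verts G)"
| "nb_walk G [x, v] = adj G v x"
| "nb_walk G (b # x # y # q) = (adj G x b \<and> b \<noteq> y \<and> nb_walk G (x # y # q))"

section \<open>Non-backtracking walks in graphs without cycles\<close>

lemma nb_walk_not_Nil: "nb_walk G p \<Longrightarrow> p \<noteq> []"
  by auto

lemma nb_walk_ConsD:
  assumes "simple_graph G" "nb_walk G (b # x # q)"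
  shows "nb_walk G (x # q)" "adj G x b"
  using assms by (cases q; auto dest: simple_graph_adjD)+

lemma nb_walk_append:
  assumes "simple_graph G"
  shows "nb_walk G (xs @ [z]) \<Longrightarrow> nb_walk G (z # ys) \<Longrightarrow>
    (xs \<noteq> [] \<Longrightarrow> ys \<noteq> [] \<Longrightarrow> last xs \<noteq> hd ys) \<Longrightarrow> nb_walk G (xs @ z # ys)"
proof (induction xs)
  case Nil
  then show ?case by simp
next
  case (Cons a xs)
  note prems = Cons.prems and IH = Cons.IH
  show ?case
  proof (cases xs)
    case Nil
    then show ?thesis using prems assms by (cases ys) (auto dest: simple_graph_adjD)
  next
    case (Cons b xs')
    have "nb_walk G (xs @ z # ys)"
      using IH prems nb_walk_ConsD[OF assms, of a b "xs' @ [z]"] Cons by auto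
    moreover have "adj G b a" using nb_walk_ConsD[OF assms, of a b "xs' @ [z]"] Cons prems by auto
    moreover have "a \<noteq> hd (xs' @ z # ys)"
      using prems Cons by (cases xs') auto
    ultimately show ?thesis using Cons by (cases xs') auto
  qed
qed

lemma nb_walk_rev:
  assumes "simple_graph G" "nb_walk G p"
  shows "nb_walk G (rev p)"
  using assms(2)
proof (induction p rule: induct_list012)
  case (3 x y zs)
  then have xy: "nb_walk G (y # zs)" "adj G y x"
    using nb_walk_ConsD[OF assms(1)] by blast+
  have "nb_walk G (rev zs @ y # [x])"
  proof (rule nb_walk_append[OF assms(1)])
    show "nb_walk G (rev zs @ [y])" using 3 xy by simp
    show "nb_walk G [y, x]" using xy assms(1) by (auto dest: simple_graph_adjD)
    show "last (rev zs) \<noteq> hd [x]" if "rev zs \<noteq> []"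
      using that 3 by (cases zs) auto
  qed
  then show ?case by simp
qed auto

lemma nb_walk_verts:
  assumes "simple_graph G" "nb_walk G p"
  shows "set p \<subseteq> verts G"
  using assms(2)
proof (induction p rule: induct_list012)
  case (3 x y zs)
  then show ?case
    using nb_walk_ConsD[OF assms(1) 3(3)] simple_graph_adjD[OF assms(1)] by auto
qed auto

lemma nb_walk_successively:
  assumes "simple_graph G" "nb_walk G p"
  shows "successively (adj G) p"
  using assms(2)
proof (induction p rule: induct_list012)
  case (3 x y zs)
  then show ?case
    using nb_walk_ConsD[OF assms(1) 3(3)] simple_graph_adjD[OF assms(1)] by auto
qed auto

text \<open>Take the first \<open>z\<close> whose prepending creates a repetition: the tail is still
  distinct, so the stretch from \<open>z\<close> to its next occurrence is a cycle. Its length is at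
  least three because adjacency is irreflexive and an immediate return is excluded.\<close>

lemma nb_walk_distinct:
  assumes G: "simple_graph G" and acyc: "\<nexists>c. graph_cycle G c" and "nb_walk G p"
  shows "distinct p"
  using assms(3)
proof (induction p)
  case Nil
  then show ?case by simp
next
  case (Cons z q)
  show ?case
  proof (cases "q = []")
    case False
    then obtain x q' where q: "q = x # q'" by (cases q) auto
    have nq: "nb_walk G q" and zx: "adj G x z" using nb_walk_ConsD[OF G] Cons.prems q by blast+
    have dq: "distinct q" using Cons.IH nq .
    show ?thesis
    proof (rule ccontr)
      assume "\<not> distinct (z # q)"
      then have "z \<in> set q" using dq by simp
      then obtain as bs where q2: "q = as @ z # bs" and "z \<notin> set as"
        by (meson split_list_first)
      have dz: "distinct (z # as)" using dq q2 \<open>z \<notin> set as\<close> by auto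
      have suc: "successively (adj G) (z # as @ z # bs)"
        using nb_walk_successively[OF G Cons.prems] q2 by simp
      have "as \<noteq> []" using q q2 zx simple_graph_adjD(3)[OF G zx] by auto
      moreover have "as \<noteq> [x]" using Cons.prems q2 by auto
      ultimately have len: "length (z # as) \<ge> 3"
        using q q2 by (cases as; cases "tl as") auto
      have suc': "successively (adj G) (z # as)" "adj G (last as) z"
        using suc \<open>as \<noteq> []\<close> by (auto simp: successively_append_iff successively_Cons)
      have "graph_cycle G (z # as)"
        unfolding graph_cycle_def walk_def
        using len dz suc' \<open>as \<noteq> []\<close> nb_walk_verts[OF G Cons.prems] q2 by auto
      with acyc show False by blast
    qed
  qed simp
qed

text \<open>After the common beginning is stripped, one walk reversed and joined to the other is
  again non-backtracking, yet it would visit the common end vertex twice.\<close>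

lemma nb_walk_unique:
  assumes G: "simple_graph G" and acyc: "\<nexists>c. graph_cycle G c"
    and "nb_walk G p" "nb_walk G p'" "hd p = hd p'" "last p = last p'"
  shows "p = p'"
  using assms(3-)
proof (induction p arbitrary: p')
  case Nil
  then show ?case by simp
next
  case (Cons z q)
  obtain q' where p': "p' = z # q'" using Cons.prems by (cases p') auto
  have d: "distinct (z # q)" "distinct (z # q')"
    using nb_walk_distinct[OF G acyc] Cons.prems p' by blast+
  have eq: "q = [] \<longleftrightarrow> q' = []"
    using d Cons.prems p' by (metis distinct.simps(2) last.simps last_in_set)
  show ?case
  proof (cases "q = []")
    case True then show ?thesis using eq p' by simp
  next
    case False
    then have q': "q' \<noteq> []" using eq by simp
    have nq: "nb_walk G q" "nb_walk G q'"
      using nb_walk_ConsD[OF G] Cons.prems p' False q' by (metis list.exhaust)+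
    show ?thesis
    proof (cases "hd q = hd q'")
      case True
      then show ?thesis using Cons.IH[OF nq(1) nq(2)] Cons.prems p' False q' by auto
    next
      case False
      have "nb_walk G (rev q' @ z # q)"
      proof (rule nb_walk_append[OF G])
        show "nb_walk G (rev q' @ [z])"
          using nb_walk_rev[OF G Cons.prems(2)] p' by simp
        show "nb_walk G (z # q)" by fact
        show "last (rev q') \<noteq> hd q" using q' False by (simp add: last_rev)
      qed
      then have "distinct (rev q' @ z # q)" by (rule nb_walk_distinct[OF G acyc])
      moreover have "last q = last q'" using Cons.prems p' \<open>q \<noteq> []\<close> q' by simp
      then have "last q \<in> set q \<inter> set q'" using \<open>q \<noteq> []\<close> q' by (metis IntI last_in_set)
      ultimately show ?thesis by auto
    qed
  qed
qed

text \<open>Induction from the end of the list: a new step is prepended, unless it would be undone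
  by the first step of the reduced walk, which is then dropped instead.\<close>

lemma walk_imp_nb_walk:
  assumes G: "simple_graph G" and "walk G u p v"
  shows "\<exists>q. nb_walk G q \<and> hd q = u \<and> last q = v \<and> length q \<le> length p"
  using assms(2)
proof (induction p arbitrary: u)
  case Nil
  then show ?case by (simp add: walk_def)
next
  case (Cons a p)
  show ?case
  proof (cases p)
    case Nil
    then show ?thesis using Cons.prems by (intro exI[of _ "[u]"]) (auto simp: walk_def)
  next
    case (Cons w p')
    have wk: "walk G w p v" and uw: "adj G u w"
      using Cons.prems Cons by (auto simp: walk_def)
    obtain q where q: "nb_walk G q" "hd q = w" "last q = v" "length q \<le> length p"
      using Cons.IH[OF wk] by blast
    then obtain q' where q': "q = w # q'" by (cases q) auto
    show ?thesis
    proof (cases "q' \<noteq> [] \<and> hd q' = u")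
      case True
      then have "nb_walk G q'"
        using nb_walk_ConsD[OF G, of w u "tl q'"] q q' by (cases q') auto
      then show ?thesis using True q q' by (intro exI[of _ q']) auto
    next
      case False
      then have "nb_walk G (u # q)"
        using q q' uw G by (cases q') (auto dest: simple_graph_adjD)
      then show ?thesis using q q' by (intro exI[of _ "u # q"]) auto
    qed
  qed
qed

text \<open>\<open>par x\<close> is the second vertex of the unique non-backtracking walk from
  \<open>x\<close> to the root. The three properties are what it takes to orient all edges towards
  \<open>r\<close>: a parent, all other neighbours being children, and no two vertices that are
  parents of each other.\<close>

lemma tree_parent:
  assumes "is_tree T" "r \<in> verts T"
  obtains par where
    "\<And>x. x \<in> verts T \<Longrightarrow> x \<noteq> r \<Longrightarrow> adj T x (par x)"
    "\<And>x y. adj T x y \<Longrightarrow> x \<noteq> r \<Longrightarrow> y \<noteq> par x \<Longrightarrow> y \<noteq> r \<and> par y = x"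
    "\<And>x. x \<in> verts T \<Longrightarrow> x \<noteq> r \<Longrightarrow> par x \<noteq> r \<Longrightarrow> par (par x) \<noteq> x"
proof -
  have T: "simple_graph T" and acyc: "\<nexists>c. graph_cycle T c" and con: "graph_connected T"
    using assms by (auto simp: is_tree_def)
  have "\<exists>q. nb_walk T q \<and> hd q = x \<and> last q = r" if x: "x \<in> verts T" for x
  proof -
    have "\<exists>p. walk T x p r" using con x assms(2) by (simp add: graph_connected_def)
    then obtain p where "walk T x p r" ..
    from walk_imp_nb_walk[OF T this] show ?thesis by blast
  qed
  then have "\<forall>x\<in>verts T. \<exists>q. nb_walk T q \<and> hd q = x \<and> last q = r" by blast
  from bchoice[OF this]
  obtain P where P: "\<And>x. x \<in> verts T \<Longrightarrow> nb_walk T (P x) \<and> hd (P x) = x \<and> last (P x) = r"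
    by blast
  define par where "par x = P x ! 1" for x
  have form: "\<exists>q. P x = x # par x # q" if x: "x \<in> verts T" "x \<noteq> r" for x
  proof -
    obtain q where "P x = x # q" using P[OF x(1)] by (cases "P x") auto
    moreover from this have "q \<noteq> []" using P[OF x(1)] x(2) by auto
    ultimately show ?thesis by (cases q) (auto simp: par_def)
  qed
  have adjp: "adj T x (par x)" if x: "x \<in> verts T" "x \<noteq> r" for x
  proof -
    obtain q where "P x = x # par x # q" using form[OF x] by blast
    then have "nb_walk T (x # par x # q)" using P[OF x(1)] by simp
    from nb_walk_ConsD(2)[OF T this] show ?thesis by (rule simple_graph_adjD(4)[OF T])
  qed
  show ?thesis
  proof (rule that[of par])
    show "adj T x (par x)" if "x \<in> verts T" "x \<noteq> r" for x using that by (rule adjp)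
    show "y \<noteq> r \<and> par y = x" if xy: "adj T x y" "x \<noteq> r" "y \<noteq> par x" for x y
    proof -
      have x: "x \<in> verts T" and y: "y \<in> verts T" using simple_graph_adjD[OF T xy(1)] by auto
      obtain q where q: "P x = x # par x # q" using form[OF x xy(2)] by blast
      have nb: "nb_walk T (y # P x)" using q xy P[OF x] by simp
      have Py: "P y = y # P x"
        by (rule nb_walk_unique[OF T acyc _ nb]) (use P[OF y] P[OF x] q in simp_all)
      have "par y = hd (P x)" unfolding par_def Py using q by simp
      moreover have "y \<notin> set (P x)" using nb_walk_distinct[OF T acyc nb] by simp
      moreover have "r \<in> set (P x)" using P[OF x] q last_in_set[of "P x"] by simp
      ultimately show ?thesis using P[OF x] by metis
    qed
    show "par (par x) \<noteq> x" if x: "x \<in> verts T" "x \<noteq> r" "par x \<noteq> r" for x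
    proof -
      obtain q where q: "P x = x # par x # q" using form[OF x(1,2)] by blast
      have px: "par x \<in> verts T" using adjp[OF x(1,2)] simple_graph_adjD[OF T] by blast
      have "nb_walk T (x # par x # q)" using q P[OF x(1)] by simp
      then have nb: "nb_walk T (par x # q)" by (rule nb_walk_ConsD[OF T])
      have "P (par x) = par x # q"
        by (rule nb_walk_unique[OF T acyc _ nb]) (use P[OF px] P[OF x(1)] q in simp_all)
      then obtain q' where "q = par (par x) # q'" using form[OF px x(3)] by auto
      moreover have "distinct (P x)" using nb_walk_distinct[OF T acyc] P[OF x(1)] by blast
      ultimately show ?thesis using q by auto
    qed
  qed
qed

section \<open>Truncated Green functions\<close>

definition loc_finite :: "'a sgraph \<Rightarrow> bool" where
  "loc_finite G \<longleftrightarrow> (\<forall>x. finite (nbrs G x))"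

lemma finite_nbrs [simp]: "loc_finite G \<Longrightarrow> finite (nbrs G x)"
  by (simp add: loc_finite_def)

lemma finite_succs [simp]: "loc_finite G \<Longrightarrow> finite (succs G x b)"
  by (simp add: succs_def)

text \<open>Generating function in \<open>1 / l\<close> of the walks in the branch at \<open>b\<close> that pass from \<open>b\<close>
  to \<open>x\<close> for the first time, truncated to finitely many walks.\<close>

primrec passage :: "'a sgraph \<Rightarrow> real \<Rightarrow> nat \<Rightarrow> 'a \<Rightarrow> 'a \<Rightarrow> real" where
  "passage G l 0 x b = 0"
| "passage G l (Suc N) x b =
     (1 + passage G l N x b * (\<Sum>c\<in>succs G x b. passage G l N b c)) / l"

lemma passage_nonneg: "l > 0 \<Longrightarrow> passage G l N x b \<ge> 0"
  by (induction N arbitrary: x b) (auto intro!: divide_nonneg_pos add_nonneg_nonneg mult_nonneg_nonneg sum_nonneg)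

lemma passage_Suc_mono: "l > 0 \<Longrightarrow> passage G l N x b \<le> passage G l (Suc N) x b"
proof (induction N arbitrary: x b)
  case (Suc N)
  have "passage G l N x b * (\<Sum>c\<in>succs G x b. passage G l N b c)
     \<le> passage G l (Suc N) x b * (\<Sum>c\<in>succs G x b. passage G l (Suc N) b c)"
    by (intro mult_mono sum_mono sum_nonneg passage_nonneg Suc)
  then show ?case using \<open>l > 0\<close>
    unfolding passage.simps(2)[of G l "Suc N"] passage.simps(2)[of G l N x b]
    by (intro divide_right_mono) (auto simp del: passage.simps(2) simp flip: passage.simps(2))
qed simp

lemma passage_mono: "l > 0 \<Longrightarrow> N \<le> N' \<Longrightarrow> passage G l N x b \<le> passage G l N' x b"
  by (rule lift_Suc_mono_le[of "\<lambda>N. passage G l N x b"]) (auto simp del: passage.simps intro: passage_Suc_mono)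

lemma passage_ge: "l > 0 \<Longrightarrow> N \<ge> 1 \<Longrightarrow> passage G l N x b \<ge> 1 / l"
  using passage_mono[of l 1 N G x b] by simp

lemma passage_antimono:
  assumes "0 < l" "l \<le> l'"
  shows "passage G l' N x b \<le> passage G l N x b"
proof (induction N arbitrary: x b)
  case (Suc N)
  have "passage G l' N x b * (\<Sum>c\<in>succs G x b. passage G l' N b c)
     \<le> passage G l N x b * (\<Sum>c\<in>succs G x b. passage G l N b c)"
    using Suc assms by (intro mult_mono sum_mono sum_nonneg passage_nonneg) auto
  moreover have "passage G l' N x b * (\<Sum>c\<in>succs G x b. passage G l' N b c) \<ge> 0"
    using assms by (intro mult_nonneg_nonneg sum_nonneg passage_nonneg) auto
  ultimately show ?case using assms by (auto intro!: frac_le)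
qed simp

text \<open>The recursion only looks at \<open>succs\<close>, on which a cover map is bijective.
  First passage functions are thus functions on the arcs of \<open>T\<close>, shared by all graphs
  that it covers.\<close>

lemma passage_cover:
  assumes "simple_graph T" "simple_graph G" "cover_map \<pi> T G" "adj T x b"
  shows "passage G l N (\<pi> x) (\<pi> b) = passage T l N x b"
  using assms(4)
proof (induction N arbitrary: x b)
  case (Suc N)
  have "(\<Sum>c\<in>succs G (\<pi> x) (\<pi> b). passage G l N (\<pi> b) c) = (\<Sum>c\<in>succs T x b. passage G l N (\<pi> b) (\<pi> c))"
    using cover_map_bij_succs[OF assms(1-3) Suc.prems] by (rule sum.reindex_bij_betw[symmetric])
  also have "\<dots> = (\<Sum>c\<in>succs T x b. passage T l N b c)"
    using Suc by (intro sum.cong) auto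
  finally show ?case using Suc by simp
qed simp

text \<open>The partial sum over k < \<open>M\<close> of A^k / l^(k+1), A the adjacency operator:
  the Neumann series of its resolvent at \<open>l\<close>, of which no convergence is
  required.\<close>

primrec green :: "'a sgraph \<Rightarrow> real \<Rightarrow> nat \<Rightarrow> 'a \<Rightarrow> 'a \<Rightarrow> real" where
  "green G l 0 v y = 0"
| "green G l (Suc M) v y = (of_bool (v = y) + (\<Sum>z\<in>nbrs G y. green G l M v z)) / l"

text \<open>The contribution to the Green function of all walks homotopic to the non-backtracking
  walk \<open>p\<close>. Lists of vertices are read backwards: the last element is the starting point.\<close>

primrec nb_green :: "'a sgraph \<Rightarrow> real \<Rightarrow> nat \<Rightarrow> 'a list \<Rightarrow> real" where
  "nb_green G l 0 p = 0"
| "nb_green G l (Suc M) p = (of_bool (tl p = []) + (if tl p = [] then 0 else nb_green G l M (tl p))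
     + (\<Sum>z\<in>{z. nb_walk G (z # p)}. nb_green G l M (z # p))) / l"

lemma nb_walk_Cons_iff:
  assumes "nb_walk G (x # q)"
  shows "nb_walk G (z # x # q) \<longleftrightarrow> adj G x z \<and> (q \<noteq> [] \<longrightarrow> z \<noteq> hd q)"
  using assms by (cases q) auto

lemma nb_walk_extensions:
  assumes "nb_walk G (z # x # q)" "simple_graph G"
  shows "{u. nb_walk G (u # z # x # q)} = succs G x z"
  unfolding nb_walk_Cons_iff[OF assms(1)] set_eq_iff by simp

lemma finite_nb_walk_extensions:
  assumes "loc_finite G" "simple_graph G" "nb_walk G p"
  shows "finite {u. nb_walk G (u # p)}"
proof -
  obtain x q where p: "p = x # q" using assms by (cases p) auto
  have "{u. nb_walk G (u # p)} \<subseteq> nbrs G x"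
    using assms(3) unfolding p by (auto simp only: nb_walk_Cons_iff mem_Collect_eq mem_nbrs)
  then show ?thesis using assms by (meson finite_nbrs finite_subset)
qed

lemma nb_green_nonneg: "l > 0 \<Longrightarrow> nb_green G l M p \<ge> 0"
  by (induction M arbitrary: p) (auto intro!: divide_nonneg_pos add_nonneg_nonneg sum_nonneg)

lemma nb_green_Suc_mono: "l > 0 \<Longrightarrow> nb_green G l M p \<le> nb_green G l (Suc M) p"
proof (induction M arbitrary: p)
  case 0
  then show ?case by (simp add: sum_nonneg)
next
  case (Suc M)
  have "(\<Sum>z\<in>{z. nb_walk G (z # p)}. nb_green G l M (z # p)) \<le> (\<Sum>z\<in>{z. nb_walk G (z # p)}. nb_green G l (Suc M) (z # p))"
    by (intro sum_mono Suc.IH Suc.prems)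
  moreover have "nb_green G l M (tl p) \<le> nb_green G l (Suc M) (tl p)" by (intro Suc.IH Suc.prems)
  ultimately show ?case using \<open>l > 0\<close>
    unfolding nb_green.simps(2)[of G l "Suc M"] nb_green.simps(2)[of G l M p]
    by (intro divide_right_mono add_mono) (auto simp del: nb_green.simps(2))
qed

lemma nb_green_mono: "l > 0 \<Longrightarrow> M \<le> M' \<Longrightarrow> nb_green G l M p \<le> nb_green G l M' p"
  by (rule lift_Suc_mono_le[of "\<lambda>M. nb_green G l M p"]) (auto simp del: nb_green.simps intro: nb_green_Suc_mono)

text \<open>A last step into \<open>y\<close> either extends the reduced walk \<open>tl p\<close> or
  cancels the head of some \<open>z # p\<close>. All these reduced predecessors are different walks,
  so summing the recursion of \<open>nb_green\<close> over \<open>Q\<close> and grouping by the head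
  \<open>z\<close> stays below the recursion of \<open>green\<close>.\<close>

lemma sum_nb_green_le_green:
  assumes G: "simple_graph G" "loc_finite G" and l: "l > 0"
    and "finite Q" "\<And>p. p \<in> Q \<Longrightarrow> nb_walk G p \<and> last p = v \<and> hd p = y"
  shows "(\<Sum>p\<in>Q. nb_green G l M p) \<le> green G l M v y"
  using assms(4-)
proof (induction M arbitrary: Q y)
  case (Suc M)
  let ?ext = "\<lambda>p. {z. nb_walk G (z # p)}"
  define Q1 where "Q1 = {p \<in> Q. tl p \<noteq> []}"
  define R where "R = tl ` Q1 \<union> (\<Union>p\<in>Q. (\<lambda>z. z # p) ` ?ext p)"
  define Rz where "Rz z = {q \<in> R. hd q = z}" for z
  have hdy: "p = y # tl p" if "p \<in> Q" for p
    using Suc.prems(2)[OF that] by (cases p) auto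
  have fin_ext: "finite (?ext p)" if "p \<in> Q" for p
    using finite_nb_walk_extensions G Suc.prems(2)[OF that] by blast
  have finR: "finite R" unfolding R_def Q1_def using Suc.prems(1) fin_ext by auto
  have Q1form: "\<exists>x q. p = y # x # q \<and> nb_walk G (x # q) \<and> adj G y x \<and> last (x # q) = v" if "p \<in> Q1" for p
  proof -
    have "p \<in> Q" "tl p \<noteq> []" using that by (auto simp: Q1_def)
    then obtain x q where p: "p = y # x # q" using hdy by (metis list.exhaust)
    then have "nb_walk G (y # x # q)" using Suc.prems(2) \<open>p \<in> Q\<close> by blast
    from nb_walk_ConsD[OF G(1) this] show ?thesis
      using p Suc.prems(2)[OF \<open>p \<in> Q\<close>] simple_graph_adjD(4)[OF G(1)] by auto
  qed
  have Rprop: "nb_walk G q \<and> last q = v \<and> adj G y (hd q)" if "q \<in> R" for q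
    using that unfolding R_def
  proof
    assume "q \<in> tl ` Q1"
    then show ?thesis using Q1form by fastforce
  next
    assume "q \<in> (\<Union>p\<in>Q. (\<lambda>z. z # p) ` ?ext p)"
    then obtain p z where p: "p \<in> Q" "nb_walk G (z # p)" "q = z # p" by auto
    then have "nb_walk G (z # y # tl p)" using hdy by metis
    then have "adj G y z" by (rule nb_walk_ConsD[OF G(1)])
    then show ?thesis using p Suc.prems(2)[OF p(1)] by auto
  qed
  \<comment> \<open>A common element would make some \<open>p\<close> in \<open>Q1\<close> begin
    with \<open>y # z # y\<close>, a backtrack.\<close>
  have disj: "tl ` Q1 \<inter> (\<Union>p\<in>Q. (\<lambda>z. z # p) ` ?ext p) = {}"
  proof (rule ccontr)
    assume "\<not> ?thesis"
    then obtain p p' z where *: "p \<in> Q1" "p' \<in> Q" "tl p = z # p'" by auto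
    then have "p = y # z # y # tl p'" using hdy Q1form by (metis list.sel(3))
    moreover have "nb_walk G p" using * Suc.prems(2) by (auto simp: Q1_def)
    ultimately show False by (metis nb_walk.simps(4))
  qed
  have inj1: "inj_on tl Q1"
    using Q1form by (intro inj_onI) (metis list.sel(3))
  have "(\<Sum>p\<in>Q. (if tl p = [] then 0 else nb_green G l M (tl p)) + (\<Sum>z\<in>?ext p. nb_green G l M (z # p)))
      = (\<Sum>p\<in>Q1. nb_green G l M (tl p)) + (\<Sum>p\<in>Q. \<Sum>z\<in>?ext p. nb_green G l M (z # p))"
    unfolding sum.distrib Q1_def sum.inter_filter[OF Suc.prems(1)]
    by (intro arg_cong2[of _ _ _ _ "(+)"] sum.cong) auto
  also have "(\<Sum>p\<in>Q1. nb_green G l M (tl p)) = (\<Sum>q\<in>tl ` Q1. nb_green G l M q)"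
    by (simp add: sum.reindex[OF inj1])
  also have "(\<Sum>p\<in>Q. \<Sum>z\<in>?ext p. nb_green G l M (z # p))
      = (\<Sum>p\<in>Q. \<Sum>q\<in>(\<lambda>z. z # p) ` ?ext p. nb_green G l M q)"
    by (intro sum.cong refl, subst sum.reindex) (auto simp: inj_on_def)
  also have "\<dots> = (\<Sum>q\<in>(\<Union>p\<in>Q. (\<lambda>z. z # p) ` ?ext p). nb_green G l M q)"
    using Suc.prems(1) fin_ext by (intro sum.UNION_disjoint[symmetric]) auto
  also have "(\<Sum>q\<in>tl ` Q1. nb_green G l M q) + \<dots> = (\<Sum>q\<in>R. nb_green G l M q)"
    unfolding R_def using Suc.prems(1) fin_ext disj
    by (intro sum.union_disjoint[symmetric]) (auto simp: Q1_def)
  also have "\<dots> = (\<Sum>z\<in>nbrs G y. \<Sum>q\<in>Rz z. nb_green G l M q)"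
    unfolding Rz_def using G finR Rprop by (intro sum.group[symmetric]) auto
  also have "\<dots> \<le> (\<Sum>z\<in>nbrs G y. green G l M v z)"
    by (intro sum_mono Suc.IH) (use finR Rprop in \<open>auto simp: Rz_def\<close>)
  finally have main: "(\<Sum>p\<in>Q. (if tl p = [] then 0 else nb_green G l M (tl p)) + (\<Sum>z\<in>?ext p. nb_green G l M (z # p)))
      \<le> (\<Sum>z\<in>nbrs G y. green G l M v z)" .
  have triv: "{p \<in> Q. tl p = []} \<subseteq> (if v = y then {[y]} else {})"
  proof
    fix p assume "p \<in> {p \<in> Q. tl p = []}"
    then have "p = [y]" "last p = v" using hdy Suc.prems(2) by fastforce+
    then show "p \<in> (if v = y then {[y]} else {})" by auto
  qed
  have "(\<Sum>p\<in>Q. of_bool (tl p = [])) = real (card {p \<in> Q. tl p = []})"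
    using Suc.prems(1) by (simp add: sum.If_cases of_bool_def Int_def)
  also have "\<dots> \<le> of_bool (v = y)"
    using card_mono[OF _ triv] by (auto split: if_splits)
  finally have triv': "(\<Sum>p\<in>Q. of_bool (tl p = [])) \<le> (of_bool (v = y) :: real)" .
  have "(\<Sum>p\<in>Q. nb_green G l (Suc M) p) = ((\<Sum>p\<in>Q. of_bool (tl p = []))
      + (\<Sum>p\<in>Q. (if tl p = [] then 0 else nb_green G l M (tl p)) + (\<Sum>z\<in>?ext p. nb_green G l M (z # p)))) / l"
    by (simp add: sum_divide_distrib[symmetric] sum.distrib add.assoc)
  also have "\<dots> \<le> (of_bool (v = y) + (\<Sum>z\<in>nbrs G y. green G l M v z)) / l"
    using triv' main l by (intro divide_right_mono add_mono) auto
  finally show ?case by simp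
qed simp

text \<open>Depth of \<open>nb_green\<close> that accounts for \<open>passage\<close> at depth
  \<open>N\<close>: one last step, plus two nested passages, one out of a sub-branch and one along
  the arc itself.\<close>

primrec passage_cost :: "nat \<Rightarrow> nat" where
  "passage_cost 0 = 0"
| "passage_cost (Suc N) = Suc (2 * passage_cost N)"

text \<open>In the universal cover, walks in the class of \<open>z # x # q\<close> split at the last
  visit to the lifted \<open>x\<close>; reversed, the remainder is a first passage from
  \<open>z\<close> to \<open>x\<close>. Expanding the last step and using the induction hypothesis
  twice, for the arc into \<open>z\<close> and for the arc into \<open>u\<close>, reproduces the
  recursion of \<open>passage\<close>.\<close>

lemma nb_green_Cons_ge:
  assumes G: "simple_graph G" "loc_finite G" and l: "l > 0"
  shows "nb_walk G (z # x # q) \<Longrightarrow>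
    passage G l N x z * nb_green G l M (x # q) \<le> nb_green G l (passage_cost N + M) (z # x # q)"
proof (induction N arbitrary: z x q M)
  case 0
  then show ?case by (simp add: nb_green_nonneg l)
next
  case (Suc N)
  let ?f = "passage_cost N"
  let ?M = "2 * ?f + M"
  note ext = nb_walk_extensions[OF Suc.prems G(1)]
  have step: "passage G l N z u * (passage G l N x z * nb_green G l M (x # q))
      \<le> nb_green G l ?M (u # z # x # q)" if "u \<in> succs G x z" for u
  proof -
    have nb: "nb_walk G (u # z # x # q)" using that ext by blast
    have "passage G l N z u * (passage G l N x z * nb_green G l M (x # q))
        \<le> passage G l N z u * nb_green G l (?f + M) (z # x # q)"
      using Suc l by (intro mult_left_mono passage_nonneg)
    also have "\<dots> \<le> nb_green G l (?f + (?f + M)) (u # z # x # q)"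
      by (rule Suc.IH[OF nb])
    finally show ?thesis by (simp add: mult_2 add.assoc)
  qed
  have "passage G l (Suc N) x z * nb_green G l M (x # q)
     = (nb_green G l M (x # q) + (\<Sum>u\<in>succs G x z. passage G l N z u * (passage G l N x z * nb_green G l M (x # q)))) / l"
    by (simp add: algebra_simps sum_distrib_left sum_distrib_right)
  also have "\<dots> \<le> (nb_green G l ?M (x # q) + (\<Sum>u\<in>succs G x z. nb_green G l ?M (u # z # x # q))) / l"
    using l step by (intro divide_right_mono add_mono sum_mono nb_green_mono) auto
  also have "\<dots> = nb_green G l (Suc ?M) (z # x # q)"
    unfolding nb_green.simps(2) ext by simp
  finally show ?case by simp
qed

text \<open>The factor 1 / l is the contribution of the empty walk to the returns at the starting
  point; all other returns there are given away.\<close>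

fun nb_weight :: "real \<Rightarrow> ('a \<Rightarrow> 'a \<Rightarrow> real) \<Rightarrow> 'a list \<Rightarrow> real" where
  "nb_weight l w (z # x # q) = w x z * nb_weight l w (x # q)"
| "nb_weight l w p = 1 / l"

lemma nb_weight_le_nb_green:
  assumes G: "simple_graph G" "loc_finite G" and l: "l > 0"
  shows "nb_walk G p \<Longrightarrow>
    nb_weight l (passage G l N) p \<le> nb_green G l (1 + passage_cost N * (length p - 1)) p"
proof (induction p rule: induct_list012)
  case (2 x)
  have "0 \<le> (\<Sum>z | adj G x z. (0::real))" by simp
  then show ?case using l by simp
next
  case (3 z x q)
  have "nb_walk G (x # q)" using nb_walk_ConsD[OF G(1) 3(3)] by simp
  then have "nb_weight l (passage G l N) (z # x # q) \<le>
     passage G l N x z * nb_green G l (1 + passage_cost N * (length (x # q) - 1)) (x # q)"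
    unfolding nb_weight.simps(1) by (intro mult_left_mono passage_nonneg 3(2) l)
  also have "\<dots> \<le> nb_green G l (passage_cost N + (1 + passage_cost N * (length (x # q) - 1))) (z # x # q)"
    by (rule nb_green_Cons_ge[OF G l 3(3)])
  finally show ?case by (simp add: add.commute)
qed simp

lemma sum_nb_weight_le_green:
  assumes G: "simple_graph G" "loc_finite G" and l: "l > 0"
    and Q: "finite Q" "\<And>p. p \<in> Q \<Longrightarrow> nb_walk G p \<and> last p = v \<and> hd p = y"
    and len: "\<And>p. p \<in> Q \<Longrightarrow> 1 + passage_cost N * (length p - 1) \<le> M"
  shows "(\<Sum>p\<in>Q. nb_weight l (passage G l N) p) \<le> green G l M v y"
proof -
  have "(\<Sum>p\<in>Q. nb_weight l (passage G l N) p) \<le> (\<Sum>p\<in>Q. nb_green G l M p)"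
    by (intro sum_mono order_trans[OF nb_weight_le_nb_green[OF G l] nb_green_mono[OF l len]])
      (use Q in auto)
  also have "\<dots> \<le> green G l M v y"
    by (rule sum_nb_green_le_green[OF G l Q])
  finally show ?thesis .
qed

section \<open>The spectral radius\<close>

text \<open>Cauchy-Schwarz after splitting 1 into \<open>sqrt (t x y)\<close> and
  \<open>sqrt (t y x)\<close>; the sum over \<open>x\<close> of \<open>t y x\<close> is then a row
  sum at \<open>y\<close>. Only rows in \<open>X\<close> and next to it are used, so one bad row
  elsewhere is harmless.\<close>

lemma schur_test_finite:
  fixes t :: "'a \<Rightarrow> 'a \<Rightarrow> real"
  assumes G: "simple_graph G" "loc_finite G" and X: "finite X"
    and t: "\<And>x y. adj G x y \<Longrightarrow> t x y > 0" "\<And>x y. adj G x y \<Longrightarrow> t x y * t y x = 1"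
    and row: "\<And>x. x \<in> X \<union> (\<Union>x\<in>X. nbrs G x) \<Longrightarrow> (\<Sum>y\<in>nbrs G x. t x y) \<le> c"
    and c: "c \<ge> 0"
  shows "(\<Sum>x\<in>X. (adj_op G f x)\<^sup>2) \<le> c\<^sup>2 * (\<Sum>y\<in>(\<Union>x\<in>X. nbrs G x). (f y)\<^sup>2)"
proof -
  define Y where "Y = (\<Union>x\<in>X. nbrs G x)"
  have finY: "finite Y" using X G by (auto simp: Y_def)
  have "(adj_op G f x)\<^sup>2 \<le> c * (\<Sum>y\<in>nbrs G x. t y x * (f y)\<^sup>2)" if "x \<in> X" for x
  proof -
    have "adj_op G f x = (\<Sum>y\<in>nbrs G x. sqrt (t x y) * (sqrt (t y x) * f y))"
      unfolding adj_op_def nbrs_def[symmetric]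
    proof (intro sum.cong refl)
      fix y assume "y \<in> nbrs G x"
      then have "sqrt (t x y) * sqrt (t y x) = 1" using t(2)[of x y] by (simp flip: real_sqrt_mult)
      then show "f y = sqrt (t x y) * (sqrt (t y x) * f y)" by (simp flip: mult.assoc)
    qed
    then have "(adj_op G f x)\<^sup>2 \<le> (\<Sum>y\<in>nbrs G x. (sqrt (t x y))\<^sup>2) * (\<Sum>y\<in>nbrs G x. (sqrt (t y x) * f y)\<^sup>2)"
      using Cauchy_Schwarz_ineq_sum by metis
    also have "\<dots> = (\<Sum>y\<in>nbrs G x. t x y) * (\<Sum>y\<in>nbrs G x. t y x * (f y)\<^sup>2)"
      using t(1) simple_graph_adjD(4)[OF G(1)]
      by (intro arg_cong2[of _ _ _ _ "(*)"] sum.cong) (auto simp: power_mult_distrib less_imp_le)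
    also have "\<dots> \<le> c * (\<Sum>y\<in>nbrs G x. t y x * (f y)\<^sup>2)"
      using row[of x] that t(1) simple_graph_adjD(4)[OF G(1)]
      by (intro mult_right_mono sum_nonneg) (auto simp: less_imp_le)
    finally show ?thesis .
  qed
  then have "(\<Sum>x\<in>X. (adj_op G f x)\<^sup>2) \<le> (\<Sum>x\<in>X. c * (\<Sum>y\<in>nbrs G x. t y x * (f y)\<^sup>2))"
    by (rule sum_mono)
  also have "\<dots> = c * (\<Sum>x\<in>X. \<Sum>y\<in>{y. y \<in> Y \<and> adj G x y}. t y x * (f y)\<^sup>2)"
    unfolding sum_distrib_left by (intro sum.cong) (auto simp: Y_def)
  also have "\<dots> = c * (\<Sum>y\<in>Y. \<Sum>x\<in>{x. x \<in> X \<and> adj G x y}. t y x * (f y)\<^sup>2)"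
    using X finY by (subst sum.swap_restrict) auto
  also have "\<dots> \<le> c * (\<Sum>y\<in>Y. c * (f y)\<^sup>2)"
  proof (intro mult_left_mono sum_mono c)
    fix y assume y: "y \<in> Y"
    have "(\<Sum>x\<in>{x. x \<in> X \<and> adj G x y}. t y x * (f y)\<^sup>2) = (\<Sum>x\<in>{x. x \<in> X \<and> adj G x y}. t y x) * (f y)\<^sup>2"
      by (simp add: sum_distrib_right)
    also have "(\<Sum>x\<in>{x. x \<in> X \<and> adj G x y}. t y x) \<le> (\<Sum>x\<in>nbrs G y. t y x)"
      using G t(1) by (intro sum_mono2) (auto dest: simple_graph_adjD simp: less_imp_le)
    also have "\<dots> \<le> c" using y by (intro row) (auto simp: Y_def)
    finally show "(\<Sum>x\<in>{x. x \<in> X \<and> adj G x y}. t y x * (f y)\<^sup>2) \<le> c * (f y)\<^sup>2"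
      by (simp add: mult_right_mono)
  qed
  finally show ?thesis by (simp add: Y_def power2_eq_square sum_distrib_left mult.assoc)
qed

lemma adj_op_ell2_bound:
  assumes G: "simple_graph G" "loc_finite G" and c: "c \<ge> 0"
    and bound: "\<And>X. finite X \<Longrightarrow> X \<subseteq> verts G \<Longrightarrow>
      (\<Sum>x\<in>X. (adj_op G f x)\<^sup>2) \<le> c\<^sup>2 * (\<Sum>y\<in>(\<Union>x\<in>X. nbrs G x). (f y)\<^sup>2)"
    and f: "f \<in> ell2 (verts G)"
  shows "ell2_norm (verts G) (adj_op G f) \<le> c * ell2_norm (verts G) f"
proof -
  let ?V = "verts G"
  have sf: "(\<lambda>v. (f v)\<^sup>2) summable_on ?V" using f by (simp add: ell2_def)
  have le: "(\<Sum>x\<in>X. (adj_op G f x)\<^sup>2) \<le> c\<^sup>2 * (\<Sum>\<^sub>\<infinity>v\<in>?V. (f v)\<^sup>2)" if "finite X" "X \<subseteq> ?V" for X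
  proof -
    have "(\<Sum>y\<in>(\<Union>x\<in>X. nbrs G x). (f y)\<^sup>2) \<le> (\<Sum>\<^sub>\<infinity>v\<in>?V. (f v)\<^sup>2)"
      using that G nbrs_subset_verts[OF G(1)] by (intro finite_sum_le_infsum sf) auto
    then show ?thesis using bound[OF that] by (meson mult_left_mono order_trans zero_le_power2)
  qed
  have "(\<lambda>v. (adj_op G f v)\<^sup>2) summable_on ?V"
    using le by (intro nonneg_bdd_above_summable_on) (auto simp: bdd_above_def)
  then have "(\<Sum>\<^sub>\<infinity>v\<in>?V. (adj_op G f v)\<^sup>2) \<le> c\<^sup>2 * (\<Sum>\<^sub>\<infinity>v\<in>?V. (f v)\<^sup>2)"
    using le by (intro infsum_le_finite_sums)
  then have "sqrt (\<Sum>\<^sub>\<infinity>v\<in>?V. (adj_op G f v)\<^sup>2) \<le> sqrt (c\<^sup>2 * (\<Sum>\<^sub>\<infinity>v\<in>?V. (f v)\<^sup>2))"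
    by (rule real_sqrt_le_mono)
  then show ?thesis using c by (simp add: ell2_norm_def real_sqrt_mult)
qed

lemma ell2_norm_nonneg: "ell2_norm V f \<ge> 0"
  by (simp add: ell2_norm_def infsum_nonneg)

lemma zero_in_ell2: "(\<lambda>_. 0) \<in> ell2 V"
  by (simp add: ell2_def)

lemma spectral_radius_le:
  assumes G: "simple_graph G" "loc_finite G" and c: "c \<ge> 0"
    and bound: "\<And>X f. finite X \<Longrightarrow> X \<subseteq> verts G \<Longrightarrow>
      (\<Sum>x\<in>X. (adj_op G f x)\<^sup>2) \<le> c\<^sup>2 * (\<Sum>y\<in>(\<Union>x\<in>X. nbrs G x). (f y)\<^sup>2)"
  shows "graph_spectral_radius G \<le> c"
  unfolding graph_spectral_radius_def
proof (rule cSUP_least)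
  show "ell2 (verts G) \<noteq> {}" using zero_in_ell2 by blast
  fix f assume f: "f \<in> ell2 (verts G)"
  have "ell2_norm (verts G) (adj_op G f) \<le> c * ell2_norm (verts G) f"
    by (rule adj_op_ell2_bound[OF G c bound f])
  then show "ell2_norm (verts G) (adj_op G f) / ell2_norm (verts G) f \<le> c"
    using c ell2_norm_nonneg[of "verts G" f] by (cases "ell2_norm (verts G) f = 0") (auto simp: divide_le_eq)
qed

lemma bounded_degree_adj_op:
  assumes G: "simple_graph G" "loc_finite G" and deg: "\<And>x. card (nbrs G x) \<le> d"
    and X: "finite X"
  shows "(\<Sum>x\<in>X. (adj_op G f x)\<^sup>2) \<le> (real d)\<^sup>2 * (\<Sum>y\<in>(\<Union>x\<in>X. nbrs G x). (f y)\<^sup>2)"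
  by (rule schur_test_finite[OF G X, of "\<lambda>_ _. 1"]) (use deg in auto)

lemma
  assumes G: "simple_graph G" "loc_finite G" and deg: "\<And>x. card (nbrs G x) \<le> d"
  shows adj_op_norm_le: "f \<in> ell2 (verts G) \<Longrightarrow>
      ell2_norm (verts G) (adj_op G f) \<le> graph_spectral_radius G * ell2_norm (verts G) f"
    and spectral_radius_nonneg: "graph_spectral_radius G \<ge> 0"
proof -
  let ?V = "verts G"
  let ?R = "\<lambda>f. ell2_norm ?V (adj_op G f) / ell2_norm ?V f"
  have b: "ell2_norm ?V (adj_op G f) \<le> real d * ell2_norm ?V f" if "f \<in> ell2 ?V" for f
    by (rule adj_op_ell2_bound[OF G _ bounded_degree_adj_op[OF G deg] that]) auto
  have "?R f \<le> real d" if "f \<in> ell2 ?V" for f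
    using b[OF that] ell2_norm_nonneg[of ?V f] by (cases "ell2_norm ?V f = 0") (auto simp: divide_le_eq)
  then have bdd: "bdd_above (?R ` ell2 ?V)" by (auto simp: bdd_above_def)
  have up: "?R f \<le> graph_spectral_radius G" if "f \<in> ell2 ?V" for f
    unfolding graph_spectral_radius_def by (rule cSUP_upper[OF that bdd])
  show "graph_spectral_radius G \<ge> 0"
    using up[OF zero_in_ell2] by (simp add: ell2_norm_def)
  show "ell2_norm ?V (adj_op G f) \<le> graph_spectral_radius G * ell2_norm ?V f" if f: "f \<in> ell2 ?V"
  proof (cases "ell2_norm ?V f = 0")
    \<comment> \<open>Here the quotient is 0 by convention and says nothing; the degree bound shows
      that the image has norm zero as well.\<close>
    case True
    then show ?thesis using b[OF f] by simp
  next
    case False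
    then have "ell2_norm ?V f > 0" using ell2_norm_nonneg[of ?V f] by simp
    then show ?thesis using up[OF f] by (simp add: divide_le_eq)
  qed
qed

lemma finite_support_ell2:
  assumes "finite S" "S \<subseteq> V" "\<And>v. v \<notin> S \<Longrightarrow> f v = 0"
  shows "f \<in> ell2 V" "ell2_norm V f = L2_set f S"
proof -
  have "(\<lambda>v. (f v)\<^sup>2) summable_on V \<longleftrightarrow> (\<lambda>v. (f v)\<^sup>2) summable_on S"
    by (rule summable_on_cong_neutral) (use assms in auto)
  then show "f \<in> ell2 V" using assms by (auto simp: ell2_def)
  have "(\<Sum>\<^sub>\<infinity>v\<in>V. (f v)\<^sup>2) = (\<Sum>\<^sub>\<infinity>v\<in>S. (f v)\<^sup>2)"
    by (rule infsum_cong_neutral) (use assms in auto)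
  then show "ell2_norm V f = L2_set f S" using assms by (simp add: ell2_norm_def L2_set_def)
qed

text \<open>A column g of the truncated resolvent has finite support, and in norm the next one is at
  most (1 + \<rho> |g|) / l. The claimed bound is the fixed point of this recursion, and an entry is
  at most the norm.\<close>

lemma green_le:
  assumes G: "simple_graph G" "loc_finite G" and deg: "\<And>x. card (nbrs G x) \<le> d"
    and l: "l > graph_spectral_radius G" and v: "v \<in> verts G"
  shows "green G l M v y \<le> 1 / (l - graph_spectral_radius G)"
proof -
  let ?V = "verts G" and ?r = "graph_spectral_radius G"
  have r: "?r \<ge> 0" by (rule spectral_radius_nonneg[OF G deg])
  have l0: "l > 0" using r l by simp
  have "\<exists>S. finite S \<and> S \<subseteq> ?V \<and> (\<forall>y. y \<notin> S \<longrightarrow> green G l M v y = 0) \<and> L2_set (green G l M v) S \<le> 1 / (l - ?r)"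
  proof (induction M)
    case 0
    then show ?case using l by (intro exI[of _ "{}"]) auto
  next
    case (Suc M)
    then obtain S where S: "finite S" "S \<subseteq> ?V" "\<And>y. y \<notin> S \<Longrightarrow> green G l M v y = 0"
      "L2_set (green G l M v) S \<le> 1 / (l - ?r)" by blast
    let ?g = "green G l M v"
    let ?S = "insert v (\<Union>x\<in>S. nbrs G x)"
    have S': "finite ?S" "?S \<subseteq> ?V" using S(1,2) G v simple_graph_adjD(2)[OF G(1)] by auto
    have A0: "adj_op G ?g y = 0" if y: "y \<notin> ?S" for y
      unfolding adj_op_def
    proof (intro sum.neutral ballI)
      fix u assume "u \<in> {u. adj G y u}"
      then have "y \<in> nbrs G u" using simple_graph_adjD(4)[OF G(1)] by simp
      then have "u \<notin> S" using y by blast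
      then show "?g u = 0" by (rule S(3))
    qed
    have eq: "green G l (Suc M) v = (\<lambda>y. (1 / l) * (of_bool (y = v) + adj_op G ?g y))"
      by (auto simp: adj_op_def nbrs_def)
    have "L2_set (green G l (Suc M) v) ?S = (1 / l) * L2_set (\<lambda>y. of_bool (y = v) + adj_op G ?g y) ?S"
      unfolding eq using l0 by (subst L2_set_right_distrib) auto
    also have "\<dots> \<le> (1 / l) * (L2_set (\<lambda>y. of_bool (y = v)) ?S + L2_set (adj_op G ?g) ?S)"
      using l0 by (intro mult_left_mono L2_set_triangle_ineq) auto
    also have "L2_set (\<lambda>y. of_bool (y = v)) ?S = 1"
    proof -
      have "(\<Sum>y\<in>?S. (of_bool (y = v))\<^sup>2) = (\<Sum>y\<in>{v}. (of_bool (y = v) :: real)\<^sup>2)"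
        using S' by (intro sum.mono_neutral_right) auto
      then show ?thesis by (simp add: L2_set_def)
    qed
    also have "L2_set (adj_op G ?g) ?S = ell2_norm ?V (adj_op G ?g)"
      using finite_support_ell2(2)[OF S' A0] by simp
    also have "\<dots> \<le> ?r * ell2_norm ?V ?g"
      by (rule adj_op_norm_le[OF G deg finite_support_ell2(1)[OF S(1-3)]])
    also have "ell2_norm ?V ?g = L2_set ?g S" by (rule finite_support_ell2(2)[OF S(1-3)])
    also have "?r * \<dots> \<le> ?r * (1 / (l - ?r))" by (rule mult_left_mono[OF S(4) r])
    also have "(1 / l) * (1 + ?r * (1 / (l - ?r))) = 1 / (l - ?r)"
      using l l0 by (simp add: field_simps)
    finally have "L2_set (green G l (Suc M) v) ?S \<le> 1 / (l - ?r)"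
      using l0 by (simp del: green.simps add: divide_right_mono)
    moreover have "green G l (Suc M) v y = 0" if "y \<notin> ?S" for y
      unfolding eq using A0[OF that] that by auto
    ultimately show ?case using S' by blast
  qed
  then obtain S where S: "finite S" "\<And>y. y \<notin> S \<Longrightarrow> green G l M v y = 0"
    "L2_set (green G l M v) S \<le> 1 / (l - ?r)" by blast
  show ?thesis
  proof (cases "y \<in> S")
    case True
    then have "green G l M v y \<le> L2_set (green G l M v) S" using S(1) by (intro member_le_L2_set)
    then show ?thesis using S by simp
  qed (use S l in auto)
qed

section \<open>First passage functions and branch sums at a fixed energy\<close>

text \<open>Renewal at \<open>b\<close>: with \<open>A\<close> the supremum of the return sums
  \<open>?a M\<close>, splitting off the last excursion gives 1 + \<open>?P\<close> A \<le> l A. As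
  \<open>A\<close> is positive and finite, \<open>?P\<close> < l. Finiteness of \<open>A\<close> is
  where an energy above the spectral radius enters.\<close>

lemma sum_passage_le:
  assumes G: "simple_graph G" "loc_finite G" and deg: "\<And>x. card (nbrs G x) \<le> d"
    and l: "l > graph_spectral_radius G" and b: "b \<in> verts G"
  shows "(\<Sum>c\<in>nbrs G b. passage G l N b c) \<le> l"
proof -
  let ?a = "\<lambda>M. nb_green G l M [b]"
  let ?P = "\<Sum>c\<in>nbrs G b. passage G l N b c"
  have l0: "l > 0" using spectral_radius_nonneg[OF G deg] l by simp
  have P0: "?P \<ge> 0" using l0 by (intro sum_nonneg passage_nonneg)
  have "?a M \<le> 1 / (l - graph_spectral_radius G)" for M
  proof -
    have "(\<Sum>p\<in>{[b]}. nb_green G l M p) \<le> green G l M b b"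
      using b by (intro sum_nb_green_le_green[OF G l0]) auto
    also have "\<dots> \<le> 1 / (l - graph_spectral_radius G)" by (rule green_le[OF G deg l b])
    finally show ?thesis by simp
  qed
  then have bdd: "bdd_above (range ?a)" by (auto simp: bdd_above_def)
  define A where "A = (SUP M. ?a M)"
  have aA: "?a M \<le> A" for M unfolding A_def by (rule cSUP_upper[OF _ bdd]) simp
  have "1 / l \<le> A" using aA[of "Suc 0"] by simp
  moreover have "1 / l > 0" using l0 by simp
  ultimately have A0: "A > 0" by linarith
  have step: "1 + ?P * ?a M \<le> l * A" for M
  proof -
    have ext: "{z. nb_walk G [z, b]} = nbrs G b" by auto
    have "?P * ?a M = (\<Sum>c\<in>nbrs G b. passage G l N b c * ?a M)" by (simp add: sum_distrib_right)
    also have "\<dots> \<le> (\<Sum>c\<in>nbrs G b. nb_green G l (passage_cost N + M) [c, b])"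
      by (intro sum_mono nb_green_Cons_ge[OF G l0]) simp
    also have "\<dots> = l * ?a (Suc (passage_cost N + M)) - 1"
      using l0 unfolding nb_green.simps(2) ext by simp
    also have "\<dots> \<le> l * A - 1" using aA[of "Suc (passage_cost N + M)"] l0 by (simp del: nb_green.simps)
    finally show ?thesis by simp
  qed
  have "1 + ?P * A \<le> l * A"
  proof (cases "?P = 0")
    case True then show ?thesis using step[of 0] by simp
  next
    case False
    then have P: "?P > 0" using P0 by simp
    have "A \<le> (l * A - 1) / ?P"
      unfolding A_def[symmetric]
      by (subst A_def, rule cSUP_least) (use step P in \<open>auto simp: le_divide_eq mult.commute algebra_simps\<close>)
    then show ?thesis using P by (simp add: le_divide_eq mult.commute)
  qed
  then have "?P * A < l * A" by simp
  then show ?thesis using A0 by simp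
qed

lemma passage_le:
  assumes G: "simple_graph G" "loc_finite G" and deg: "\<And>x. card (nbrs G x) \<le> d"
    and l: "l > graph_spectral_radius G" and xb: "adj G x b"
  shows "passage G l N x b \<le> l"
proof -
  have l0: "l > 0" using spectral_radius_nonneg[OF G deg] l by simp
  have "passage G l N x b \<le> (\<Sum>c\<in>nbrs G x. passage G l N x c)"
    using xb G l0 by (intro member_le_sum passage_nonneg) auto
  also have "\<dots> \<le> l" using xb simple_graph_adjD[OF G(1)] by (intro sum_passage_le[OF G deg l])
  finally show ?thesis .
qed

section \<open>Removing the truncation of first passage functions\<close>

definition passage_lim :: "'a sgraph \<Rightarrow> real \<Rightarrow> 'a \<Rightarrow> 'a \<Rightarrow> real" where
  "passage_lim G l x b = lim (\<lambda>N. passage G l N x b)"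

lemma passage_tendsto:
  assumes l: "l > 0" and bnd: "\<And>N. passage G l N x b \<le> C"
  shows "(\<lambda>N. passage G l N x b) \<longlonglongrightarrow> passage_lim G l x b"
proof -
  have "incseq (\<lambda>N. passage G l N x b)" using passage_mono[OF l] by (auto simp: mono_def)
  then have "convergent (\<lambda>N. passage G l N x b)"
    using bnd by (intro Bseq_monoseq_convergent Bseq_eq_bounded[of _ 0 C] ) (auto simp: incseq_imp_monoseq passage_nonneg[OF l])
  then show ?thesis unfolding passage_lim_def by (simp add: convergent_LIMSEQ_iff)
qed

lemma
  assumes l: "l > 0" and bnd: "\<And>N x b. adj G x b \<Longrightarrow> passage G l N x b \<le> C" and xb: "adj G x b"
  shows passage_le_lim: "passage G l N x b \<le> passage_lim G l x b"
    and passage_lim_le: "passage_lim G l x b \<le> C"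
    and passage_lim_ge: "passage_lim G l x b \<ge> 1 / l"
    and passage_lim_eq: "l * passage_lim G l x b = 1 + passage_lim G l x b * (\<Sum>c\<in>succs G x b. passage_lim G l b c)"
proof -
  note T = passage_tendsto[OF l bnd]
  show le: "passage G l N x b \<le> passage_lim G l x b" for N
    using T[OF xb] passage_mono[OF l] by (intro incseq_le) (auto simp: mono_def)
  show "passage_lim G l x b \<le> C" using T[OF xb] bnd[OF xb] by (intro LIMSEQ_le_const2) auto
  show "passage_lim G l x b \<ge> 1 / l" using le[of 1] by simp
  have "(\<lambda>N. (1 + passage G l N x b * (\<Sum>c\<in>succs G x b. passage G l N b c)) / l)
      \<longlonglongrightarrow> (1 + passage_lim G l x b * (\<Sum>c\<in>succs G x b. passage_lim G l b c)) / l"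
    using l by (intro tendsto_intros T xb) auto
  moreover have "(\<lambda>N. passage G l (Suc N) x b) \<longlonglongrightarrow> passage_lim G l x b"
    using T[OF xb] by (rule LIMSEQ_Suc)
  ultimately have "passage_lim G l x b = (1 + passage_lim G l x b * (\<Sum>c\<in>succs G x b. passage_lim G l b c)) / l"
    using LIMSEQ_unique by (simp del: passage.simps add: passage.simps(2)) blast
  then show "l * passage_lim G l x b = 1 + passage_lim G l x b * (\<Sum>c\<in>succs G x b. passage_lim G l b c)"
    using l by (simp add: field_simps)
qed

text \<open>The sum, over the non-backtracking paths of one to \<open>K\<close> arcs that begin with
  the arc from \<open>x\<close> to \<open>b\<close>, of the product of the weights of their
  arcs.\<close>

primrec branch :: "'a sgraph \<Rightarrow> ('a \<Rightarrow> 'a \<Rightarrow> real) \<Rightarrow> nat \<Rightarrow> 'a \<Rightarrow> 'a \<Rightarrow> real" where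
  "branch G w 0 x b = 0"
| "branch G w (Suc K) x b = w x b * (1 + (\<Sum>c\<in>succs G x b. branch G w K b c))"

lemma branch_nonneg:
  assumes "\<And>x b. adj G x b \<Longrightarrow> w x b \<ge> 0" "adj G x b"
  shows "branch G w K x b \<ge> 0"
  using assms(2) by (induction K arbitrary: x b) (auto intro!: mult_nonneg_nonneg add_nonneg_nonneg sum_nonneg assms(1))

lemma branch_mono_weight:
  assumes "\<And>x b. adj G x b \<Longrightarrow> 0 \<le> w x b \<and> w x b \<le> w' x b" "adj G x b"
  shows "branch G w K x b \<le> branch G w' K x b"
  using assms(2)
proof (induction K arbitrary: x b)
  case (Suc K)
  have w: "0 \<le> w x b" "w x b \<le> w' x b" using assms(1)[OF Suc.prems] by auto
  have "(\<Sum>c\<in>succs G x b. branch G w K b c) \<le> (\<Sum>c\<in>succs G x b. branch G w' K b c)"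
    by (intro sum_mono Suc.IH) auto
  moreover have "0 \<le> (\<Sum>c\<in>succs G x b. branch G w K b c)"
    by (intro sum_nonneg branch_nonneg) (use assms(1) in auto)
  ultimately show ?case using w unfolding branch.simps by (intro mult_mono) linarith+
qed simp

lemma branch_Suc_mono:
  assumes w: "\<And>x b. adj G x b \<Longrightarrow> w x b \<ge> 0" and xb: "adj G x b"
  shows "branch G w K x b \<le> branch G w (Suc K) x b"
  using xb
proof (induction K arbitrary: x b)
  case 0
  then show ?case using w by simp
next
  case (Suc K)
  have "(\<Sum>c\<in>succs G x b. branch G w K b c) \<le> (\<Sum>c\<in>succs G x b. branch G w (Suc K) b c)"
    by (intro sum_mono Suc.IH) auto
  then show ?case
    unfolding branch.simps(2)[of G w "Suc K"] branch.simps(2)[of G w K x b]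
    by (intro mult_left_mono w Suc.prems) linarith
qed

lemma branch_mono:
  assumes w: "\<And>x b. adj G x b \<Longrightarrow> w x b \<ge> 0" and xb: "adj G x b" and "K \<le> K'"
  shows "branch G w K x b \<le> branch G w K' x b"
  by (rule lift_Suc_mono_le[of "\<lambda>K. branch G w K x b"]) (auto simp del: branch.simps intro: branch_Suc_mono[OF w] xb assms(3))

lemma branch_cover:
  assumes "simple_graph T" "simple_graph G" "cover_map \<pi> T G" "adj T x b"
    and w: "\<And>x b. adj T x b \<Longrightarrow> w (\<pi> x) (\<pi> b) = w' x b"
  shows "branch G w K (\<pi> x) (\<pi> b) = branch T w' K x b"
  using assms(4)
proof (induction K arbitrary: x b)
  case (Suc K)
  have "(\<Sum>c\<in>succs G (\<pi> x) (\<pi> b). branch G w K (\<pi> b) c) = (\<Sum>c\<in>succs T x b. branch G w K (\<pi> b) (\<pi> c))"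
    using cover_map_bij_succs[OF assms(1-3) Suc.prems] by (rule sum.reindex_bij_betw[symmetric])
  also have "\<dots> = (\<Sum>c\<in>succs T x b. branch T w' K b c)"
    using Suc by (intro sum.cong) auto
  finally show ?case using w[OF Suc.prems] by simp
qed simp

text \<open>The branch sums are difference quotients of the first passage function in the energy:
  this is the discrete form of \<open>- dm/dl = m\<^sup>2 (1 + \<Sum> (- dm/dl))\<close>.\<close>

lemma branch_le_passage_diff:
  assumes l: "0 < l1" "l1 \<le> l2"
    and bnd1: "\<And>N x b. adj G x b \<Longrightarrow> passage G l1 N x b \<le> C"
    and bnd2: "\<And>N x b. adj G x b \<Longrightarrow> passage G l2 N x b \<le> C"
    and xb: "adj G x b"
  shows "(l2 - l1) * branch G (\<lambda>x b. (passage_lim G l2 x b)\<^sup>2) K x b \<le> passage_lim G l1 x b - passage_lim G l2 x b"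
  using xb
proof (induction K arbitrary: x b)
  case 0
  have "passage_lim G l2 x b \<le> passage_lim G l1 x b"
  proof (rule LIMSEQ_le)
    show "(\<lambda>N. passage G l2 N x b) \<longlonglongrightarrow> passage_lim G l2 x b"
      using l by (intro passage_tendsto[OF _ bnd2[OF 0]]) simp
    show "(\<lambda>N. passage G l1 N x b) \<longlonglongrightarrow> passage_lim G l1 x b"
      by (rule passage_tendsto[OF l(1) bnd1[OF 0]])
    show "\<exists>M. \<forall>N\<ge>M. passage G l2 N x b \<le> passage G l1 N x b"
      by (intro exI allI impI passage_antimono[OF l])
  qed
  then show ?case by simp
next
  case (Suc K)
  let ?m1 = "passage_lim G l1" and ?m2 = "passage_lim G l2"
  let ?H = "branch G (\<lambda>x b. (?m2 x b)\<^sup>2) K"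
  let ?s1 = "\<Sum>c\<in>succs G x b. ?m1 b c" and ?s2 = "\<Sum>c\<in>succs G x b. ?m2 b c" and ?h = "\<Sum>c\<in>succs G x b. ?H b c"
  have e1: "?m1 x b * (l1 - ?s1) = 1" using passage_lim_eq[OF l(1) bnd1 Suc.prems] by (simp add: algebra_simps)
  have e2: "?m2 x b * (l2 - ?s2) = 1" using passage_lim_eq[OF _ bnd2 Suc.prems] l by (simp add: algebra_simps)
  have l': "1 / l1 > 0" "1 / l2 > 0" "l2 > 0" using l by auto
  have m2: "?m2 x b > 0" using passage_lim_ge[OF l'(3) bnd2 Suc.prems] l' by linarith
  have m1: "?m1 x b > 0" using passage_lim_ge[OF l(1) bnd1 Suc.prems] l' by linarith
  have "(l2 - l1) * ?h = (\<Sum>c\<in>succs G x b. (l2 - l1) * ?H b c)" by (simp add: sum_distrib_left)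
  also have "\<dots> \<le> (\<Sum>c\<in>succs G x b. ?m1 b c - ?m2 b c)" by (intro sum_mono Suc.IH) auto
  also have "\<dots> = ?s1 - ?s2" by (simp add: sum_subtractf)
  finally have h: "(l2 - l1) * ?h \<le> ?s1 - ?s2" .
  have h0: "?h \<ge> 0" by (intro sum_nonneg branch_nonneg) auto
  have D0: "0 \<le> (l2 - l1) * (1 + ?h)" using l h0 by (intro mult_nonneg_nonneg) auto
  have D: "(l2 - l1) * (1 + ?h) \<le> (l2 - ?s2) - (l1 - ?s1)" using h by (simp add: algebra_simps)
  \<comment> \<open>The equations say m = 1 / (l - s), so this is a difference of reciprocals.
    Replacing the product of both values by the square of the smaller one, at \<open>l2\<close>,
    leaves one step of the recursion of \<open>branch\<close>.\<close>
  have diff: "?m1 x b - ?m2 x b = ?m1 x b * ?m2 x b * ((l2 - ?s2) - (l1 - ?s1))"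
  proof -
    have "a - b = a * b * (q - p)" if "a * p = 1" "b * q = 1" for a b p q :: real
    proof -
      have "a * b * (q - p) = a * (b * q) - b * (a * p)" by (simp add: algebra_simps)
      then show ?thesis using that by simp
    qed
    from this[OF e1 e2] show ?thesis .
  qed
  then have "?m2 x b \<le> ?m1 x b" using D0 D m1 m2
    by (smt (verit, best) mult_nonneg_nonneg)
  then have "?m2 x b * ?m2 x b \<le> ?m1 x b * ?m2 x b" using m2 by (intro mult_right_mono) auto
  then have "?m2 x b * ?m2 x b * ((l2 - l1) * (1 + ?h)) \<le> ?m1 x b * ?m2 x b * ((l2 - ?s2) - (l1 - ?s1))"
    using D D0 m1 m2 by (intro mult_mono) auto
  then show ?case using diff by (simp add: power2_eq_square algebra_simps)
qed

text \<open>Orient the tree towards a root and put \<open>m\<close> on steps away from it, 1 / m on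
  steps towards it; \<open>super\<close> is then the row condition of the Schur test. It may fail
  only at the root, which has no parent, and an infinite \<open>T\<close> has room for a root
  outside the finite set that the test looks at.\<close>

lemma spectral_radius_le_of_supersolution:
  assumes T: "is_tree T" "loc_finite T" "infinite (verts T)"
    and m: "\<And>x b. adj T x b \<Longrightarrow> m x b > 0"
    and super: "\<And>x b. adj T x b \<Longrightarrow> m x b * (c - (\<Sum>u\<in>succs T x b. m b u)) \<ge> 1"
    and c: "c \<ge> 0"
  shows "graph_spectral_radius T \<le> c"
proof -
  have S: "simple_graph T" using T by (simp add: is_tree_def)
  show ?thesis
  proof (rule spectral_radius_le[OF S T(2) c])
    fix X f assume X: "finite X" "X \<subseteq> verts T"
    let ?Y = "X \<union> (\<Union>x\<in>X. nbrs T x)"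
    have Y: "finite ?Y" "?Y \<subseteq> verts T" using X T(2) nbrs_subset_verts[OF S] by auto
    have "\<not> verts T \<subseteq> ?Y" using T(3) finite_subset[OF _ Y(1)] by blast
    then obtain r where r: "r \<in> verts T" "r \<notin> ?Y" by blast
    obtain par where
      p1: "\<And>x. x \<in> verts T \<Longrightarrow> x \<noteq> r \<Longrightarrow> adj T x (par x)" and
      p2: "\<And>x y. adj T x y \<Longrightarrow> x \<noteq> r \<Longrightarrow> y \<noteq> par x \<Longrightarrow> y \<noteq> r \<and> par y = x" and
      p3: "\<And>x. x \<in> verts T \<Longrightarrow> x \<noteq> r \<Longrightarrow> par x \<noteq> r \<Longrightarrow> par (par x) \<noteq> x"
      by (rule tree_parent[OF T(1) r(1)], rule that, assumption+)
    define t where "t x y = (if x \<noteq> r \<and> par x = y then 1 / m y x else m x y)" for x y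
    show "(\<Sum>x\<in>X. (adj_op T f x)\<^sup>2) \<le> c\<^sup>2 * (\<Sum>y\<in>(\<Union>x\<in>X. nbrs T x). (f y)\<^sup>2)"
    proof (rule schur_test_finite[OF S T(2) X(1) _ _ _ c, of t])
      show "t x y > 0" if "adj T x y" for x y
        using m[OF that] m[OF simple_graph_adjD(4)[OF S that]] by (simp add: t_def)
      show "t x y * t y x = 1" if xy: "adj T x y" for x y
      proof -
        have yx: "adj T y x" and V: "x \<in> verts T" "y \<in> verts T" and ne: "x \<noteq> y"
          using simple_graph_adjD[OF S xy] by auto
        have mm: "m x y \<noteq> 0" "m y x \<noteq> 0" using m[OF xy] m[OF yx] by auto
        consider "x \<noteq> r" "par x = y" | "x \<noteq> r" "par x \<noteq> y" | "x = r" by blast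
        then show ?thesis
        proof cases
          case 1
          then have "\<not> (y \<noteq> r \<and> par y = x)" using p3[OF V(1)] by auto
          then show ?thesis using 1 mm by (auto simp: t_def)
        next
          case 2
          then have "y \<noteq> r \<and> par y = x" using p2[OF xy] by blast
          then show ?thesis using 2 mm by (auto simp: t_def)
        next
          case 3
          then have "y \<noteq> r" using ne by simp
          moreover have "par y = x" using p2[OF yx \<open>y \<noteq> r\<close>] 3 by blast
          ultimately show ?thesis using 3 mm by (auto simp: t_def)
        qed
      qed
      show "(\<Sum>y\<in>nbrs T x. t x y) \<le> c" if "x \<in> ?Y" for x
      proof -
        have x: "x \<in> verts T" using that Y(2) by blast
        have "x \<noteq> r" using that r(2) by blast
        note x = x this
        let ?p = "par x"
        have px: "adj T x ?p" "adj T ?p x" using p1[OF x] simple_graph_adjD[OF S] by auto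
        have "nbrs T x = insert ?p (succs T ?p x)" using px by auto
        then have "(\<Sum>y\<in>nbrs T x. t x y) = t x ?p + (\<Sum>y\<in>succs T ?p x. t x y)"
          using T(2) by simp
        also have "(\<Sum>y\<in>succs T ?p x. t x y) = (\<Sum>y\<in>succs T ?p x. m x y)"
          by (intro sum.cong) (auto simp: t_def)
        also have "t x ?p = 1 / m ?p x" using x by (simp add: t_def)
        also have "\<dots> \<le> c - (\<Sum>y\<in>succs T ?p x. m x y)"
          using super[OF px(2)] m[OF px(2)] by (simp add: divide_le_eq mult.commute)
        finally show ?thesis by simp
      qed
    qed
  qed
qed

lemma infinite_tree_arc:
  assumes T: "is_tree T" "infinite (verts T)"
  obtains x b where "adj T x b"
proof -
  have "verts T \<noteq> {}" using T(2) by auto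
  then obtain x where x: "x \<in> verts T" by blast
  have "\<not> verts T \<subseteq> {x}" using T(2) finite_subset[of "verts T" "{x}"] by blast
  then obtain y where y: "y \<in> verts T" "y \<noteq> x" by blast
  show ?thesis by (rule tree_parent[OF T(1) x], rule that) (use y in blast)
qed

text \<open>If the branch sums at energy \<open>l\<close> are bounded, then \<open>m + 2 \<eta> H\<close> is still a supersolution
  at energy \<open>l - \<eta>\<close>.\<close>

lemma spectral_gap_of_branch_bound:
  assumes T: "is_tree T" "loc_finite T" "infinite (verts T)" and deg: "\<And>x. card (nbrs T x) \<le> d"
    and l: "l > graph_spectral_radius T" "l \<le> L" and B: "B > 0"
    and bound: "\<And>K x b. adj T x b \<Longrightarrow> branch T (\<lambda>x b. (passage_lim T l x b)\<^sup>2) K x b \<le> B"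
  shows "l - graph_spectral_radius T \<ge> 1 / (4 * L ^ 3 * B\<^sup>2)"
proof -
  have S: "simple_graph T" using T by (simp add: is_tree_def)
  have l0: "l > 0" using spectral_radius_nonneg[OF S T(2) deg] l by simp
  have L0: "L > 0" using l0 l by simp
  note bnd = passage_le[OF S T(2) deg l(1)]
  \<comment> \<open>Dictated by the second-order term, which is at most 4 \<eta> B^2 / m^2 and must
    not exceed m, where m \<ge> 1 / L.\<close>
  define \<eta> where "\<eta> = 1 / (4 * L ^ 3 * B\<^sup>2)"
  have \<eta>: "\<eta> > 0" using L0 B by (simp add: \<eta>_def)
  let ?m = "passage_lim T l"
  let ?Hk = "branch T (\<lambda>x b. (?m x b)\<^sup>2)"
  define H where "H x b = lim (\<lambda>K. ?Hk K x b)" for x b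
  have lim: "(\<lambda>K. ?Hk K x b) \<longlonglongrightarrow> H x b" if "adj T x b" for x b
  proof -
    have "incseq (\<lambda>K. ?Hk K x b)" using branch_mono[OF _ that, of "\<lambda>x b. (?m x b)\<^sup>2"] by (auto simp: mono_def)
    moreover have "0 \<le> ?Hk K x b" for K by (rule branch_nonneg[OF _ that]) auto
    ultimately have "convergent (\<lambda>K. ?Hk K x b)"
      using bound[OF that] by (intro Bseq_monoseq_convergent Bseq_eq_bounded[of _ 0 B]) (auto simp: incseq_imp_monoseq)
    then show ?thesis unfolding H_def by (simp add: convergent_LIMSEQ_iff)
  qed
  have Heq: "H x b = (?m x b)\<^sup>2 * (1 + (\<Sum>c\<in>succs T x b. H b c))" if xb: "adj T x b" for x b
  proof -
    have "(\<lambda>K. (?m x b)\<^sup>2 * (1 + (\<Sum>c\<in>succs T x b. ?Hk K b c))) \<longlonglongrightarrow> (?m x b)\<^sup>2 * (1 + (\<Sum>c\<in>succs T x b. H b c))"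
      by (intro tendsto_intros lim) auto
    moreover have "(\<lambda>K. ?Hk (Suc K) x b) \<longlonglongrightarrow> H x b" using lim[OF xb] by (rule LIMSEQ_Suc)
    ultimately show ?thesis using LIMSEQ_unique by (simp del: branch.simps add: branch.simps(2)) blast
  qed
  have H0: "H x b \<ge> 0" if "adj T x b" for x b
    using lim[OF that] by (rule LIMSEQ_le_const) (auto intro!: branch_nonneg that)
  have HB: "H x b \<le> B" if "adj T x b" for x b
    using lim[OF that] by (rule LIMSEQ_le_const2) (use bound[OF that] in auto)
  define m' where "m' x b = ?m x b + 2 * \<eta> * H x b" for x b
  have mge: "?m x b \<ge> 1 / L" if "adj T x b" for x b
  proof -
    have "1 / L \<le> 1 / l" using l l0 by (simp add: frac_le)
    then show ?thesis using passage_lim_ge[OF l0 bnd that] by simp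
  qed
  have mpos: "?m x b > 0" if "adj T x b" for x b
  proof -
    have "1 / L > 0" using L0 by simp
    then show ?thesis using mge[OF that] by linarith
  qed
  have m'pos: "m' x b > 0" if "adj T x b" for x b
    using mpos[OF that] H0[OF that] \<eta> by (simp add: m'_def add_pos_nonneg)
  have super: "m' x b * ((l - \<eta>) - (\<Sum>u\<in>succs T x b. m' b u)) \<ge> 1" if xb: "adj T x b" for x b
  proof -
    let ?s = "\<Sum>u\<in>succs T x b. ?m b u" and ?h = "\<Sum>u\<in>succs T x b. H b u"
    let ?M = "?m x b" and ?H = "H x b"
    have h0: "?h \<ge> 0" using H0 by (intro sum_nonneg) auto
    have e: "?M * (l - ?s) = 1" using passage_lim_eq[OF l0 bnd xb] by (simp add: algebra_simps)
    have sum': "(\<Sum>u\<in>succs T x b. m' b u) = ?s + 2 * \<eta> * ?h"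
      by (simp add: m'_def sum.distrib sum_distrib_left)
    have M: "?M > 0" using mpos[OF xb] .
    have key: "2 * \<eta> * ?H * (1 + 2 * ?h) \<le> ?M"
    proof -
      have "2 * \<eta> * ?H * (1 + 2 * ?h) * ?M\<^sup>2 \<le> 2 * \<eta> * ?H * (2 * (1 + ?h)) * ?M\<^sup>2"
        using \<eta> H0[OF xb] h0 by (intro mult_right_mono mult_left_mono) auto
      also have "\<dots> = 4 * \<eta> * ?H\<^sup>2" using Heq[OF xb] by (simp add: power2_eq_square)
      also have "\<dots> \<le> 4 * \<eta> * B\<^sup>2" using H0[OF xb] HB[OF xb] \<eta> by (intro mult_left_mono power_mono) auto
      also have "\<dots> = (1 / L) ^ 3" using B L0 by (simp add: \<eta>_def field_simps)
      also have "\<dots> \<le> ?M ^ 3" using mge[OF xb] L0 by (intro power_mono) auto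
      also have "\<dots> = ?M * ?M\<^sup>2" by (simp add: power3_eq_cube power2_eq_square)
      finally show ?thesis using M by simp
    qed
    \<comment> \<open>To first order in \<eta> the correction 2 \<eta> H gains 2 H (l - s) = 2 m (1
      + h), while the lower energy and the larger successors cost m (1 + 2 h). The factor 2 leaves
      the surplus m, against which \<open>key\<close> sets the second-order term.\<close>
    have "m' x b * ((l - \<eta>) - (\<Sum>u\<in>succs T x b. m' b u))
       = (?M + 2 * \<eta> * ?H) * ((l - ?s) - \<eta> * (1 + 2 * ?h))"
      unfolding sum' unfolding m'_def by (simp add: algebra_simps)
    also have "\<dots> = ?M * (l - ?s) + \<eta> * (2 * ?H * (l - ?s) - ?M * (1 + 2 * ?h)) - \<eta> * (2 * \<eta> * ?H * (1 + 2 * ?h))"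
      by (simp add: algebra_simps)
    also have "2 * ?H * (l - ?s) = 2 * ?M * (?M * (l - ?s)) * (1 + ?h)"
      using Heq[OF xb] by (simp add: power2_eq_square)
    also have "\<dots> - ?M * (1 + 2 * ?h) = ?M" unfolding e by (simp add: algebra_simps)
    finally have eq: "m' x b * ((l - \<eta>) - (\<Sum>u\<in>succs T x b. m' b u)) = 1 + \<eta> * (?M - 2 * \<eta> * ?H * (1 + 2 * ?h))"
      unfolding e by (simp add: algebra_simps)
    show ?thesis unfolding eq using key \<eta> by simp
  qed
  obtain x b where xb: "adj T x b" by (rule infinite_tree_arc[OF T(1,3)])
  \<comment> \<open>The Schur test needs a nonnegative bound; a single arc suffices, since both
    factors of the supersolution inequality are positive.\<close>
  have "l - \<eta> \<ge> 0"
  proof -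
    have "0 < (l - \<eta>) - (\<Sum>u\<in>succs T x b. m' b u)"
      by (rule zero_less_mult_pos[OF _ m'pos[OF xb]]) (use super[OF xb] in linarith)
    moreover have "0 \<le> (\<Sum>u\<in>succs T x b. m' b u)" using m'pos by (intro sum_nonneg) (auto simp: less_imp_le)
    ultimately show ?thesis by simp
  qed
  then have "graph_spectral_radius T \<le> l - \<eta>"
    by (intro spectral_radius_le_of_supersolution[OF T m'pos super])
  then show ?thesis by (simp add: \<eta>_def)
qed

section \<open>Turning around in the core\<close>

primrec extendable :: "'a sgraph \<Rightarrow> nat \<Rightarrow> 'a \<Rightarrow> 'a \<Rightarrow> bool" where
  "extendable G 0 x b = adj G x b"
| "extendable G (Suc N) x b = (adj G x b \<and> (\<exists>c\<in>succs G x b. extendable G N b c))"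

text \<open>In a finite graph this only means that the arc can be continued arbitrarily far; on the
  universal cover, which is locally finite, it says that the branch behind the arc is
  infinite.\<close>

definition inf_arc :: "'a sgraph \<Rightarrow> 'a \<Rightarrow> 'a \<Rightarrow> bool" where
  "inf_arc G x b \<longleftrightarrow> (\<forall>N. extendable G N x b)"

definition core_arc :: "'a sgraph \<Rightarrow> 'a \<Rightarrow> 'a \<Rightarrow> bool" where
  "core_arc G x b \<longleftrightarrow> inf_arc G x b \<and> inf_arc G b x"

lemma extendable_adj: "extendable G N x b \<Longrightarrow> adj G x b"
  by (cases N) auto

lemma extendable_Suc: "extendable G (Suc N) x b \<Longrightarrow> extendable G N x b"
proof (induction N arbitrary: x b)
  case (Suc N)
  then obtain c where "adj G x b" "c \<in> succs G x b" "extendable G (Suc N) b c"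
    unfolding extendable.simps(2)[of G "Suc N"] by blast
  with Suc.IH show ?case unfolding extendable.simps(2) by blast
qed auto

lemma extendable_antimono: "N \<le> N' \<Longrightarrow> extendable G N' x b \<Longrightarrow> extendable G N x b"
  by (induction N' rule: dec_induct) (auto simp del: extendable.simps dest: extendable_Suc)

lemma extendable_cover:
  assumes "simple_graph T" "simple_graph G" "cover_map \<pi> T G" "adj T x b"
  shows "extendable G N (\<pi> x) (\<pi> b) = extendable T N x b"
  using assms(4)
proof (induction N arbitrary: x b)
  case 0
  then show ?case using cover_map_adj[OF assms(3)] by simp
next
  case (Suc N)
  have "succs G (\<pi> x) (\<pi> b) = \<pi> ` succs T x b"
    using cover_map_bij_succs[OF assms(1-3) Suc.prems] by (simp add: bij_betw_def)
  then show ?case using Suc cover_map_adj[OF assms(3)] by simp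
qed

lemma inf_arc_cover:
  assumes "simple_graph T" "simple_graph G" "cover_map \<pi> T G" "adj T x b"
  shows "inf_arc G (\<pi> x) (\<pi> b) = inf_arc T x b"
  using extendable_cover[OF assms] by (simp add: inf_arc_def)

lemma core_arc_cover:
  assumes "simple_graph T" "simple_graph G" "cover_map \<pi> T G" "adj T x b"
  shows "core_arc G (\<pi> x) (\<pi> b) = core_arc T x b"
  using inf_arc_cover[OF assms] inf_arc_cover[OF assms(1-3) simple_graph_adjD(4)[OF assms(1,4)]]
  by (simp add: core_arc_def)

lemma inf_arc_adj: "inf_arc G x b \<Longrightarrow> adj G x b"
  by (auto simp: inf_arc_def dest: extendable_adj)

lemma core_arc_adj: "core_arc G x b \<Longrightarrow> adj G x b"
  by (auto simp: core_arc_def dest: inf_arc_adj)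

lemma inf_arcI:
  assumes "adj G x b" "c \<in> succs G x b" "inf_arc G b c"
  shows "inf_arc G x b"
  unfolding inf_arc_def
proof
  fix N show "extendable G N x b" using assms by (cases N) (auto simp: inf_arc_def)
qed

lemma inf_arc_coinduct:
  assumes "Q x b" and step: "\<And>x b. Q x b \<Longrightarrow> adj G x b \<and> (\<exists>c\<in>succs G x b. Q b c)"
  shows "inf_arc G x b"
proof -
  have "extendable G N x b" if "Q x b" for N x b
    using that
  proof (induction N arbitrary: x b)
    case 0
    then show ?case using step by simp
  next
    case (Suc N)
    from step[OF Suc.prems] Suc.IH show ?case by auto
  qed
  then show ?thesis using assms(1) by (simp add: inf_arc_def)
qed

text \<open>Koenig's lemma: if every successor failed at some depth, the maximum of these finitely
  many depths would bound the arc itself.\<close>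

lemma inf_arc_step:
  assumes "loc_finite G" "inf_arc G x b"
  obtains c where "c \<in> succs G x b" "inf_arc G b c"
proof -
  have "\<exists>c\<in>succs G x b. inf_arc G b c"
  proof (rule ccontr)
    assume "\<not> ?thesis"
    then have "\<forall>c\<in>succs G x b. \<exists>N. \<not> extendable G N b c" by (auto simp: inf_arc_def)
    from bchoice[OF this] obtain N where N: "\<And>c. c \<in> succs G x b \<Longrightarrow> \<not> extendable G (N c) b c" by blast
    define M where "M = Max (insert 0 (N ` succs G x b))"
    have "N c \<le> M" if "c \<in> succs G x b" for c
      unfolding M_def using that assms(1) by (intro Max_ge) auto
    moreover have "extendable G (Suc M) x b" using assms(2) by (auto simp: inf_arc_def simp del: extendable.simps)
    then obtain c where "c \<in> succs G x b" "extendable G M b c" by auto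
    ultimately show False using N extendable_antimono by metis
  qed
  then show ?thesis using that by blast
qed

lemma core_arc_sym: "core_arc G x b \<Longrightarrow> core_arc G b x"
  by (simp add: core_arc_def)

lemma core_arc_next:
  assumes "simple_graph G" "core_arc G x b" "c \<in> succs G x b" "inf_arc G b c"
  shows "core_arc G b c"
proof -
  have "adj G c b" using assms simple_graph_adjD[OF assms(1)] by auto
  moreover have "x \<in> succs G c b" using assms inf_arc_adj[of G b x] by (auto simp: core_arc_def)
  ultimately have "inf_arc G c b" using assms inf_arcI[of G c b x] by (auto simp: core_arc_def)
  then show ?thesis using assms by (simp add: core_arc_def)
qed

definition arc_step :: "'a sgraph \<Rightarrow> (('a \<times> 'a) \<times> ('a \<times> 'a)) set" where
  "arc_step G = {((u, v), (v', w)). v' = v \<and> core_arc G u v \<and> core_arc G v w \<and> w \<noteq> u}"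

lemma arc_step_reverse:
  "((u, v), (u', v')) \<in> (arc_step G)\<^sup>* \<Longrightarrow> ((v', u'), (v, u)) \<in> (arc_step G)\<^sup>*"
proof (induction "(u', v')" arbitrary: u' v' rule: rtrancl_induct)
  case base
  then show ?case by simp
next
  case (step y)
  obtain p q where y: "y = (p, q)" by (cases y)
  have "((v', u'), (q, p)) \<in> arc_step G"
    using step(2) y by (auto simp: arc_step_def intro: core_arc_sym)
  moreover have "((q, p), (v, u)) \<in> (arc_step G)\<^sup>*" using step(3) y by blast
  ultimately show ?case by (rule converse_rtrancl_into_rtrancl)
qed

text \<open>A finite set of core arcs that is closed under non-backtracking continuation and contains
  no arc together with its reverse has exactly one arc into and one arc out of each of its vertices,
  so it is an isolated cycle. Hence a walk starting at a branching point can turn around.\<close>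

lemma core_turn_around:
  assumes G: "simple_graph G" "finite (verts G)"
    and core: "core_arc G x u1" "core_arc G x u2" "core_arc G x u3"
    and dist: "u1 \<noteq> u2" "u1 \<noteq> u3" "u2 \<noteq> u3"
  shows "((x, u1), (u1, x)) \<in> (arc_step G)\<^sup>*"
proof (rule ccontr)
  assume no: "((x, u1), (u1, x)) \<notin> (arc_step G)\<^sup>*"
  have lf: "loc_finite G" using G nbrs_subset_verts[OF G(1)] by (auto simp: loc_finite_def intro: finite_subset)
  define R where "R = (arc_step G)\<^sup>* `` {(x, u1)}"
  have R0: "(x, u1) \<in> R" by (simp add: R_def)
  have Rcore: "core_arc G u v" if "(u, v) \<in> R" for u v
    using that core(1) unfolding R_def by (auto simp: arc_step_def elim: rtranclE)
  have Rstep: "(v, w) \<in> R" if "(u, v) \<in> R" "core_arc G v w" "w \<noteq> u" for u v w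
  proof -
    have "((u, v), (v, w)) \<in> arc_step G" using that Rcore by (simp add: arc_step_def)
    then show ?thesis using that(1) unfolding R_def by (auto intro: rtrancl_into_rtrancl)
  qed
  have norev: False if "(u, v) \<in> R" "(v, u) \<in> R" for u v
  proof -
    have "((v, u), (u1, x)) \<in> (arc_step G)\<^sup>*" using that(1) arc_step_reverse by (auto simp: R_def)
    moreover have "((x, u1), (v, u)) \<in> (arc_step G)\<^sup>*" using that(2) by (auto simp: R_def)
    ultimately show False using no by (meson rtrancl_trans)
  qed
  \<comment> \<open>After entering \<open>v\<close> from \<open>u'\<close> one could go on to
    \<open>u\<close>, which is the reverse of an arc of \<open>R\<close>.\<close>
  have uniq: "u = u'" if "(u, v) \<in> R" "(u', v) \<in> R" for u u' v
  proof (rule ccontr)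
    assume "u \<noteq> u'"
    then have "(v, u) \<in> R" using Rstep[OF that(2)] core_arc_sym[OF Rcore[OF that(1)]] by blast
    then show False using norev that(1) by blast
  qed
  have finR: "finite R"
  proof (rule finite_subset)
    show "R \<subseteq> verts G \<times> verts G"
    proof (rule subrelI)
      fix u v assume uv: "(u, v) \<in> R"
      have "adj G u v" by (rule core_arc_adj[OF Rcore[OF uv]])
      from simple_graph_adjD[OF G(1) this] show "(u, v) \<in> verts G \<times> verts G" by simp
    qed
  qed (use G in auto)
  have "inj_on snd R" using uniq by (auto simp: inj_on_def)
  then have c1: "card (snd ` R) = card R" by (rule card_image)
  have sub: "snd ` R \<subseteq> fst ` R"
  proof
    fix v assume "v \<in> snd ` R"
    then obtain u where uv: "(u, v) \<in> R" by auto
    then have "inf_arc G u v" using Rcore by (simp add: core_arc_def)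
    then obtain w where w: "w \<in> succs G u v" "inf_arc G v w" using inf_arc_step[OF lf] by blast
    then have "(v, w) \<in> R" using Rstep[OF uv core_arc_next[OF G(1) Rcore[OF uv]]] by auto
    then show "v \<in> fst ` R" by force
  qed
  have "card (fst ` R) \<le> card R" by (rule card_image_le[OF finR])
  then have eq: "snd ` R = fst ` R" using sub c1 finR by (intro card_seteq) auto
  then have inj: "inj_on fst R" using c1 finR by (intro eq_card_imp_inj_on) auto
  have "x \<in> snd ` R" unfolding eq using R0 by force
  then obtain u where u: "(u, x) \<in> R" by auto
  \<comment> \<open>\<open>x\<close> is entered through \<open>u\<close>, and at least two of
    \<open>u1\<close>, \<open>u2\<close>, \<open>u3\<close> differ from \<open>u\<close>; both would
    leave \<open>x\<close> within \<open>R\<close>, against one outgoing arc per vertex.\<close>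
  have two: "\<exists>w w'. w \<noteq> w' \<and> w \<noteq> u \<and> w' \<noteq> u \<and> core_arc G x w \<and> core_arc G x w'"
    using core dist by metis
  then obtain w w' where "w \<noteq> w'" "(x, w) \<in> R" "(x, w') \<in> R" using Rstep[OF u] by blast
  with inj_onD[OF inj, of "(x, w)" "(x, w')"] show False by simp
qed

section \<open>Harnack inequalities for branch sums\<close>

lemma branch_arc_step:
  assumes lf: "loc_finite G" and w: "\<And>x b. adj G x b \<Longrightarrow> \<epsilon> \<le> w x b" and \<epsilon>: "0 < \<epsilon>" "\<epsilon> \<le> 1"
    and xb: "adj G x b" and c: "c \<in> succs G x b"
  shows "\<epsilon> * (1 + branch G w K b c) \<le> branch G w (Suc K) x b"
proof -
  have w0: "w x b \<ge> 0" if "adj G x b" for x b using w[OF that] \<epsilon> by linarith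
  have "branch G w K b c \<le> (\<Sum>c\<in>succs G x b. branch G w K b c)"
    using lf c by (intro member_le_sum branch_nonneg w0) auto
  moreover have "branch G w K b c \<ge> 0" using c by (intro branch_nonneg w0) auto
  ultimately show ?thesis unfolding branch.simps using w[OF xb] \<epsilon> by (intro mult_mono) auto
qed

lemma branch_arc_steps:
  assumes lf: "loc_finite G" and w: "\<And>x b. adj G x b \<Longrightarrow> \<epsilon> \<le> w x b" and \<epsilon>: "0 < \<epsilon>" "\<epsilon> \<le> 1"
  shows "((x, b), (y, c)) \<in> arc_step G ^^ n \<Longrightarrow> \<epsilon> ^ n * (1 + branch G w K y c) \<le> 1 + branch G w (K + n) x b"
proof (induction n arbitrary: y c K)
  case (Suc n)
  then obtain u v where uv: "((x, b), (u, v)) \<in> arc_step G ^^ n" "((u, v), (y, c)) \<in> arc_step G"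
    by (auto elim: relcompE)
  then have yc: "y = v" "c \<in> succs G u v" "adj G u v"
    by (auto simp: arc_step_def core_arc_def dest: inf_arc_adj)
  have "\<epsilon> ^ Suc n * (1 + branch G w K y c) = \<epsilon> ^ n * (\<epsilon> * (1 + branch G w K v c))" using yc by simp
  also have "\<dots> \<le> \<epsilon> ^ n * (1 + branch G w (Suc K) u v)"
    using branch_arc_step[where w=w and K=K, OF lf w \<epsilon> yc(3,2)] \<epsilon> by (intro mult_left_mono) (auto simp del: branch.simps)
  also have "\<dots> \<le> 1 + branch G w (Suc K + n) x b" by (rule Suc.IH[OF uv(1)])
  finally show ?case by simp
qed simp

text \<open>If \<open>b\<close> differs from \<open>y\<close>, the arc from \<open>y\<close> to
  \<open>x\<close> continues into the arc from \<open>x\<close> to \<open>b\<close>. If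
  \<open>b\<close> = \<open>y\<close>, the branch is the arc itself followed by at most
  \<open>d\<close> branches at \<open>y\<close>, one of which must carry its share. The constant
  covers both cases.\<close>

lemma branch_nbr:
  assumes G: "simple_graph G" "loc_finite G" and deg: "\<And>x. card (nbrs G x) \<le> d"
    and w: "\<And>x b. adj G x b \<Longrightarrow> 1 / C \<le> w x b \<and> w x b \<le> C" and C: "C \<ge> 1"
    and xy: "adj G x y" and xb: "adj G x b"
  shows "\<exists>c. adj G y c \<and> (1 + branch G w K x b) / (1 + C * (1 + real d)) \<le> 1 + branch G w (Suc K) y c"
proof (rule ccontr)
  let ?k = "1 + C * (1 + real d)"
  let ?q = "(1 + branch G w K x b) / ?k"
  assume "\<not> ?thesis"
  then have small: "1 + branch G w (Suc K) y c < ?q" if "adj G y c" for c using that by force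
  have w0: "w x b \<ge> 0" if "adj G x b" for x b
  proof -
    have "1 / C > 0" using C by simp
    then show ?thesis using w[OF that] by linarith
  qed
  have k: "?k > 0" "C \<le> ?k" using C by (auto simp: algebra_simps intro!: add_pos_nonneg add_nonneg_nonneg)
  have yx: "adj G y x" using simple_graph_adjD[OF G(1) xy] by simp
  have br0: "branch G w K' y c \<ge> 0" if "adj G y c" for K' c by (rule branch_nonneg[where w=w, OF w0 that])
  have q1: "1 < ?q" using small[OF yx] br0[OF yx, of "Suc K"] by linarith
  have eq: "1 + branch G w K x b = ?q + C * (1 + real d) * ?q"
  proof -
    have "a = a / k + c * (a / k)" if "k = 1 + c" "k > 0" for a k c :: real
    proof -
      have "a / k + c * (a / k) = k * (a / k)" unfolding that(1) by (simp only: distrib_right mult_1_left)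
      then show ?thesis using that(2) by simp
    qed
    from this[OF refl k(1)] show ?thesis .
  qed
  show False
  proof (cases "b = y")
    case False
    have bs: "b \<in> succs G y x" using xb False by simp
    have "(1 / C) * (1 + branch G w K x b) \<le> branch G w (Suc K) y x"
      using w C by (intro branch_arc_step[where w=w, OF G(2) _ _ _ yx bs]) auto
    moreover have "?q \<le> (1 / C) * (1 + branch G w K x b)"
      using k C branch_nonneg[where w=w and K=K, OF w0 xb] by (simp add: frac_le)
    ultimately show False using small[OF yx] by linarith
  next
    case True
    have "branch G w K x b \<le> C * (1 + real d * (?q - 1))"
    proof (cases K)
      case 0
      then show ?thesis using C q1 by (auto intro!: mult_nonneg_nonneg add_nonneg_nonneg)
    next
      case (Suc K')
      have "(\<Sum>c\<in>succs G x y. branch G w K' y c) \<le> (\<Sum>c\<in>succs G x y. ?q - 1)"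
      proof (rule sum_mono)
        fix c assume "c \<in> succs G x y"
        then have yc: "adj G y c" by simp
        have "branch G w K' y c \<le> branch G w (Suc K) y c" by (rule branch_mono[where w=w, OF w0 yc]) (use Suc in auto)
        then show "branch G w K' y c \<le> ?q - 1" using small[OF yc] by linarith
      qed
      also have "\<dots> = real (card (succs G x y)) * (?q - 1)" by simp
      also have "\<dots> \<le> real d * (?q - 1)"
      proof -
        have "card (succs G x y) \<le> card (nbrs G y)" using G(2) by (intro card_mono) (auto simp: succs_def)
        then show ?thesis using deg[of y] q1 by (intro mult_right_mono) auto
      qed
      finally have "(\<Sum>c\<in>succs G x y. branch G w K' y c) \<le> real d * (?q - 1)" .
      moreover have "0 \<le> (\<Sum>c\<in>succs G x y. branch G w K' y c)" by (intro sum_nonneg br0) auto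
      ultimately show ?thesis
        using w[OF xb] w0[OF xb] C unfolding Suc True branch.simps by (intro mult_mono) auto
    qed
    also have "\<dots> \<le> C * ((1 + real d) * ?q)"
    proof (rule mult_left_mono)
      have "1 + real d * (q - 1) \<le> (1 + real d) * q" if "1 < q" for q
        using that by (simp add: algebra_simps)
      from this[OF q1] show "1 + real d * (?q - 1) \<le> (1 + real d) * ?q" .
    qed (use C in auto)
    finally have "branch G w K x b \<le> C * (1 + real d) * ?q" by (simp add: mult.assoc)
    then show False using eq q1 by linarith
  qed
qed

lemma branch_walk:
  assumes G: "simple_graph G" "loc_finite G" and deg: "\<And>x. card (nbrs G x) \<le> d"
    and w: "\<And>x b. adj G x b \<Longrightarrow> 1 / C \<le> w x b \<and> w x b \<le> C" and C: "C \<ge> 1"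
  shows "walk G x p y \<Longrightarrow> adj G x b \<Longrightarrow>
    \<exists>c. adj G y c \<and> (1 + branch G w K x b) / (1 + C * (1 + real d)) ^ (length p - 1) \<le> 1 + branch G w (K + (length p - 1)) y c"
proof (induction p arbitrary: x b K)
  case Nil
  then show ?case by (simp add: walk_def)
next
  case (Cons a p)
  let ?k = "1 + C * (1 + real d)"
  have k: "?k > 0" using C by (auto intro!: add_pos_nonneg)
  show ?case
  proof (cases p)
    case Nil
    then show ?thesis using Cons.prems by (auto simp: walk_def)
  next
    case (Cons z p')
    have wk: "walk G z p y" and xz: "adj G x z"
      using Cons.prems Cons by (auto simp: walk_def)
    obtain c where c: "adj G z c" "(1 + branch G w K x b) / ?k \<le> 1 + branch G w (Suc K) z c"
      using branch_nbr[where w=w, OF G deg w C xz Cons.prems(2)] by blast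
    obtain c' where c': "adj G y c'" "(1 + branch G w (Suc K) z c) / ?k ^ (length p - 1) \<le> 1 + branch G w (Suc K + (length p - 1)) y c'"
      using Cons.IH[OF wk c(1)] by blast
    have len: "length (a # p) - 1 = Suc (length p - 1)" using Cons by simp
    have "(1 + branch G w K x b) / ?k ^ Suc (length p - 1) = (1 + branch G w K x b) / ?k / ?k ^ (length p - 1)" by simp
    also have "\<dots> \<le> (1 + branch G w (Suc K) z c) / ?k ^ (length p - 1)"
      using c(2) k by (intro divide_right_mono) auto
    also have "\<dots> \<le> 1 + branch G w (Suc K + (length p - 1)) y c'" by (rule c'(2))
    finally show ?thesis using c'(1) unfolding len by (intro exI[of _ c']) simp
  qed
qed

lemma finite_graph_walk_bound:
  assumes "finite (verts G)" "graph_connected G"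
  obtains D where "\<And>x y. x \<in> verts G \<Longrightarrow> y \<in> verts G \<Longrightarrow> \<exists>p. walk G x p y \<and> length p - 1 \<le> D"
proof -
  have "\<forall>e\<in>verts G \<times> verts G. \<exists>p. walk G (fst e) p (snd e)" using assms(2) by (auto simp: graph_connected_def)
  from bchoice[OF this] obtain P where P: "\<And>e. e \<in> verts G \<times> verts G \<Longrightarrow> walk G (fst e) (P e) (snd e)" by blast
  show ?thesis
  proof (rule that)
    fix x y assume xy: "x \<in> verts G" "y \<in> verts G"
    have "length (P (x, y)) - 1 \<le> (\<Sum>e\<in>verts G \<times> verts G. length (P e) - 1)"
      using xy assms(1) by (intro member_le_sum) auto
    then show "\<exists>p. walk G x p y \<and> length p - 1 \<le> (\<Sum>e\<in>verts G \<times> verts G. length (P e) - 1)"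
      using P[of "(x, y)"] xy by auto
  qed
qed

text \<open>A walk to \<open>x\<close> ends in some arc from \<open>x\<close> to \<open>c\<close>
  that is large but cannot be prescribed. If \<open>c\<close> is not \<open>u1\<close>, one starts
  with the arc to \<open>u1\<close>, turns around in the core to come back from \<open>u1\<close> to
  \<open>x\<close>, and continues to \<open>c\<close>. Both moves take boundedly many arcs, so
  \<kappa> and \<open>D\<close> depend neither on \<open>w\<close> and \<open>K\<close> nor on the
  arcs.\<close>

lemma branch_harnack:
  assumes G: "simple_graph G" "finite (verts G)" "graph_connected G" and C: "C \<ge> 1"
  obtains D \<kappa> where "(\<kappa>::real) > 0" "\<And>w K x0 b0 x u1 u2 u3.
      (\<And>x b. adj G x b \<Longrightarrow> 1 / C \<le> w x b \<and> w x b \<le> C) \<Longrightarrow> adj G x0 b0 \<Longrightarrow>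
      core_arc G x u1 \<Longrightarrow> core_arc G x u2 \<Longrightarrow> core_arc G x u3 \<Longrightarrow> u1 \<noteq> u2 \<Longrightarrow> u1 \<noteq> u3 \<Longrightarrow> u2 \<noteq> u3 \<Longrightarrow>
      \<kappa> * (1 + branch G w K x0 b0) \<le> 1 + branch G w (K + D) x u1"
proof -
  have lf: "loc_finite G" using G nbrs_subset_verts[OF G(1)] by (auto simp: loc_finite_def intro: finite_subset)
  define d where "d = card (verts G)"
  have deg: "card (nbrs G x) \<le> d" for x
    unfolding d_def using G nbrs_subset_verts[OF G(1)] by (intro card_mono) auto
  obtain D1 where D1: "\<And>x y. x \<in> verts G \<Longrightarrow> y \<in> verts G \<Longrightarrow> \<exists>p. walk G x p y \<and> length p - 1 \<le> D1"
    using finite_graph_walk_bound[OF G(2,3)] by blast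
  have "arc_step G \<subseteq> (verts G \<times> verts G) \<times> (verts G \<times> verts G)"
  proof
    fix e assume "e \<in> arc_step G"
    then obtain u v w where e: "e = ((u, v), (v, w))" "core_arc G u v" "core_arc G v w"
      by (auto simp: arc_step_def)
    from simple_graph_adjD[OF G(1) core_arc_adj[OF e(2)]] simple_graph_adjD[OF G(1) core_arc_adj[OF e(3)]]
    show "e \<in> (verts G \<times> verts G) \<times> (verts G \<times> verts G)" using e(1) by simp
  qed
  then have finS: "finite (arc_step G)" by (rule finite_subset) (use G in auto)
  \<comment> \<open>A chain of \<open>arc_step\<close> can be shortened to at most as many steps as
    the relation has pairs; the extra one is the final step to \<open>c\<close>.\<close>
  define D2 where "D2 = Suc (card (arc_step G))"
  let ?k = "1 + C * (1 + real d)"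
  have k: "?k \<ge> 1" using C by auto
  define \<kappa> where "\<kappa> = (1 / ?k) ^ D1 * (1 / C) ^ D2"
  show ?thesis
  proof (rule that[of \<kappa> "D1 + D2"])
    have "?k > 0" using k by linarith
    then show "\<kappa> > 0" unfolding \<kappa>_def using C by (intro mult_pos_pos zero_less_power) auto
    fix w K x0 b0 x u1 u2 u3
    assume w: "\<And>x b. adj G x b \<Longrightarrow> 1 / C \<le> w x b \<and> w x b \<le> C" and xb0: "adj G x0 b0"
      and core: "core_arc G x u1" "core_arc G x u2" "core_arc G x u3" and ne: "u1 \<noteq> u2" "u1 \<noteq> u3" "u2 \<noteq> u3"
    have w0: "w x b \<ge> 0" if "adj G x b" for x b
    proof -
      have "1 / C > 0" using C by simp
      then show ?thesis using w[OF that] by linarith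
    qed
    have xu: "adj G x u1" using core by (auto simp: core_arc_def dest: inf_arc_adj)
    have V: "x0 \<in> verts G" "x \<in> verts G" using simple_graph_adjD[OF G(1)] xb0 xu by auto
    obtain p where p: "walk G x0 p x" "length p - 1 \<le> D1" using D1[OF V] by blast
    obtain c where c: "adj G x c" "(1 + branch G w K x0 b0) / ?k ^ (length p - 1) \<le> 1 + branch G w (K + (length p - 1)) x c"
      using branch_walk[where w=w, OF G(1) lf deg w C p(1) xb0] by blast
    have B0: "0 \<le> 1 + branch G w K x0 b0" using branch_nonneg[where w=w and K=K, OF w0 xb0] by simp
    have "(1 / ?k) ^ D1 * (1 + branch G w K x0 b0) \<le> (1 / ?k) ^ (length p - 1) * (1 + branch G w K x0 b0)"
      using k p(2) B0 by (intro mult_right_mono power_decreasing) auto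
    also have "\<dots> \<le> 1 + branch G w (K + (length p - 1)) x c"
      using c(2) by (simp add: power_one_over)
    also have "\<dots> \<le> 1 + branch G w (K + D1) x c"
      using branch_mono[where w=w and K="K + (length p - 1)" and K'="K + D1", OF w0 c(1)] p(2) by simp
    finally have c2: "(1 / ?k) ^ D1 * (1 + branch G w K x0 b0) \<le> 1 + branch G w (K + D1) x c" .
    have C2: "0 \<le> (1 / C) ^ D2" "(1 / C) ^ D2 \<le> 1" using C by (auto intro!: power_le_one)
    have c3: "\<kappa> * (1 + branch G w K x0 b0) \<le> (1 / C) ^ D2 * (1 + branch G w (K + D1) x c)"
      unfolding \<kappa>_def using mult_left_mono[OF c2 C2(1)] by (simp add: mult_ac)
    show "\<kappa> * (1 + branch G w K x0 b0) \<le> 1 + branch G w (K + (D1 + D2)) x u1"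
    proof (cases "c = u1")
      case True
      have "(1 / C) ^ D2 * (1 + branch G w (K + D1) x c) \<le> 1 + branch G w (K + D1) x c"
        using C2 branch_nonneg[where w=w and K="K + D1", OF w0 c(1)] by (intro mult_left_le_one_le) auto
      also have "\<dots> \<le> 1 + branch G w (K + (D1 + D2)) x u1"
        using branch_mono[where w=w and K="K + D1" and K'="K + (D1 + D2)", OF w0 xu] True by simp
      finally show ?thesis using c3 by linarith
    next
      case False
      have "((x, u1), (u1, x)) \<in> (arc_step G)\<^sup>*"
        by (rule core_turn_around[OF G(1,2) core ne])
      then obtain n where n: "n \<le> card (arc_step G)" "((x, u1), (u1, x)) \<in> arc_step G ^^ n"
        unfolding rtrancl_finite_eq_relpow[OF finS] by auto
      have ux: "adj G u1 x" using simple_graph_adjD[OF G(1) xu] by simp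
      have ge: "w x b \<ge> 1 / C" if "adj G x b" for x b using w[OF that] by simp
      have iC: "0 < 1 / C" "1 / C \<le> 1" using C by auto
      have s1: "(1 / C) * (1 + branch G w (K + D1) x c) \<le> branch G w (Suc (K + D1)) u1 x"
      proof (rule branch_arc_step[where w=w, OF lf ge iC ux])
        show "c \<in> succs G u1 x" unfolding mem_succs using c(1) False by blast
      qed
      have "(1 / C) ^ D2 * (1 + branch G w (K + D1) x c) \<le> (1 / C) ^ Suc n * (1 + branch G w (K + D1) x c)"
        using n(1) iC branch_nonneg[where w=w and K="K + D1", OF w0 c(1)]
        by (intro mult_right_mono power_decreasing) (auto simp: D2_def)
      also have "\<dots> = (1 / C) ^ n * ((1 / C) * (1 + branch G w (K + D1) x c))" by simp
      also have "\<dots> \<le> (1 / C) ^ n * (1 + branch G w (Suc (K + D1)) u1 x)"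
        using s1 iC by (intro mult_left_mono) (auto simp del: branch.simps)
      also have "\<dots> \<le> 1 + branch G w (Suc (K + D1) + n) x u1"
        by (rule branch_arc_steps[where w=w, OF lf ge iC n(2)])
      also have "\<dots> \<le> 1 + branch G w (K + (D1 + D2)) x u1"
        using branch_mono[where w=w and K="Suc (K + D1) + n" and K'="K + (D1 + D2)", OF w0 xu] n(1) by (simp add: D2_def del: branch.simps)
      finally show ?thesis using c3 by linarith
    qed
  qed
qed

section \<open>Mass transport\<close>

definition mat_app :: "'e set \<Rightarrow> ('e \<Rightarrow> 'e \<Rightarrow> real) \<Rightarrow> ('e \<Rightarrow> real) \<Rightarrow> 'e \<Rightarrow> real" where
  "mat_app E B g e = (\<Sum>f\<in>E. B e f * g f)"

text \<open>The partial sum g + B g + ... + B^(k-1) g; \<open>B\<close> will be a transfer matrix on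
  arcs.\<close>

primrec mat_series :: "'e set \<Rightarrow> ('e \<Rightarrow> 'e \<Rightarrow> real) \<Rightarrow> ('e \<Rightarrow> real) \<Rightarrow> nat \<Rightarrow> 'e \<Rightarrow> real" where
  "mat_series E B g 0 e = 0"
| "mat_series E B g (Suc k) e = g e + mat_app E B (mat_series E B g k) e"

lemma mat_app_series: "mat_app E B (mat_series E B g k) e = mat_series E B (mat_app E B g) k e"
proof (induction k arbitrary: e)
  case 0
  then show ?case by (simp add: mat_app_def)
next
  case (Suc k)
  have "mat_app E B (mat_series E B g (Suc k)) e = mat_app E B g e + mat_app E B (mat_app E B (mat_series E B g k)) e"
    by (simp add: mat_app_def distrib_left sum.distrib)
  also have "mat_app E B (mat_series E B g k) = mat_series E B (mat_app E B g) k"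
    using Suc.IH by (rule ext)
  finally show ?case by simp
qed

lemma mat_series_adjoint:
  "(\<Sum>e\<in>E. h e * mat_series E B g k e) = (\<Sum>e\<in>E. g e * mat_series E (\<lambda>e f. B f e) h k e)"
proof (induction k arbitrary: g)
  case (Suc k)
  let ?v = "mat_series E (\<lambda>e f. B f e) h k"
  have "(\<Sum>e\<in>E. h e * mat_series E B g (Suc k) e)
      = (\<Sum>e\<in>E. h e * g e) + (\<Sum>e\<in>E. h e * mat_series E B (mat_app E B g) k e)"
    by (simp add: mat_app_series distrib_left sum.distrib)
  also have "(\<Sum>e\<in>E. h e * mat_series E B (mat_app E B g) k e) = (\<Sum>e\<in>E. mat_app E B g e * ?v e)"
    by (rule Suc.IH)
  also have "\<dots> = (\<Sum>e\<in>E. \<Sum>f\<in>E. B e f * g f * ?v e)"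
    by (simp add: mat_app_def sum_distrib_right)
  also have "\<dots> = (\<Sum>f\<in>E. g f * (\<Sum>e\<in>E. B e f * ?v e))"
    by (subst sum.swap) (simp add: sum_distrib_left mult_ac)
  finally show ?case by (simp add: mat_app_def distrib_left sum.distrib mult.commute)
qed simp

definition arcs :: "'a sgraph \<Rightarrow> ('a \<times> 'a) set" where
  "arcs G = {(x, b). adj G x b}"

lemma finite_arcs: "simple_graph G \<Longrightarrow> finite (verts G) \<Longrightarrow> finite (arcs G)"
  by (rule finite_subset[of _ "verts G \<times> verts G"]) (auto simp: arcs_def dest: simple_graph_adjD)

lemma sum_arcs_from:
  assumes "finite (arcs G)"
  shows "(\<Sum>f\<in>arcs G. of_bool (fst f = b \<and> snd f \<noteq> x) * g f) = (\<Sum>c\<in>succs G x b. g (b, c) :: real)"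
proof -
  have "(\<Sum>f\<in>arcs G. of_bool (fst f = b \<and> snd f \<noteq> x) * g f) = (\<Sum>f\<in>(\<lambda>c. (b, c)) ` succs G x b. g f)"
    using assms by (intro sum.mono_neutral_cong_right) (auto simp: arcs_def)
  then show ?thesis by (simp add: sum.reindex inj_on_def)
qed

lemma sum_arcs_into:
  assumes "simple_graph G" "finite (arcs G)"
  shows "(\<Sum>f\<in>arcs G. of_bool (snd f = x \<and> fst f \<noteq> b) * g f) = (\<Sum>z\<in>succs G b x. g (z, x) :: real)"
proof -
  have "(\<Sum>f\<in>arcs G. of_bool (snd f = x \<and> fst f \<noteq> b) * g f) = (\<Sum>f\<in>(\<lambda>z. (z, x)) ` succs G b x. g f)"
    using assms simple_graph_adjD(4)[OF assms(1)]
    by (intro sum.mono_neutral_cong_right) (auto simp: arcs_def image_iff)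
  then show ?thesis by (simp add: sum.reindex inj_on_def)
qed

lemma sum_arcs_swap:
  assumes "simple_graph G"
  shows "(\<Sum>(x, b)\<in>arcs G. g b x) = (\<Sum>(x, b)\<in>arcs G. g x b)"
  by (rule sum.reindex_bij_witness[of _ prod.swap prod.swap]) (use assms in \<open>auto simp: arcs_def dest: simple_graph_adjD\<close>)

text \<open>Both sides sum over all paths of at most \<open>K\<close> arcs, read in either
  direction; formally the transfer matrix is replaced by its transpose. The identity concerns the
  total over all arcs, which is why the number of arcs enters when single branch sums are
  compared.\<close>

lemma sum_branch_reverse:
  assumes G: "simple_graph G" "finite (verts G)"
  shows "(\<Sum>(x, b)\<in>arcs G. branch G w K x b) = (\<Sum>(x, b)\<in>arcs G. branch G (\<lambda>x b. w b x) K x b)"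
proof -
  note fin = finite_arcs[OF G]
  define B where "B e f = w (fst e) (snd e) * of_bool (fst f = snd e \<and> snd f \<noteq> fst e)" for e f :: "'a \<times> 'a"
  have u: "mat_series (arcs G) B (\<lambda>e. w (fst e) (snd e)) K (x, b) = branch G w K x b" for x b
  proof (induction K arbitrary: x b)
    case (Suc K)
    let ?u = "mat_series (arcs G) B (\<lambda>e. w (fst e) (snd e)) K"
    have "mat_app (arcs G) B ?u (x, b) = w x b * (\<Sum>f\<in>arcs G. of_bool (fst f = b \<and> snd f \<noteq> x) * ?u f)"
      unfolding mat_app_def B_def sum_distrib_left by (intro sum.cong) auto
    also have "\<dots> = w x b * (\<Sum>c\<in>succs G x b. branch G w K b c)"
      unfolding sum_arcs_from[OF fin] using Suc.IH by simp
    finally show ?case by (simp add: distrib_left)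
  qed simp
  have v: "w x b * mat_series (arcs G) (\<lambda>e f. B f e) (\<lambda>_. 1) K (x, b) = branch G (\<lambda>x b. w b x) K b x" for x b
  proof (induction K arbitrary: x b)
    case (Suc K)
    have "mat_app (arcs G) (\<lambda>e f. B f e) (mat_series (arcs G) (\<lambda>e f. B f e) (\<lambda>_. 1) K) (x, b)
      = (\<Sum>f\<in>arcs G. of_bool (snd f = x \<and> fst f \<noteq> b) * (w (fst f) (snd f) * mat_series (arcs G) (\<lambda>e f. B f e) (\<lambda>_. 1) K f))"
      unfolding mat_app_def B_def by (intro sum.cong) auto
    also have "\<dots> = (\<Sum>z\<in>succs G b x. branch G (\<lambda>x b. w b x) K x z)"
      unfolding sum_arcs_into[OF G(1) fin] using Suc.IH by simp
    finally show ?case by simp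
  qed simp
  have "(\<Sum>(x, b)\<in>arcs G. branch G w K x b) = (\<Sum>e\<in>arcs G. 1 * mat_series (arcs G) B (\<lambda>e. w (fst e) (snd e)) K e)"
    by (intro sum.cong) (auto simp: u)
  also have "\<dots> = (\<Sum>e\<in>arcs G. w (fst e) (snd e) * mat_series (arcs G) (\<lambda>e f. B f e) (\<lambda>_. 1) K e)"
    by (rule mat_series_adjoint)
  also have "\<dots> = (\<Sum>(x, b)\<in>arcs G. branch G (\<lambda>x b. w b x) K b x)"
    by (intro sum.cong) (auto simp: v)
  also have "\<dots> = (\<Sum>(x, b)\<in>arcs G. branch G (\<lambda>x b. w b x) K x b)"
    by (rule sum_arcs_swap[OF G(1)])
  finally show ?thesis .
qed

section \<open>Detours around short cycles\<close>

text \<open>\<open>bad y x b\<close> marks a passage \<open>y, x, b\<close> of a walk at which the closed walk \<open>loop y x b\<close> can be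
  inserted. Since walks are read backwards, \<open>loop y x b = x # y # \<dots> # z\<close> is entered from \<open>x\<close>
  through \<open>z\<close> and left from \<open>y\<close> through \<open>x\<close>.\<close>

locale detour_graph =
  fixes G :: "'a sgraph" and bad :: "'a \<Rightarrow> 'a \<Rightarrow> 'a \<Rightarrow> bool" and loop :: "'a \<Rightarrow> 'a \<Rightarrow> 'a \<Rightarrow> 'a list"
    and L :: nat
  assumes simple: "simple_graph G" and finite_verts: "finite (verts G)"
    and loop: "bad y x b \<Longrightarrow> \<exists>s. loop y x b = x # y # s \<and> nb_walk G (loop y x b @ [x]) \<and>
      last (loop y x b) \<noteq> y \<and> last (loop y x b) \<noteq> b \<and> length (loop y x b) \<le> L"
begin

text \<open>At each bad passage one turn around the loop is inserted or not. The loop returns to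
  \<open>x\<close> from \<open>y\<close>, so \<open>y\<close>, \<open>x\<close>, \<open>b\<close>
  are still consecutive after the insertion.\<close>

fun detours :: "'a list \<Rightarrow> 'a list set" where
  "detours (b # x # y # q) = (#) b ` detours (x # y # q) \<union>
     (if bad y x b then (\<lambda>p. b # loop y x b @ p) ` detours (x # y # q) else {})"
| "detours p = {p}"

fun bad_count :: "'a list \<Rightarrow> nat" where
  "bad_count (b # x # y # q) = of_bool (bad y x b) + bad_count (x # y # q)"
| "bad_count p = 0"

lemma loc_finite: "loc_finite G"
  using finite_verts nbrs_subset_verts[OF simple] by (auto simp: loc_finite_def intro: finite_subset)

lemma finite_detours: "finite (detours P)"
  by (induction P rule: detours.induct) auto

text \<open>Since the two leading vertices are kept, the next vertex or loop can be prepended as if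
  nothing had been inserted. The factor \<open>Suc L\<close> allows for one loop per vertex.\<close>

lemma detours_form:
  assumes "nb_walk G P" "p \<in> detours P"
  shows "nb_walk G p \<and> last p = last P \<and> length p \<le> Suc L * length P \<and> take 2 p = take 2 P"
  using assms
proof (induction P arbitrary: p rule: detours.induct)
  case (1 b x y q)
  have nb: "nb_walk G (x # y # q)" and xb: "adj G x b" and bny: "b \<noteq> y"
    using "1.prems"(1) by auto
  note IH1 = "1.IH"(1)[OF nb]
  from "1.prems"(2) consider
    (direct) p' where "p = b # p'" "p' \<in> detours (x # y # q)" |
    (detour) p' where "p = b # loop y x b @ p'" "p' \<in> detours (x # y # q)" "bad y x b"
    by (auto split: if_splits)
  then show ?case
  proof cases
    case (direct p')
    note IH = IH1[OF direct(2)]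
    then obtain q' where q': "p' = x # y # q'" by (cases p' rule: remdups_adj.cases) auto
    show ?thesis using IH xb bny direct(1) unfolding q' by auto
  next
    case (detour p')
    note IH = IH1[OF detour(2)]
    then obtain q' where q': "p' = x # y # q'" by (cases p' rule: remdups_adj.cases) auto
    obtain s where s: "loop y x b = x # y # s" "nb_walk G (loop y x b @ [x])"
      "last (loop y x b) \<noteq> y" "length (loop y x b) \<le> L" using loop[OF detour(3)] by blast
    have "nb_walk G ((b # loop y x b) @ x # y # q')"
    proof (rule nb_walk_append[OF simple])
      show "nb_walk G ((b # loop y x b) @ [x])" using s xb bny by auto
      show "nb_walk G (x # y # q')" using IH q' by simp
      show "last (b # loop y x b) \<noteq> hd (y # q')" using s by auto
    qed
    then have "nb_walk G p" unfolding detour(1) q' by simp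
    moreover have "last p = last (x # y # q)" unfolding detour(1) using IH q' by simp
    moreover have "length p \<le> Suc L * length (b # x # y # q)"
      unfolding detour(1) using IH s(4) by simp
    moreover have "take 2 p = [b, x]" unfolding detour(1) s(1) by simp
    ultimately show ?thesis by simp
  qed
qed auto

text \<open>This separates the lists with a given detour from those without it. Peeling off equal
  tails reduces the comparison to a single loop \<open>t\<close> inserted at \<open>b\<close>, which
  would have to end in \<open>b\<close>; the locale excludes that.\<close>

lemma detours_suffix:
  assumes "nb_walk G P" "p \<in> detours P" "p' \<in> detours P" "p = s @ p'"
  shows "s = []"
  using assms
proof (induction P arbitrary: p p' s rule: detours.induct)
  case (1 b x y q)
  have nb: "nb_walk G (x # y # q)" using "1.prems"(1) by auto
  let ?D = "detours (x # y # q)"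
  have IH: "r = r'" if r: "r \<in> ?D" "r' \<in> ?D" "u @ r = u' @ r'" for r r' u u'
  proof -
    from r(3) obtain v where "u = u' @ v \<and> v @ r = r' \<or> u @ v = u' \<and> r = v @ r'"
      by (auto simp: append_eq_append_conv2)
    then show ?thesis
    proof
      assume "u = u' @ v \<and> v @ r = r'"
      then show ?thesis using "1.IH"(1)[OF nb r(2,1)] by auto
    next
      assume "u @ v = u' \<and> r = v @ r'"
      then show ?thesis using "1.IH"(1)[OF nb r(1,2)] by auto
    qed
  qed
  have last: "bad y x b \<Longrightarrow> loop y x b \<noteq> [] \<and> last (loop y x b) \<noteq> b"
    using loop by fastforce
  from "1.prems"(2) obtain r t where r: "r \<in> ?D" "p = b # t @ r" "t = [] \<or> bad y x b \<and> t = loop y x b"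
    by (auto split: if_splits)
  from "1.prems"(3) obtain r' t' where r': "r' \<in> ?D" "p' = b # t' @ r'" "t' = [] \<or> bad y x b \<and> t' = loop y x b"
    by (auto split: if_splits)
  have eq: "(b # t) @ r = (s @ b # t') @ r'" using "1.prems"(4) r r' by simp
  from IH[OF r(1) r'(1) eq] have "b # t = s @ b # t'" using eq by simp
  show ?case
  proof (cases s)
    case (Cons a s')
    then have "t = s' @ b # t'" using \<open>b # t = s @ b # t'\<close> by simp
    moreover from this have t: "bad y x b" "t = loop y x b" using r(3) by auto
    moreover have "length t > length t'" using \<open>t = s' @ b # t'\<close> by simp
    ultimately have "t' = []" using r'(3) by auto
    then have "last t = b" using \<open>t = s' @ b # t'\<close> by simp
    then show ?thesis using last[OF t(1)] t(2) by simp
  qed simp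
qed auto

lemma nb_weight_append_ge:
  assumes w: "\<And>x b. adj G x b \<Longrightarrow> \<epsilon> \<le> w x b" and \<epsilon>: "0 < \<epsilon>" and l: "l > 0"
  shows "nb_walk G (s @ p) \<Longrightarrow> p \<noteq> [] \<Longrightarrow> \<epsilon> ^ length s * nb_weight l w p \<le> nb_weight l w (s @ p) \<and> 0 < nb_weight l w p"
proof (induction s)
  case Nil
  have "0 < nb_weight l w p" if "nb_walk G p" for p
    using that
  proof (induction p rule: induct_list012)
    case (3 z x q)
    have "adj G x z" "nb_walk G (x # q)" using nb_walk_ConsD[OF simple 3(3)] by auto
    then show ?case using 3(2) w[of x z] \<epsilon> by simp
  qed (use l in auto)
  then show ?case using Nil by simp
next
  case (Cons z s)
  then obtain x q where xq: "s @ p = x # q" by (cases "s @ p") auto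
  have nb: "nb_walk G (z # x # q)" using Cons.prems xq by simp
  have zx: "adj G x z" "nb_walk G (s @ p)" using nb_walk_ConsD[OF simple nb] xq by auto
  note IH = Cons.IH[OF zx(2) Cons.prems(2)]
  have "\<epsilon> ^ length (z # s) * nb_weight l w p = \<epsilon> * (\<epsilon> ^ length s * nb_weight l w p)" by simp
  also have "\<dots> \<le> w x z * nb_weight l w (s @ p)"
    using IH w[OF zx(1)] \<epsilon> by (intro mult_mono) auto
  also have "\<dots> = nb_weight l w ((z # s) @ p)" using xq by simp
  finally show ?case using IH by simp
qed

lemma nb_weight_pos:
  assumes "\<And>x b. adj G x b \<Longrightarrow> \<epsilon> \<le> w x b" "0 < \<epsilon>" "l > 0" "nb_walk G p"
  shows "0 < nb_weight l w p"
  using nb_weight_append_ge[where w=w and s="[]" and p=p, OF assms(1-3)] assms(4) nb_walk_not_Nil[OF assms(4)] by auto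

text \<open>Each bad passage splits the detours into two disjoint families of lists, and inserting a
  loop keeps at least the share \<epsilon>^L of the weight, so the total gains the factor 1 +
  \<epsilon>^L.\<close>

lemma sum_detours_ge:
  assumes w: "\<And>x b. adj G x b \<Longrightarrow> \<epsilon> \<le> w x b" and \<epsilon>: "0 < \<epsilon>" "\<epsilon> \<le> 1" and l: "l > 0"
  shows "nb_walk G P \<Longrightarrow> nb_weight l w P * (1 + \<epsilon> ^ L) ^ bad_count P \<le> (\<Sum>p\<in>detours P. nb_weight l w p)"
proof (induction P rule: detours.induct)
  case (1 b x y q)
  have nb: "nb_walk G (x # y # q)" and xb: "adj G x b" using "1.prems" by auto
  let ?D = "detours (x # y # q)" and ?W = "nb_weight l w"
  have w0: "w x b > 0" using w[OF xb] \<epsilon> by linarith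
  have form: "\<exists>r. p = x # y # r" if "p \<in> ?D" for p
    using detours_form[OF nb that] by (cases p rule: remdups_adj.cases) auto
  have IH: "?W (x # y # q) * (1 + \<epsilon> ^ L) ^ bad_count (x # y # q) \<le> sum ?W ?D" by (rule "1.IH"(1)[OF nb])
  have pos: "0 \<le> ?W p" if "p \<in> ?D" for p
    using nb_weight_pos[where w=w, OF w \<epsilon>(1) l] detours_form[OF nb that] by (simp add: less_imp_le)
  have c1: "(\<Sum>p\<in>(#) b ` ?D. ?W p) = w x b * sum ?W ?D"
  proof -
    have "(\<Sum>p\<in>(#) b ` ?D. ?W p) = (\<Sum>p\<in>?D. ?W (b # p))" by (simp add: sum.reindex)
    also have "\<dots> = (\<Sum>p\<in>?D. w x b * ?W p)"
    proof (rule sum.cong)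
      fix p assume "p \<in> ?D"
      then obtain r where "p = x # y # r" using form by blast
      then show "?W (b # p) = w x b * ?W p" by simp
    qed simp
    finally show ?thesis by (simp add: sum_distrib_left)
  qed
  show ?case
  proof (cases "bad y x b")
    case False
    have "?W (b # x # y # q) * (1 + \<epsilon> ^ L) ^ bad_count (b # x # y # q)
      = w x b * (?W (x # y # q) * (1 + \<epsilon> ^ L) ^ bad_count (x # y # q))" using False by simp
    also have "\<dots> \<le> w x b * sum ?W ?D" using IH w0 by (intro mult_left_mono) auto
    finally show ?thesis using c1 False by simp
  next
    case True
    let ?s = "loop y x b"
    let ?g = "\<lambda>p. b # ?s @ p"
    obtain s' where s: "?s = x # y # s'" "length ?s \<le> L" using loop[OF True] by blast
    have fin: "finite ?D" by (rule finite_detours)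
    have disj: "(#) b ` ?D \<inter> ?g ` ?D = {}"
    proof (rule ccontr)
      assume "\<not> ?thesis"
      then obtain p p' where "p \<in> ?D" "p' \<in> ?D" "p = ?s @ p'" by auto
      from detours_suffix[OF nb this] s show False by simp
    qed
    have ge: "w x b * (\<epsilon> ^ L * ?W p) \<le> ?W (?g p)" if "p \<in> ?D" for p
    proof -
      have gin: "?g p \<in> detours (b # x # y # q)" using that True by simp
      have nbg: "nb_walk G (b # x # y # s' @ p)"
        using detours_form[OF "1.prems" gin] s by simp
      have nbs: "nb_walk G (?s @ p)" using nb_walk_ConsD(1)[OF simple nbg] s by simp
      have pn: "p \<noteq> []" using form[OF that] by auto
      have "\<epsilon> ^ L * ?W p \<le> \<epsilon> ^ length ?s * ?W p"
        using s \<epsilon> pos[OF that] by (intro mult_right_mono power_decreasing) auto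
      also have "\<dots> \<le> ?W (?s @ p)"
        using nb_weight_append_ge[where w=w, OF w \<epsilon>(1) l nbs pn] by blast
      finally have "w x b * (\<epsilon> ^ L * ?W p) \<le> w x b * ?W (?s @ p)" using w0 by (intro mult_left_mono) auto
      also have "\<dots> = ?W (?g p)" using s by simp
      finally show ?thesis .
    qed
    have "(\<Sum>p\<in>?D. w x b * (\<epsilon> ^ L * ?W p)) \<le> (\<Sum>p\<in>?D. ?W (?g p))" by (rule sum_mono[OF ge])
    also have "\<dots> = (\<Sum>p\<in>?g ` ?D. ?W p)" by (subst sum.reindex) (auto simp: inj_on_def)
    finally have c2: "w x b * \<epsilon> ^ L * sum ?W ?D \<le> (\<Sum>p\<in>?g ` ?D. ?W p)"
      by (simp add: sum_distrib_left mult.assoc)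
    have "?W (b # x # y # q) * (1 + \<epsilon> ^ L) ^ bad_count (b # x # y # q)
      = w x b * (1 + \<epsilon> ^ L) * (?W (x # y # q) * (1 + \<epsilon> ^ L) ^ bad_count (x # y # q))" using True by simp
    also have "\<dots> \<le> w x b * (1 + \<epsilon> ^ L) * sum ?W ?D"
      using IH w0 \<epsilon> by (intro mult_left_mono) auto
    also have "\<dots> = w x b * sum ?W ?D + w x b * \<epsilon> ^ L * sum ?W ?D" by (simp add: algebra_simps)
    also have "\<dots> \<le> (\<Sum>p\<in>(#) b ` ?D. ?W p) + (\<Sum>p\<in>?g ` ?D. ?W p)" using c1 c2 by simp
    also have "\<dots> = (\<Sum>p\<in>detours (b # x # y # q). ?W p)"
      using True disj fin by (simp add: sum.union_disjoint)
    finally show ?thesis .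
  qed
qed auto

section \<open>Second moments of the weights over all paths of bounded length\<close>

definition paths :: "nat \<Rightarrow> 'a list set" where
  "paths K = {p. nb_walk G p \<and> length p \<le> Suc K}"

definition paths_to :: "nat \<Rightarrow> 'a \<Rightarrow> 'a \<Rightarrow> 'a list set" where
  "paths_to K x b = {p \<in> paths K. take 2 p = [b, x]}"

lemma finite_paths: "finite (paths K)"
proof (rule finite_subset)
  show "paths K \<subseteq> {p. set p \<subseteq> verts G \<and> length p \<le> Suc K}"
    using nb_walk_verts[OF simple] by (auto simp: paths_def)
qed (rule finite_lists_length_le[OF finite_verts])

lemma finite_paths_to: "finite (paths_to K x b)"
  using finite_paths by (simp add: paths_to_def)

lemma paths_toE:
  assumes "p \<in> paths_to K x b"
  obtains q where "p = b # x # q" "nb_walk G p" "length p \<le> Suc K"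
  using assms by (cases p rule: remdups_adj.cases) (auto simp: paths_to_def paths_def)

lemma sum_paths_to_Suc:
  assumes "adj G x b"
  shows "(\<Sum>p\<in>paths_to (Suc K) x b. f p) = f [b, x] + (\<Sum>y\<in>succs G b x. \<Sum>p\<in>paths_to K y x. f (b # p) :: real)"
proof -
  have eq: "paths_to (Suc K) x b = insert [b, x] (\<Union>y\<in>succs G b x. (#) b ` paths_to K y x)" (is "?A = ?B")
  proof (intro equalityI subsetI)
    fix p assume p: "p \<in> ?A"
    then obtain q where q: "p = b # x # q" "nb_walk G p" "length p \<le> Suc (Suc K)" by (rule paths_toE)
    show "p \<in> ?B"
    proof (cases q)
      case (Cons y q')
      have nb: "nb_walk G (x # y # q')" "b \<noteq> y" using q Cons by auto
      then have "adj G x y" using nb_walk_ConsD(2)[OF simple nb(1)] simple_graph_adjD[OF simple] by blast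
      moreover have "x # y # q' \<in> paths_to K y x" using nb q Cons by (simp add: paths_to_def paths_def)
      ultimately show ?thesis using nb q Cons by auto
    qed (use q in auto)
  next
    fix p assume "p \<in> ?B"
    then consider "p = [b, x]" | y p' where "y \<in> succs G b x" "p' \<in> paths_to K y x" "p = b # p'" by auto
    then show "p \<in> ?A"
    proof cases
      case 2
      then obtain q where "p' = x # y # q" "nb_walk G p'" "length p' \<le> Suc K" using paths_toE by metis
      then show ?thesis using 2 assms by (auto simp: paths_to_def paths_def)
    qed (use assms in \<open>auto simp: paths_to_def paths_def\<close>)
  qed
  have notin: "[b, x] \<notin> (\<Union>y\<in>succs G b x. (#) b ` paths_to K y x)"
    by (auto elim: paths_toE)
  have disj: "(#) b ` paths_to K y x \<inter> (#) b ` paths_to K y' x = {}" if "y \<noteq> y'" for y y'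
    using that by (auto elim!: paths_toE)
  have fin: "finite (succs G b x)" using loc_finite by simp
  have "(\<Sum>p\<in>?A. f p) = f [b, x] + (\<Sum>p\<in>(\<Union>y\<in>succs G b x. (#) b ` paths_to K y x). f p)"
    unfolding eq using notin fin finite_paths_to by (subst sum.insert) auto
  also have "(\<Sum>p\<in>(\<Union>y\<in>succs G b x. (#) b ` paths_to K y x). f p) = (\<Sum>y\<in>succs G b x. \<Sum>p\<in>(#) b ` paths_to K y x. f p)"
    using fin finite_paths_to disj by (intro sum.UNION_disjoint) auto
  also have "\<dots> = (\<Sum>y\<in>succs G b x. \<Sum>p\<in>paths_to K y x. f (b # p))"
    by (rule sum.cong[OF refl], subst sum.reindex) auto
  finally show ?thesis .
qed

lemma paths_to_0: "paths_to 0 x b = {}"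
  by (auto elim: paths_toE)

lemma sum_paths:
  "(\<Sum>p\<in>paths K. f p) = (\<Sum>v\<in>verts G. f [v]) + (\<Sum>(x, b)\<in>arcs G. \<Sum>p\<in>paths_to K x b. f p :: real)"
proof -
  have eq: "paths K = (\<lambda>v. [v]) ` verts G \<union> (\<Union>e\<in>arcs G. paths_to K (fst e) (snd e))" (is "_ = ?A \<union> ?B")
  proof (intro equalityI subsetI)
    fix p assume p: "p \<in> paths K"
    show "p \<in> ?A \<union> ?B"
    proof (cases p rule: remdups_adj.cases)
      case (3 b x q)
      then have "adj G x b" using p nb_walk_ConsD(2)[OF simple, of b x q] by (auto simp: paths_def)
      moreover have "p \<in> paths_to K x b" using p 3 by (auto simp: paths_to_def)
      ultimately show ?thesis by (auto simp: arcs_def)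
    qed (use p in \<open>auto simp: paths_def\<close>)
  qed (auto simp: paths_def paths_to_def)
  have fin: "finite (arcs G)" by (rule finite_arcs[OF simple finite_verts])
  have "(\<Sum>p\<in>paths K. f p) = (\<Sum>p\<in>?A. f p) + (\<Sum>p\<in>?B. f p)"
    unfolding eq using fin finite_verts finite_paths_to by (intro sum.union_disjoint) (auto elim!: paths_toE)
  also have "(\<Sum>p\<in>?A. f p) = (\<Sum>v\<in>verts G. f [v])" by (subst sum.reindex) (auto simp: inj_on_def)
  also have "(\<Sum>p\<in>?B. f p) = (\<Sum>e\<in>arcs G. \<Sum>p\<in>paths_to K (fst e) (snd e). f p)"
    using fin finite_paths_to by (intro sum.UNION_disjoint) (auto elim!: paths_toE)
  finally show ?thesis by (simp add: case_prod_beta)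
qed

text \<open>A path ending with the arc from \<open>x\<close> to \<open>b\<close> is seen backwards,
  from \<open>b\<close> through \<open>x\<close>. Its weights still follow the direction of travel,
  hence the exchanged arguments; the denominator comes from the starting point.\<close>

lemma sum_weight_paths_to:
  assumes "adj G x b"
  shows "(\<Sum>p\<in>paths_to K x b. (nb_weight l w p)\<^sup>2) = branch G (\<lambda>x b. (w b x)\<^sup>2) K b x / l\<^sup>2"
  using assms
proof (induction K arbitrary: x b)
  case 0
  then show ?case by (simp add: paths_to_0)
next
  case (Suc K)
  have "(\<Sum>p\<in>paths_to (Suc K) x b. (nb_weight l w p)\<^sup>2)
     = (w x b / l)\<^sup>2 + (\<Sum>y\<in>succs G b x. \<Sum>p\<in>paths_to K y x. (nb_weight l w (b # p))\<^sup>2)"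
    by (simp add: sum_paths_to_Suc[OF Suc.prems])
  also have "(\<Sum>y\<in>succs G b x. \<Sum>p\<in>paths_to K y x. (nb_weight l w (b # p))\<^sup>2)
     = (\<Sum>y\<in>succs G b x. (w x b)\<^sup>2 * (branch G (\<lambda>x b. (w b x)\<^sup>2) K x y / l\<^sup>2))"
  proof (intro sum.cong refl)
    fix y assume y: "y \<in> succs G b x"
    then have yx: "adj G y x" using simple_graph_adjD[OF simple] by simp
    have "(\<Sum>p\<in>paths_to K y x. (nb_weight l w (b # p))\<^sup>2) = (\<Sum>p\<in>paths_to K y x. (w x b)\<^sup>2 * (nb_weight l w p)\<^sup>2)"
      by (intro sum.cong) (auto elim!: paths_toE simp: power_mult_distrib)
    also have "\<dots> = (w x b)\<^sup>2 * (branch G (\<lambda>x b. (w b x)\<^sup>2) K x y / l\<^sup>2)"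
      by (simp add: Suc.IH[OF yx] flip: sum_distrib_left)
    finally show "(\<Sum>p\<in>paths_to K y x. (nb_weight l w (b # p))\<^sup>2) = (w x b)\<^sup>2 * (branch G (\<lambda>x b. (w b x)\<^sup>2) K x y / l\<^sup>2)" .
  qed
  finally show ?case
    by (simp add: power_divide sum_distrib_left sum_divide_distrib distrib_left add_divide_distrib)
qed

text \<open>The right side counts paths together with one bad passage in them. Cutting at the
  passage leaves a past ending with the arc from \<open>y\<close> to \<open>x\<close> and a future
  beginning with the arc from \<open>x\<close> to \<open>b\<close>, whose lengths vary independently
  up to \<open>K2\<close> and \<open>k\<close>.\<close>

lemma sum_bad_paths_ge:
  shows "(\<Sum>(x, b)\<in>arcs G. \<Sum>y\<in>succs G b x. of_bool (bad y x b) *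
      (branch G (\<lambda>x b. (w b x)\<^sup>2) K2 x y / l\<^sup>2 * branch G (\<lambda>x b. (w x b)\<^sup>2) k x b))
    \<le> (\<Sum>p\<in>paths (K2 + k). (nb_weight l w p)\<^sup>2 * real (bad_count p))"
proof -
  note fin = finite_arcs[OF simple finite_verts]
  let ?Z = "\<lambda>K y x. \<Sum>p\<in>paths_to K y x. (nb_weight l w p)\<^sup>2"
  define X where "X K x b = (\<Sum>p\<in>paths_to K x b. (nb_weight l w p)\<^sup>2 * real (bad_count p))" for K x b
  have X0: "X K x b \<ge> 0" for K x b unfolding X_def by (intro sum_nonneg) auto
  have XSuc: "X (Suc K) x b = (w x b)\<^sup>2 * (\<Sum>y\<in>succs G b x. X K y x + of_bool (bad y x b) * ?Z K y x)"
    if xb: "adj G x b" for K x b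
  proof -
    have "X (Suc K) x b = (\<Sum>y\<in>succs G b x. \<Sum>p\<in>paths_to K y x. (nb_weight l w (b # p))\<^sup>2 * real (bad_count (b # p)))"
      unfolding X_def sum_paths_to_Suc[OF xb] by simp
    also have "\<dots> = (\<Sum>y\<in>succs G b x. (w x b)\<^sup>2 * (X K y x + of_bool (bad y x b) * ?Z K y x))"
    proof (intro sum.cong refl)
      fix y assume "y \<in> succs G b x"
      have "(\<Sum>p\<in>paths_to K y x. (nb_weight l w (b # p))\<^sup>2 * real (bad_count (b # p)))
         = (\<Sum>p\<in>paths_to K y x. (w x b)\<^sup>2 * ((nb_weight l w p)\<^sup>2 * real (bad_count p) + of_bool (bad y x b) * (nb_weight l w p)\<^sup>2))"
        by (intro sum.cong) (auto elim!: paths_toE simp: power_mult_distrib algebra_simps)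
      also have "\<dots> = (w x b)\<^sup>2 * (X K y x + of_bool (bad y x b) * ?Z K y x)"
        unfolding X_def sum_distrib_left[symmetric] sum.distrib by (rule refl)
      finally show "(\<Sum>p\<in>paths_to K y x. (nb_weight l w (b # p))\<^sup>2 * real (bad_count (b # p)))
         = (w x b)\<^sup>2 * (X K y x + of_bool (bad y x b) * ?Z K y x)" .
    qed
    finally show ?thesis by (simp only: sum_distrib_left)
  qed
  define g where "g f = (w (fst f) (snd f))\<^sup>2 * (\<Sum>y\<in>succs G (snd f) (fst f). of_bool (bad y (fst f) (snd f)) * ?Z K2 y (fst f))"
    for f
  define B where "B f e = (w (fst f) (snd f))\<^sup>2 * of_bool (snd e = fst f \<and> fst e \<noteq> snd f)" for f e :: "'a \<times> 'a"
  have appB: "mat_app (arcs G) B h (x, b) = (w x b)\<^sup>2 * (\<Sum>y\<in>succs G b x. h (y, x))" for h x b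
  proof -
    have "mat_app (arcs G) B h (x, b) = (w x b)\<^sup>2 * (\<Sum>f\<in>arcs G. of_bool (snd f = x \<and> fst f \<noteq> b) * h f)"
      unfolding mat_app_def B_def sum_distrib_left by (intro sum.cong) auto
    then show ?thesis by (simp add: sum_arcs_into[OF simple fin])
  qed
  have ge: "mat_series (arcs G) B g k (x, b) \<le> X (K2 + k) x b" if "adj G x b" for k x b
    using that
  proof (induction k arbitrary: x b)
    case 0
    then show ?case by (simp add: X0)
  next
    case (Suc k)
    have f1: "(\<Sum>y\<in>succs G b x. mat_series (arcs G) B g k (y, x)) \<le> (\<Sum>y\<in>succs G b x. X (K2 + k) y x)"
      using simple_graph_adjD[OF simple] by (intro sum_mono Suc.IH) auto
    have f2: "(\<Sum>y\<in>succs G b x. of_bool (bad y x b) * ?Z K2 y x) \<le> (\<Sum>y\<in>succs G b x. of_bool (bad y x b) * ?Z (K2 + k) y x)"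
      by (intro sum_mono mult_left_mono sum_mono2 finite_paths_to) (auto simp: paths_to_def paths_def)
    have "(w x b)\<^sup>2 * ((\<Sum>y\<in>succs G b x. mat_series (arcs G) B g k (y, x)) + (\<Sum>y\<in>succs G b x. of_bool (bad y x b) * ?Z K2 y x))
      \<le> (w x b)\<^sup>2 * ((\<Sum>y\<in>succs G b x. X (K2 + k) y x) + (\<Sum>y\<in>succs G b x. of_bool (bad y x b) * ?Z (K2 + k) y x))"
      by (intro mult_left_mono add_mono f1 f2) simp
    moreover have "g (x, b) = (w x b)\<^sup>2 * (\<Sum>y\<in>succs G b x. of_bool (bad y x b) * ?Z K2 y x)"
      by (simp add: g_def)
    ultimately show ?case using XSuc[OF Suc.prems] by (simp add: appB sum.distrib distrib_left)
  qed
  \<comment> \<open>Iterating the transposed recursion from the constant 1 collects all futures of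
    an arc, so pairing with the source \<open>g\<close> glues past and future.\<close>
  have v: "(w x b)\<^sup>2 * mat_series (arcs G) (\<lambda>e f. B f e) (\<lambda>_. 1) k (x, b) = branch G (\<lambda>x b. (w x b)\<^sup>2) k x b" for x b
  proof (induction k arbitrary: x b)
    case (Suc k)
    let ?v = "mat_series (arcs G) (\<lambda>e f. B f e) (\<lambda>_. 1) k"
    have "mat_app (arcs G) (\<lambda>e f. B f e) ?v (x, b)
      = (\<Sum>f\<in>arcs G. of_bool (fst f = b \<and> snd f \<noteq> x) * ((w (fst f) (snd f))\<^sup>2 * ?v f))"
      unfolding mat_app_def B_def by (intro sum.cong) auto
    also have "\<dots> = (\<Sum>c\<in>succs G x b. branch G (\<lambda>x b. (w x b)\<^sup>2) k b c)"
      unfolding sum_arcs_from[OF fin] using Suc.IH by simp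
    finally show ?case by simp
  qed simp
  have "(\<Sum>(x, b)\<in>arcs G. \<Sum>y\<in>succs G b x. of_bool (bad y x b) *
      (branch G (\<lambda>x b. (w b x)\<^sup>2) K2 x y / l\<^sup>2 * branch G (\<lambda>x b. (w x b)\<^sup>2) k x b))
    = (\<Sum>f\<in>arcs G. g f * mat_series (arcs G) (\<lambda>e f. B f e) (\<lambda>_. 1) k f)"
  proof (intro sum.cong refl)
    fix f assume f: "f \<in> arcs G"
    obtain x b where xb: "f = (x, b)" by (cases f)
    have "(\<Sum>y\<in>succs G b x. of_bool (bad y x b) * (branch G (\<lambda>x b. (w b x)\<^sup>2) K2 x y / l\<^sup>2 * branch G (\<lambda>x b. (w x b)\<^sup>2) k x b))
      = (\<Sum>y\<in>succs G b x. of_bool (bad y x b) * ?Z K2 y x) * branch G (\<lambda>x b. (w x b)\<^sup>2) k x b"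
      unfolding sum_distrib_right
    proof (intro sum.cong refl)
      fix y assume "y \<in> succs G b x"
      then have "adj G y x" using simple_graph_adjD[OF simple] by simp
      then show "of_bool (bad y x b) * (branch G (\<lambda>x b. (w b x)\<^sup>2) K2 x y / l\<^sup>2 * branch G (\<lambda>x b. (w x b)\<^sup>2) k x b)
        = of_bool (bad y x b) * ?Z K2 y x * branch G (\<lambda>x b. (w x b)\<^sup>2) k x b"
        by (simp add: sum_weight_paths_to)
    qed
    then show "(case f of (x, b) \<Rightarrow> \<Sum>y\<in>succs G b x. of_bool (bad y x b) * (branch G (\<lambda>x b. (w b x)\<^sup>2) K2 x y / l\<^sup>2 * branch G (\<lambda>x b. (w x b)\<^sup>2) k x b))
       = g f * mat_series (arcs G) (\<lambda>e f. B f e) (\<lambda>_. 1) k f"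
      unfolding xb g_def v[symmetric] by (simp add: mult_ac)
  qed
  also have "\<dots> = (\<Sum>f\<in>arcs G. 1 * mat_series (arcs G) B g k f)"
    by (rule mat_series_adjoint[symmetric])
  also have "\<dots> \<le> (\<Sum>(x, b)\<in>arcs G. X (K2 + k) x b)"
    using ge by (intro sum_mono) (auto simp: arcs_def)
  also have "\<dots> = (\<Sum>p\<in>paths (K2 + k). (nb_weight l w p)\<^sup>2 * real (bad_count p))"
    unfolding sum_paths X_def by simp
  finally show ?thesis .
qed

text \<open>One factor of the square is the weight of the path, the other the total weight of its
  detours, which have the same end points; both are parts of the same entry of the Green function.
  In \<open>M\<close>, \<open>Suc L * Suc K\<close> bounds the length of a detour.\<close>

lemma sum_green_sq_ge:
  assumes l: "l > 0" and \<epsilon>: "0 < \<epsilon>" "\<epsilon> \<le> 1"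
    and w: "\<And>x b. adj G x b \<Longrightarrow> \<epsilon> \<le> passage G l N x b"
    and M: "1 + passage_cost N * (Suc L * Suc K) \<le> M"
  shows "(\<Sum>p\<in>paths K. (nb_weight l (passage G l N) p)\<^sup>2 * (1 + \<epsilon> ^ L) ^ bad_count p)
    \<le> (\<Sum>v\<in>verts G. \<Sum>y\<in>verts G. (green G l M v y)\<^sup>2)"
proof -
  let ?W = "nb_weight l (passage G l N)"
  define R where "R = Suc L * Suc K"
  define Q where "Q v y = {p \<in> paths R. last p = v \<and> hd p = y}" for v y
  define P where "P v y = {p \<in> paths K. last p = v \<and> hd p = y}" for v y
  have finQ: "finite (Q v y)" "finite (P v y)" for v y using finite_paths by (auto simp: Q_def P_def)
  have Wpos: "0 < ?W p" if "nb_walk G p" for p by (rule nb_weight_pos[OF w \<epsilon>(1) l that])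
  have sub: "detours p \<subseteq> Q v y" if p: "p \<in> P v y" for p v y
  proof
    fix q assume q: "q \<in> detours p"
    have nb: "nb_walk G p" "length p \<le> Suc K" "last p = v" "hd p = y" using p by (auto simp: P_def paths_def)
    note D = detours_form[OF nb(1) q]
    have "hd r = hd (take 2 r)" for r :: "'a list" by (cases r) simp_all
    then have "hd q = y" using D nb(4) by metis
    moreover have "length q \<le> Suc R"
    proof -
      have "length q \<le> Suc L * length p" using D by simp
      also have "\<dots> \<le> Suc L * Suc K" using nb(2) by (rule mult_le_mono2)
      finally show ?thesis by (simp add: R_def)
    qed
    ultimately show "q \<in> Q v y" using D nb by (simp add: Q_def paths_def)
  qed
  have "(\<Sum>p\<in>P v y. (?W p)\<^sup>2 * (1 + \<epsilon> ^ L) ^ bad_count p) \<le> (green G l M v y)\<^sup>2" for v y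
  proof -
    have le: "(\<Sum>p\<in>Q v y. ?W p) \<le> green G l M v y"
    proof (rule sum_nb_weight_le_green[OF simple loc_finite l finQ(1)])
      fix p assume "p \<in> Q v y"
      then have p: "nb_walk G p" "length p \<le> Suc R" "last p = v" "hd p = y" by (auto simp: Q_def paths_def)
      then show "nb_walk G p \<and> last p = v \<and> hd p = y" by simp
      have "passage_cost N * (length p - 1) \<le> passage_cost N * R" using p(2) by (intro mult_le_mono2) simp
      then show "1 + passage_cost N * (length p - 1) \<le> M" using M by (simp add: R_def)
    qed
    have Q0: "0 \<le> (\<Sum>p\<in>Q v y. ?W p)" using Wpos by (intro sum_nonneg) (auto simp: Q_def paths_def less_imp_le)
    have "(\<Sum>p\<in>P v y. (?W p)\<^sup>2 * (1 + \<epsilon> ^ L) ^ bad_count p) = (\<Sum>p\<in>P v y. ?W p * (?W p * (1 + \<epsilon> ^ L) ^ bad_count p))"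
      by (simp add: power2_eq_square mult.assoc)
    also have "\<dots> \<le> (\<Sum>p\<in>P v y. ?W p * (\<Sum>q\<in>detours p. ?W q))"
      using Wpos by (intro sum_mono mult_left_mono sum_detours_ge[OF w \<epsilon> l]) (auto simp: P_def paths_def less_imp_le)
    also have "\<dots> \<le> (\<Sum>p\<in>P v y. ?W p * (\<Sum>q\<in>Q v y. ?W q))"
      using Wpos sub finQ by (intro sum_mono mult_left_mono sum_mono2) (auto simp: P_def Q_def paths_def less_imp_le)
    also have "\<dots> = (\<Sum>p\<in>P v y. ?W p) * (\<Sum>q\<in>Q v y. ?W q)" by (simp add: sum_distrib_right)
    also have "\<dots> \<le> (\<Sum>p\<in>Q v y. ?W p) * (\<Sum>q\<in>Q v y. ?W q)"
    proof (rule mult_right_mono[OF _ Q0])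
      have "K \<le> R" by (simp add: R_def)
      then have "P v y \<subseteq> Q v y" by (auto simp: P_def Q_def paths_def)
      then show "(\<Sum>p\<in>P v y. ?W p) \<le> (\<Sum>p\<in>Q v y. ?W p)"
        using Wpos finQ by (intro sum_mono2) (auto simp: Q_def paths_def less_imp_le)
    qed
    also have "\<dots> \<le> green G l M v y * green G l M v y"
      using le Q0 by (intro mult_mono) auto
    finally show ?thesis by (simp add: power2_eq_square)
  qed
  then have "(\<Sum>v\<in>verts G. \<Sum>y\<in>verts G. \<Sum>p\<in>P v y. (?W p)\<^sup>2 * (1 + \<epsilon> ^ L) ^ bad_count p)
    \<le> (\<Sum>v\<in>verts G. \<Sum>y\<in>verts G. (green G l M v y)\<^sup>2)" by (intro sum_mono)
  moreover have "(\<Sum>v\<in>verts G. \<Sum>y\<in>verts G. \<Sum>p\<in>P v y. (?W p)\<^sup>2 * (1 + \<epsilon> ^ L) ^ bad_count p)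
    = (\<Sum>p\<in>paths K. (?W p)\<^sup>2 * (1 + \<epsilon> ^ L) ^ bad_count p)"
  proof -
    let ?f = "\<lambda>p. (?W p)\<^sup>2 * (1 + \<epsilon> ^ L) ^ bad_count p"
    have "(\<Sum>v\<in>verts G. \<Sum>y\<in>verts G. sum ?f (P v y)) = (\<Sum>e\<in>verts G \<times> verts G. sum ?f {p \<in> paths K. (last p, hd p) = e})"
      unfolding sum.cartesian_product by (intro sum.cong) (auto simp: P_def)
    also have "\<dots> = sum ?f (paths K)"
    proof (rule sum.group)
      show "(\<lambda>p. (last p, hd p)) ` paths K \<subseteq> verts G \<times> verts G"
      proof (rule image_subsetI)
        fix p assume "p \<in> paths K"
        then have "nb_walk G p" by (simp add: paths_def)
        then show "(last p, hd p) \<in> verts G \<times> verts G"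
          using nb_walk_verts[OF simple] nb_walk_not_Nil by fastforce
      qed
    qed (use finite_paths finite_verts in auto)
    finally show ?thesis .
  qed
  ultimately show ?thesis by simp
qed

text \<open>Jensen's inequality for the weights \<open>W\<^sup>2\<close> on the set of all paths.\<close>

lemma sum_green_sq_exp:
  fixes l \<epsilon> :: real
  assumes l: "l > 0" and \<epsilon>: "0 < \<epsilon>" "\<epsilon> \<le> 1"
    and w: "\<And>x b. adj G x b \<Longrightarrow> \<epsilon> \<le> passage G l N x b"
    and M: "1 + passage_cost N * (Suc L * Suc K) \<le> M"
    and a: "a * (\<Sum>p\<in>paths K. (nb_weight l (passage G l N) p)\<^sup>2)
      \<le> (\<Sum>p\<in>paths K. (nb_weight l (passage G l N) p)\<^sup>2 * real (bad_count p))"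
  shows "real (card (verts G)) / l\<^sup>2 * exp (ln (1 + \<epsilon> ^ L) * a) \<le> (\<Sum>v\<in>verts G. \<Sum>y\<in>verts G. (green G l M v y)\<^sup>2)"
proof -
  let ?W = "nb_weight l (passage G l N)"
  let ?Z = "\<Sum>p\<in>paths K. (?W p)\<^sup>2" and ?X = "\<Sum>p\<in>paths K. (?W p)\<^sup>2 * real (bad_count p)"
  define \<theta> where "\<theta> = ln (1 + \<epsilon> ^ L)"
  have e: "1 + \<epsilon> ^ L > 1" using \<epsilon> by simp
  have \<theta>: "\<theta> > 0" unfolding \<theta>_def using e by (intro ln_gt_zero)
  \<comment> \<open>The tangent of the exponential at \<open>a\<close> is a lower bound that is
    affine in the number of bad passages; after summation only their mean is left, and
    \<open>a\<close> does not exceed it.\<close>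
  have tangent: "exp (\<theta> * a) * (1 + \<theta> * (real n - a)) \<le> (1 + \<epsilon> ^ L) ^ n" for n
  proof -
    have "exp (\<theta> * a) * (1 + \<theta> * (real n - a)) \<le> exp (\<theta> * a) * exp (\<theta> * (real n - a))"
      by (intro mult_left_mono exp_ge_add_one_self) auto
    also have "\<dots> = exp (real n * \<theta>)" by (simp add: algebra_simps flip: exp_add)
    also have "\<dots> = exp \<theta> ^ n" by (rule exp_of_nat_mult)
    also have "exp \<theta> = 1 + \<epsilon> ^ L" unfolding \<theta>_def using e by (intro exp_ln) linarith
    finally show ?thesis .
  qed
  \<comment> \<open>The one-vertex paths alone carry this mass.\<close>
  have "real (card (verts G)) / l\<^sup>2 = (\<Sum>v\<in>verts G. (?W [v])\<^sup>2)" by (simp add: power_divide)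
  also have "\<dots> \<le> ?Z"
    unfolding sum_paths by (simp add: sum_nonneg split_beta)
  finally have "real (card (verts G)) / l\<^sup>2 * exp (\<theta> * a) \<le> ?Z * exp (\<theta> * a)" by (intro mult_right_mono) auto
  also have "\<dots> \<le> exp (\<theta> * a) * (?Z + \<theta> * (?X - a * ?Z))"
    using a \<theta> by (simp add: mult.commute)
  also have "\<dots> = (\<Sum>p\<in>paths K. (?W p)\<^sup>2 * (exp (\<theta> * a) * (1 + \<theta> * (real (bad_count p) - a))))"
    by (simp add: sum_distrib_left sum_subtractf sum.distrib algebra_simps)
  also have "\<dots> \<le> (\<Sum>p\<in>paths K. (?W p)\<^sup>2 * (1 + \<epsilon> ^ L) ^ bad_count p)"
    by (intro sum_mono mult_left_mono tangent) auto
  also have "\<dots> \<le> (\<Sum>v\<in>verts G. \<Sum>y\<in>verts G. (green G l M v y)\<^sup>2)"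
    by (rule sum_green_sq_ge[OF l \<epsilon> w M])
  finally show ?thesis by (simp add: \<theta>_def)
qed

end

section \<open>The trace formula\<close>

lemma symmetric_eigenvalue_real:
  fixes A :: "real mat"
  assumes A: "A \<in> carrier_mat n n" and sym: "\<And>i j. i < n \<Longrightarrow> j < n \<Longrightarrow> A $$ (i, j) = A $$ (j, i)"
    and ev: "eigenvector (map_mat complex_of_real A) v a"
  shows "a \<in> \<real>"
proof -
  have v: "v \<in> carrier_vec n" "v \<noteq> 0\<^sub>v n" "map_mat complex_of_real A *\<^sub>v v = a \<cdot>\<^sub>v v"
    using ev A by (auto simp: eigenvector_def)
  have entry: "(\<Sum>j<n. of_real (A $$ (i, j)) * v $ j) = a * v $ i" if "i < n" for i
  proof -
    have "(map_mat complex_of_real A *\<^sub>v v) $ i = (\<Sum>j<n. of_real (A $$ (i, j)) * v $ j)"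
      using A v(1) that by (simp add: scalar_prod_def lessThan_atLeast0)
    then show ?thesis using v that by simp
  qed
  define q where "q = (\<Sum>i<n. \<Sum>j<n. cnj (v $ i) * (of_real (A $$ (i, j)) * v $ j))"
  have "cnj q = (\<Sum>i<n. \<Sum>j<n. cnj (v $ j) * (of_real (A $$ (i, j)) * v $ i))"
    unfolding q_def by (simp add: mult_ac)
  also have "\<dots> = (\<Sum>j<n. \<Sum>i<n. cnj (v $ j) * (of_real (A $$ (i, j)) * v $ i))" by (rule sum.swap)
  also have "\<dots> = q" unfolding q_def using sym by (intro sum.cong) auto
  finally have q: "q \<in> \<real>" by (simp add: Reals_cnj_iff)
  define s where "s = (\<Sum>i<n. (cmod (v $ i))\<^sup>2)"
  have "q = (\<Sum>i<n. cnj (v $ i) * (a * v $ i))"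
    unfolding q_def using entry by (simp flip: sum_distrib_left)
  also have "\<dots> = a * of_real s"
    unfolding s_def of_real_sum sum_distrib_left
    by (intro sum.cong refl) (simp only: complex_norm_square mult_ac)
  finally have qs: "q = a * of_real s" .
  have "s \<noteq> 0"
  proof
    assume "s = 0"
    then have "\<forall>i<n. v $ i = 0" unfolding s_def by (subst (asm) sum_nonneg_eq_0_iff) auto
    then have "v = 0\<^sub>v n" using v(1) by (intro eq_vecI) auto
    then show False using v by simp
  qed
  then have "a = q / of_real s" using qs by simp
  then show ?thesis using q by (simp add: Reals_divide)
qed

lemma symmetric_char_poly_splits:
  fixes A :: "real mat"
  assumes A: "A \<in> carrier_mat n n" and sym: "\<And>i j. i < n \<Longrightarrow> j < n \<Longrightarrow> A $$ (i, j) = A $$ (j, i)"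
  obtains es where "char_poly A = (\<Prod>e\<leftarrow>es. [:- e, 1:])" "length es = n"
proof -
  let ?A = "map_mat complex_of_real A"
  have Ac: "?A \<in> carrier_mat n n" using A by simp
  obtain as where as: "char_poly ?A = (\<Prod>a\<leftarrow>as. [:- a, 1:])" "length as = n"
    using char_poly_factorized[OF Ac] by blast
  have real: "a \<in> \<real>" if "a \<in> set as" for a
  proof -
    have "poly (char_poly ?A) a = 0"
      unfolding as(1) poly_prod_list_zero_iff using that by auto
    then obtain v where "eigenvector ?A v a"
      using eigenvalue_root_char_poly[OF Ac] by (auto simp: eigenvalue_def)
    from symmetric_eigenvalue_real[OF A _ this] sym show ?thesis by blast
  qed
  define es where "es = map Re as"
  have as_es: "as = map complex_of_real es"
    unfolding es_def using real by (simp add: map_idI)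
  have "map_poly complex_of_real (char_poly A) = char_poly ?A"
    by (rule of_real_hom.char_poly_hom[OF A, symmetric])
  also have "\<dots> = map_poly complex_of_real (\<Prod>e\<leftarrow>es. [:- e, 1:])"
    unfolding as(1) as_es
    by (induction es) (auto simp: o_def poly_eq_iff coeff_map_poly coeff_pCons split: nat.splits)
  finally have eq: "map_poly complex_of_real (char_poly A) = map_poly complex_of_real (\<Prod>e\<leftarrow>es. [:- e, 1:])" .
  have "char_poly A = (\<Prod>e\<leftarrow>es. [:- e, 1:])"
  proof (rule poly_eqI)
    fix k show "coeff (char_poly A) k = coeff (\<Prod>e\<leftarrow>es. [:- e, 1:]) k"
      using arg_cong[OF eq, of "\<lambda>p. coeff p k"] by (simp add: coeff_map_poly)
  qed
  then show ?thesis using that[of es] as(2) by (simp add: es_def)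
qed

section \<open>Frobenius norm of a truncated resolvent\<close>

definition mat_trace :: "real mat \<Rightarrow> real" where
  "mat_trace A = (\<Sum>i<dim_row A. A $$ (i, i))"

lemma mat_mult_entry:
  assumes "A \<in> carrier_mat n n" "B \<in> carrier_mat n n" "i < n" "j < n"
  shows "(A * B) $$ (i, j) = (\<Sum>k<n. A $$ (i, k) * B $$ (k, j))"
  using assms by (simp add: scalar_prod_def lessThan_atLeast0)

lemma mat_trace_mult_comm:
  assumes A: "A \<in> carrier_mat n n" and B: "B \<in> carrier_mat n n"
  shows "mat_trace (A * B) = mat_trace (B * A)"
proof -
  have "mat_trace (A * B) = (\<Sum>i<n. \<Sum>k<n. A $$ (i, k) * B $$ (k, i))"
    unfolding mat_trace_def using A by (intro sum.cong) (auto simp: mat_mult_entry[OF A B] simp del: index_mult_mat(1))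
  also have "\<dots> = (\<Sum>k<n. \<Sum>i<n. B $$ (k, i) * A $$ (i, k))" by (subst sum.swap) (simp add: mult.commute)
  also have "\<dots> = mat_trace (B * A)"
    unfolding mat_trace_def using B by (intro sum.cong) (auto simp: mat_mult_entry[OF B A] simp del: index_mult_mat(1))
  finally show ?thesis .
qed

text \<open>The polynomial sum of x^k / l^(k+1) over k < \<open>M\<close>, the spectral counterpart
  of \<open>green\<close>. Its coefficients are nonnegative, so it is controlled by its value at
  |x|, also beyond \<open>l\<close>.\<close>

primrec resolvent :: "real \<Rightarrow> nat \<Rightarrow> real \<Rightarrow> real" where
  "resolvent l 0 x = 0"
| "resolvent l (Suc M) x = (1 + resolvent l M x * x) / l"

primrec mat_resolvent :: "nat \<Rightarrow> real \<Rightarrow> nat \<Rightarrow> real mat \<Rightarrow> real mat" where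
  "mat_resolvent n l 0 A = 0\<^sub>m n n"
| "mat_resolvent n l (Suc M) A = (1 / l) \<cdot>\<^sub>m (1\<^sub>m n + mat_resolvent n l M A * A)"

lemma mat_resolvent_carrier: "A \<in> carrier_mat n n \<Longrightarrow> mat_resolvent n l M A \<in> carrier_mat n n"
  by (induction M) auto

lemma mat_resolvent_entry:
  assumes A: "A \<in> carrier_mat n n" "i < n" "j < n"
  shows "mat_resolvent n l (Suc M) A $$ (i, j) = (of_bool (i = j) + (\<Sum>k<n. mat_resolvent n l M A $$ (i, k) * A $$ (k, j))) / l"
proof -
  have R: "mat_resolvent n l M A \<in> carrier_mat n n" by (rule mat_resolvent_carrier[OF A(1)])
  show ?thesis
    using A R mat_mult_entry[OF R A] by (auto simp del: index_mult_mat(1))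
qed

lemma mat_resolvent_comm:
  assumes A: "A \<in> carrier_mat n n"
  shows "A * mat_resolvent n l M A = mat_resolvent n l M A * A"
proof (induction M)
  case 0
  then show ?case using A by simp
next
  case (Suc M)
  let ?R = "mat_resolvent n l M A"
  have R: "?R \<in> carrier_mat n n" by (rule mat_resolvent_carrier[OF A])
  have RA: "?R * A \<in> carrier_mat n n" by (rule mult_carrier_mat[OF R A])
  have "A * mat_resolvent n l (Suc M) A = (1 / l) \<cdot>\<^sub>m (A * (1\<^sub>m n + ?R * A))"
    using A RA by (simp add: mult_smult_distrib[OF A, of _ n])
  also have "A * (1\<^sub>m n + ?R * A) = A * 1\<^sub>m n + A * (?R * A)"
    by (rule mult_add_distrib_mat[OF A _ RA]) simp
  also have "A * (?R * A) = (A * ?R) * A" by (rule assoc_mult_mat[OF A R A, symmetric])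
  also have "A * ?R = ?R * A" by (rule Suc.IH)
  also have "A * 1\<^sub>m n = 1\<^sub>m n * A" using A by simp
  also have "1\<^sub>m n * A + (?R * A) * A = (1\<^sub>m n + ?R * A) * A"
    by (rule add_mult_distrib_mat[OF _ RA A, symmetric]) simp
  also have "(1 / l) \<cdot>\<^sub>m ((1\<^sub>m n + ?R * A) * A) = mat_resolvent n l (Suc M) A * A"
    using A RA by (simp add: mult_smult_assoc_mat[of _ n n _ n])
  finally show ?case .
qed

lemma mat_resolvent_sym:
  assumes A: "A \<in> carrier_mat n n" and sym: "\<And>i j. i < n \<Longrightarrow> j < n \<Longrightarrow> A $$ (i, j) = A $$ (j, i)"
  shows "i < n \<Longrightarrow> j < n \<Longrightarrow> mat_resolvent n l M A $$ (i, j) = mat_resolvent n l M A $$ (j, i)"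
proof (induction M arbitrary: i j)
  case (Suc M)
  let ?R = "mat_resolvent n l M A"
  have R: "?R \<in> carrier_mat n n" by (rule mat_resolvent_carrier[OF A])
  have "(\<Sum>k<n. ?R $$ (i, k) * A $$ (k, j)) = (\<Sum>k<n. A $$ (j, k) * ?R $$ (k, i))"
    using Suc sym by (intro sum.cong) auto
  also have "\<dots> = (A * ?R) $$ (j, i)" using Suc.prems by (simp only: mat_mult_entry[OF A R])
  also have "\<dots> = (?R * A) $$ (j, i)" by (simp only: mat_resolvent_comm[OF A])
  also have "\<dots> = (\<Sum>k<n. ?R $$ (j, k) * A $$ (k, i))" using Suc.prems by (simp only: mat_mult_entry[OF R A])
  finally show ?case using Suc.prems by (simp only: mat_resolvent_entry[OF A] eq_commute[of i j])
qed simp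

lemma mat_resolvent_similar:
  assumes A: "A \<in> carrier_mat n n" and sim: "similar_mat_wit A B P Q"
  shows "mat_resolvent n l M A = P * mat_resolvent n l M B * Q"
proof (induction M)
  case 0
  note S = similar_mat_witD2[OF A sim]
  show ?case using S(6,7) by simp
next
  case (Suc M)
  note S = similar_mat_witD2[OF A sim]
  let ?R = "mat_resolvent n l M B"
  have R: "?R \<in> carrier_mat n n" by (rule mat_resolvent_carrier[OF S(5)])
  have RB: "?R * B \<in> carrier_mat n n" by (rule mult_carrier_mat[OF R S(5)])
  have PR: "P * ?R \<in> carrier_mat n n" by (rule mult_carrier_mat[OF S(6) R])
  have "mat_resolvent n l M A * A = (P * ?R * Q) * (P * B * Q)" using Suc.IH S(3) by simp
  also have "\<dots> = P * ?R * (Q * (P * B * Q))" using PR S(4-7) by (intro assoc_mult_mat[of _ n n _ n _ n]) auto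
  also have "Q * (P * B * Q) = Q * P * (B * Q)" using S(4-7) by (simp add: assoc_mult_mat[of _ n n _ n _ n])
  also have "Q * P = 1\<^sub>m n" by (rule S(2))
  also have "1\<^sub>m n * (B * Q) = B * Q" using S(4-7) by simp
  also have "P * ?R * (B * Q) = P * (?R * B) * Q" using S(4-7) R RB by (simp add: assoc_mult_mat[of _ n n _ n _ n])
  finally have RA: "mat_resolvent n l M A * A = P * (?R * B) * Q" .
  have "mat_resolvent n l (Suc M) A = (1 / l) \<cdot>\<^sub>m (P * 1\<^sub>m n * Q + P * (?R * B) * Q)"
    using RA S by simp
  also have "P * 1\<^sub>m n * Q + P * (?R * B) * Q = (P * 1\<^sub>m n + P * (?R * B)) * Q"
    using S(4-7) RB by (intro add_mult_distrib_mat[symmetric, of _ n n _ _ n]) auto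
  also have "P * 1\<^sub>m n + P * (?R * B) = P * (1\<^sub>m n + ?R * B)"
    using S(4-7) RB by (intro mult_add_distrib_mat[symmetric, of _ n n _ n]) auto
  also have "(1 / l) \<cdot>\<^sub>m (P * (1\<^sub>m n + ?R * B) * Q) = P * ((1 / l) \<cdot>\<^sub>m (1\<^sub>m n + ?R * B)) * Q"
  proof -
    have X: "1\<^sub>m n + ?R * B \<in> carrier_mat n n" using RB by simp
    have "P * ((1 / l) \<cdot>\<^sub>m (1\<^sub>m n + ?R * B)) = (1 / l) \<cdot>\<^sub>m (P * (1\<^sub>m n + ?R * B))"
      by (rule mult_smult_distrib[OF S(6) X])
    then show ?thesis using mult_smult_assoc_mat[of "P * (1\<^sub>m n + ?R * B)" n n Q n "1 / l"] S(6,7) X by simp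
  qed
  finally show ?case by simp
qed

lemma upper_triangular_mult:
  assumes A: "A \<in> carrier_mat n n" "upper_triangular A" and B: "B \<in> carrier_mat n n" "upper_triangular B"
  shows "upper_triangular (A * B :: real mat)" "\<And>i. i < n \<Longrightarrow> (A * B) $$ (i, i) = A $$ (i, i) * B $$ (i, i)"
proof -
  have zero: "A $$ (i, k) * B $$ (k, j) = 0" if "i < n" "k < n" "j \<le> i" "k \<noteq> i \<or> j \<noteq> i" for i j k
  proof (cases "k < i")
    case True
    then show ?thesis using upper_triangularD[OF A(2) True] A(1) that by simp
  next
    case False
    then have "j < k" using that by auto
    then show ?thesis using upper_triangularD[OF B(2) \<open>j < k\<close>] B(1) that by simp
  qed
  show "upper_triangular (A * B)"
  proof
    fix i j assume ij: "j < i" "i < dim_row (A * B)"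
    then have "i < n" "j < n" using A by auto
    then show "(A * B) $$ (i, j) = 0"
      unfolding mat_mult_entry[OF A(1) B(1) \<open>i < n\<close> \<open>j < n\<close>]
      using zero ij by (intro sum.neutral) auto
  qed
  show "(A * B) $$ (i, i) = A $$ (i, i) * B $$ (i, i)" if i: "i < n" for i
  proof -
    have "(A * B) $$ (i, i) = (\<Sum>k<n. A $$ (i, k) * B $$ (k, i))" by (rule mat_mult_entry[OF A(1) B(1) i i])
    also have "\<dots> = (\<Sum>k\<in>{i}. A $$ (i, k) * B $$ (k, i))"
      using i zero[of i _ i] by (intro sum.mono_neutral_right) auto
    finally show ?thesis by simp
  qed
qed

lemma mat_resolvent_triangular:
  assumes B: "B \<in> carrier_mat n n" "upper_triangular B"
  shows "upper_triangular (mat_resolvent n l M B) \<and> (\<forall>i<n. mat_resolvent n l M B $$ (i, i) = resolvent l M (B $$ (i, i)))"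
proof (induction M)
  case (Suc M)
  let ?R = "mat_resolvent n l M B"
  have R: "?R \<in> carrier_mat n n" "upper_triangular ?R" using mat_resolvent_carrier[OF B(1)] Suc by auto
  note U = upper_triangular_mult[OF R B]
  have RB: "?R * B \<in> carrier_mat n n" by (rule mult_carrier_mat[OF R(1) B(1)])
  have "upper_triangular (mat_resolvent n l (Suc M) B)"
  proof
    fix i j assume ij: "j < i" "i < dim_row (mat_resolvent n l (Suc M) B)"
    then have "i < n" "j < n" "i < dim_row (?R * B)" using R B by auto
    then show "mat_resolvent n l (Suc M) B $$ (i, j) = 0"
      using upper_triangularD[OF U(1) ij(1)] RB ij B by (simp del: index_mult_mat(1))
  qed
  moreover have "mat_resolvent n l (Suc M) B $$ (i, i) = resolvent l (Suc M) (B $$ (i, i))" if "i < n" for i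
    using U(2)[OF that] Suc that RB B carrier_matD[OF R(1)] by (simp del: index_mult_mat(1))
  ultimately show ?case by blast
qed auto

text \<open>By symmetry the left side is the trace of the squared resolvent. Similarity to an upper
  triangular matrix suffices: the polynomial acts entry by entry on the diagonal, and the trace sees
  nothing else.\<close>

lemma sum_mat_resolvent_sq:
  assumes A: "A \<in> carrier_mat n n" and sym: "\<And>i j. i < n \<Longrightarrow> j < n \<Longrightarrow> A $$ (i, j) = A $$ (j, i)"
    and es: "char_poly A = (\<Prod>e\<leftarrow>es. [:- e, 1:])"
  shows "(\<Sum>i<n. \<Sum>j<n. (mat_resolvent n l M A $$ (i, j))\<^sup>2) = (\<Sum>e\<leftarrow>es. (resolvent l M e)\<^sup>2)"
proof -
  obtain B P Q where BPQ: "schur_decomposition A es = (B, P, Q)" by (cases "schur_decomposition A es") auto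
  note sd = schur_decomposition[OF A es BPQ]
  then have sim: "similar_mat_wit A B P Q" and tri: "upper_triangular B" and diag: "diag_mat B = es" by auto
  note S = similar_mat_witD2[OF A sim]
  let ?R = "mat_resolvent n l M A" and ?T = "mat_resolvent n l M B"
  have R: "?R \<in> carrier_mat n n" and T: "?T \<in> carrier_mat n n"
    by (rule mat_resolvent_carrier[OF A], rule mat_resolvent_carrier[OF S(5)])
  have TT: "?T * ?T \<in> carrier_mat n n" by (rule mult_carrier_mat[OF T T])
  have Ttri: "upper_triangular ?T" and Tdiag: "\<And>i. i < n \<Longrightarrow> ?T $$ (i, i) = resolvent l M (B $$ (i, i))"
    using mat_resolvent_triangular[OF S(5) tri] by auto
  have "(\<Sum>i<n. \<Sum>j<n. (?R $$ (i, j))\<^sup>2) = (\<Sum>i<n. \<Sum>j<n. ?R $$ (i, j) * ?R $$ (j, i))"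
    using mat_resolvent_sym[OF A sym] by (intro sum.cong) (auto simp: power2_eq_square)
  also have "\<dots> = mat_trace (?R * ?R)"
    unfolding mat_trace_def using R by (intro sum.cong) (auto simp: mat_mult_entry[OF R R] simp del: index_mult_mat(1))
  also have "?R * ?R = P * (?T * ?T) * Q"
  proof -
    have PT: "P * ?T \<in> carrier_mat n n" by (rule mult_carrier_mat[OF S(6) T])
    have "?R * ?R = (P * ?T * Q) * (P * ?T * Q)" by (simp only: mat_resolvent_similar[OF A sim])
    also have "\<dots> = P * ?T * (Q * (P * ?T * Q))" using PT T S(4-7) by (intro assoc_mult_mat[of _ n n _ n _ n]) auto
    also have "Q * (P * ?T * Q) = Q * P * (?T * Q)" using S(4-7) T by (simp add: assoc_mult_mat[of _ n n _ n _ n])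
    also have "Q * P = 1\<^sub>m n" by (rule S(2))
    also have "1\<^sub>m n * (?T * Q) = ?T * Q" using S(4-7) T by simp
    also have "P * ?T * (?T * Q) = P * (?T * ?T) * Q" using S(4-7) T TT by (simp add: assoc_mult_mat[of _ n n _ n _ n])
    finally show ?thesis .
  qed
  also have "mat_trace (P * (?T * ?T) * Q) = mat_trace (Q * (P * (?T * ?T)))"
    using S TT by (intro mat_trace_mult_comm) auto
  also have "Q * (P * (?T * ?T)) = ?T * ?T"
    by (simp only: assoc_mult_mat[OF S(7) S(6) TT, symmetric] S(2) left_mult_one_mat[OF TT])
  also have "mat_trace (?T * ?T) = (\<Sum>i<n. (resolvent l M (B $$ (i, i)))\<^sup>2)"
    unfolding mat_trace_def using T upper_triangular_mult(2)[OF T Ttri T Ttri] Tdiag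
    by (intro sum.cong) (auto simp: power2_eq_square simp del: index_mult_mat(1))
  also have "\<dots> = (\<Sum>e\<leftarrow>es. (resolvent l M e)\<^sup>2)"
    unfolding diag[symmetric] diag_mat_def using S(5)
    by (simp add: sum_list_map_eq_sum_count o_def interv_sum_list_conv_sum_set_nat atLeast0LessThan)
  finally show ?thesis .
qed

lemma resolvent_abs_le:
  assumes "l > 0" "\<bar>x\<bar> \<le> y"
  shows "\<bar>resolvent l M x\<bar> \<le> resolvent l M y"
proof (induction M)
  case (Suc M)
  have "\<bar>resolvent l (Suc M) x\<bar> \<le> (1 + \<bar>resolvent l M x\<bar> * \<bar>x\<bar>) / l"
    using assms(1) by (simp add: abs_divide divide_right_mono order_trans[OF abs_triangle_ineq] abs_mult)
  also have "\<dots> \<le> (1 + resolvent l M y * y) / l"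
    using assms Suc by (intro divide_right_mono add_left_mono mult_mono) auto
  finally show ?case by simp
qed simp

lemma resolvent_le:
  assumes "0 \<le> r" "r < l"
  shows "resolvent l M r \<le> 1 / (l - r)"
proof (induction M)
  case 0
  then show ?case using assms by simp
next
  case (Suc M)
  have "resolvent l (Suc M) r \<le> (1 + (1 / (l - r)) * r) / l"
    unfolding resolvent.simps using assms
    by (intro divide_right_mono add_left_mono mult_right_mono Suc) auto
  also have "\<dots> = 1 / (l - r)" using assms by (simp add: field_simps)
  finally show ?case .
qed

text \<open>Eigenvalues up to \<open>r\<close> are bounded by the geometric series. The others are
  at most \<open>d\<close> in modulus; the truncated resolvent may be huge there, but its bound
  involves only \<open>l\<close>, \<open>M\<close> and \<open>d\<close>, not the size of the
  graph.\<close>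

lemma sum_green_sq_le:
  assumes G: "simple_graph G" "finite (verts G)" and deg: "\<And>x. card (nbrs G x) \<le> d"
    and r: "0 \<le> r" "r < l"
  defines "g \<equiv> size {#x \<in># eigenvalues_mset G. \<bar>x\<bar> \<le> r#}"
  shows "g \<le> card (verts G)"
    and "(\<Sum>v\<in>verts G. \<Sum>y\<in>verts G. (green G l M v y)\<^sup>2)
      \<le> real (card (verts G)) / (l - r)\<^sup>2 + real (card (verts G) - g) * (resolvent l M (real d))\<^sup>2"
proof -
  define vs where "vs = (SOME vs. distinct vs \<and> set vs = verts G)"
  have "\<exists>vs. distinct vs \<and> set vs = verts G" using finite_distinct_list[OF G(2)] by blast
  then have vs: "distinct vs" "set vs = verts G" unfolding vs_def by (metis (mono_tags, lifting) someI_ex)+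
  define n where "n = length vs"
  have n: "n = card (verts G)" unfolding n_def using vs distinct_card by force
  define A where "A = adj_matrix G"
  have A_eq: "A = Matrix.mat n n (\<lambda>(i, j). if adj G (vs ! i) (vs ! j) then 1 else 0)"
    unfolding A_def adj_matrix_def vs_def[symmetric] n_def by (simp add: Let_def)
  have A: "A \<in> carrier_mat n n" unfolding A_eq by simp
  have Aij: "A $$ (i, j) = of_bool (adj G (vs ! i) (vs ! j))" if "i < n" "j < n" for i j
    using that unfolding A_eq by simp
  have symG: "adj G u v = adj G v u" for u v using simple_graph_adjD(4)[OF G(1)] by blast
  have sym: "A $$ (i, j) = A $$ (j, i)" if "i < n" "j < n" for i j
    using that Aij symG by simp
  obtain es where es: "char_poly A = (\<Prod>e\<leftarrow>es. [:- e, 1:])" "length es = n"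
    by (rule symmetric_char_poly_splits[OF A sym])
  have eig: "eigenvalues_mset G = mset es"
  proof -
    have "proots (\<Prod>e\<leftarrow>es. [:- e, 1:]) = mset es"
    proof (induction es)
      case (Cons e es)
      have "(\<Prod>e\<leftarrow>es. [:- e, 1:]) \<noteq> 0" by (simp add: prod_list_zero_iff image_iff)
      then show ?case using Cons by (simp add: proots_mult del: mult_pCons_left)
    qed simp
    then show ?thesis using es unfolding eigenvalues_mset_def A_def by simp
  qed
  have bij: "bij_betw (\<lambda>i. vs ! i) {..<n} (verts G)"
    unfolding n_def using bij_betw_nth[OF vs(1)] vs(2) by (simp add: lessThan_atLeast0)
  have nbr_sum: "(\<Sum>k<n. h (vs ! k) * A $$ (k, j)) = (\<Sum>z\<in>nbrs G (vs ! j). h z)" if "j < n" for h :: "'a \<Rightarrow> real" and j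
  proof -
    have "(\<Sum>k<n. h (vs ! k) * A $$ (k, j)) = (\<Sum>k<n. h (vs ! k) * of_bool (adj G (vs ! k) (vs ! j)))"
      using Aij that by (intro sum.cong) auto
    also have "\<dots> = (\<Sum>z\<in>verts G. h z * of_bool (adj G z (vs ! j)))"
      by (rule sum.reindex_bij_betw[OF bij])
    also have "\<dots> = (\<Sum>z\<in>nbrs G (vs ! j). h z)"
      using G nbrs_subset_verts[OF G(1)] symG by (intro sum.mono_neutral_cong_right) auto
    finally show ?thesis .
  qed
  have green: "mat_resolvent n l M A $$ (i, j) = green G l M (vs ! i) (vs ! j)" if "i < n" "j < n" for i j
    using that
  proof (induction M arbitrary: j)
    case (Suc M)
    have "(\<Sum>k<n. mat_resolvent n l M A $$ (i, k) * A $$ (k, j)) = (\<Sum>k<n. green G l M (vs ! i) (vs ! k) * A $$ (k, j))"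
      using Suc by (intro sum.cong) auto
    also have "\<dots> = (\<Sum>z\<in>nbrs G (vs ! j). green G l M (vs ! i) z)" using Suc.prems by (intro nbr_sum)
    finally have e: "(\<Sum>k<n. mat_resolvent n l M A $$ (i, k) * A $$ (k, j)) = (\<Sum>z\<in>nbrs G (vs ! j). green G l M (vs ! i) z)" .
    have "(i = j) = (vs ! i = vs ! j)" using Suc.prems vs(1) by (simp add: n_def nth_eq_iff_index_eq)
    then show ?case unfolding mat_resolvent_entry[OF A Suc.prems] e by simp
  qed simp
  have "(\<Sum>v\<in>verts G. \<Sum>y\<in>verts G. (green G l M v y)\<^sup>2) = (\<Sum>i<n. \<Sum>y\<in>verts G. (green G l M (vs ! i) y)\<^sup>2)"
    by (rule sum.reindex_bij_betw[OF bij, symmetric])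
  also have "\<dots> = (\<Sum>i<n. \<Sum>j<n. (green G l M (vs ! i) (vs ! j))\<^sup>2)"
    by (intro sum.cong refl sum.reindex_bij_betw[OF bij, symmetric])
  also have "\<dots> = (\<Sum>i<n. \<Sum>j<n. (mat_resolvent n l M A $$ (i, j))\<^sup>2)"
    using green by (intro sum.cong) auto
  also have "\<dots> = (\<Sum>e\<leftarrow>es. (resolvent l M e)\<^sup>2)" by (rule sum_mat_resolvent_sq[OF A sym es(1)])
  finally have trace: "(\<Sum>v\<in>verts G. \<Sum>y\<in>verts G. (green G l M v y)\<^sup>2) = (\<Sum>e\<leftarrow>es. (resolvent l M e)\<^sup>2)" .
  \<comment> \<open>Evaluate the eigenvector equation at a coordinate of maximal modulus.\<close>
  have bound: "\<bar>e\<bar> \<le> real d" if "e \<in> set es" for e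
  proof -
    have "poly (char_poly A) e = 0" unfolding es(1) poly_prod_list_zero_iff using that by auto
    then obtain v where "eigenvector A v e" using eigenvalue_root_char_poly[OF A] by (auto simp: eigenvalue_def)
    then have v: "v \<in> carrier_vec n" "v \<noteq> 0\<^sub>v n" "A *\<^sub>v v = e \<cdot>\<^sub>v v" using A by (auto simp: eigenvector_def)
    have "\<exists>i<n. v $ i \<noteq> 0" using v by (metis eq_vecI carrier_vecD index_zero_vec)
    then obtain i0 where i0: "i0 < n" "v $ i0 \<noteq> 0" by blast
    define m where "m = Max ((\<lambda>i. \<bar>v $ i\<bar>) ` {..<n})"
    have mle: "\<bar>v $ i\<bar> \<le> m" if "i < n" for i unfolding m_def using that by (intro Max_ge) auto
    have "m \<in> (\<lambda>i. \<bar>v $ i\<bar>) ` {..<n}" unfolding m_def using i0 by (intro Max_in) auto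
    then obtain i where i: "i < n" "m = \<bar>v $ i\<bar>" by auto
    have m0: "m > 0" using mle[OF i0(1)] i0(2) by simp
    have "e * v $ i = (\<Sum>j<n. A $$ (i, j) * v $ j)"
    proof -
      have "(A *\<^sub>v v) $ i = (\<Sum>j<n. A $$ (i, j) * v $ j)"
        using A v(1) i by (simp add: scalar_prod_def lessThan_atLeast0)
      then show ?thesis using v i by simp
    qed
    then have "\<bar>e\<bar> * m = \<bar>\<Sum>j<n. A $$ (i, j) * v $ j\<bar>" using i by (simp add: abs_mult[symmetric])
    also have "\<dots> \<le> (\<Sum>j<n. \<bar>A $$ (i, j) * v $ j\<bar>)" by (rule sum_abs)
    also have "\<dots> \<le> (\<Sum>j<n. m * A $$ (j, i))"
      using mle Aij i symG by (intro sum_mono) (auto simp: abs_mult)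
    also have "\<dots> = m * real (card (nbrs G (vs ! i)))"
      using nbr_sum[OF i(1), of "\<lambda>_. m"] by (simp add: mult.commute)
    also have "\<dots> \<le> m * real d" using deg m0 by simp
    finally show ?thesis using m0 by simp
  qed
  have l0: "l > 0" using r by simp
  have g: "g = length (filter (\<lambda>x. \<bar>x\<bar> \<le> r) es)"
    unfolding g_def eig by (simp flip: mset_filter)
  show gle: "g \<le> card (verts G)" unfolding g using es(2) n by (metis length_filter_le)
  have good: "(resolvent l M e)\<^sup>2 \<le> 1 / (l - r)\<^sup>2" if "\<bar>e\<bar> \<le> r" for e
  proof -
    have "\<bar>resolvent l M e\<bar> \<le> 1 / (l - r)" using resolvent_abs_le[OF l0 that, of M] resolvent_le[OF r, of M] by linarith
    then have "\<bar>resolvent l M e\<bar>\<^sup>2 \<le> (1 / (l - r))\<^sup>2" by (intro power_mono) auto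
    then show ?thesis by (simp add: power_divide)
  qed
  have any: "(resolvent l M e)\<^sup>2 \<le> (resolvent l M (real d))\<^sup>2" if "e \<in> set es" for e
  proof -
    have "\<bar>resolvent l M e\<bar> \<le> resolvent l M (real d)" by (rule resolvent_abs_le[OF l0 bound[OF that]])
    then have "\<bar>resolvent l M e\<bar>\<^sup>2 \<le> (resolvent l M (real d))\<^sup>2" by (intro power_mono) auto
    then show ?thesis by simp
  qed
  have "(\<Sum>e\<leftarrow>xs. (resolvent l M e)\<^sup>2) \<le> real (length (filter (\<lambda>x. \<bar>x\<bar> \<le> r) xs)) * (1 / (l - r)\<^sup>2)
      + real (length xs - length (filter (\<lambda>x. \<bar>x\<bar> \<le> r) xs)) * (resolvent l M (real d))\<^sup>2" if "set xs \<subseteq> set es" for xs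
    using that
  proof (induction xs)
    case (Cons e xs)
    have le: "length (filter (\<lambda>x. \<bar>x\<bar> \<le> r) xs) \<le> length xs" by (rule length_filter_le)
    then have s: "Suc (length xs) - length (filter (\<lambda>x. \<bar>x\<bar> \<le> r) xs) = Suc (length xs - length (filter (\<lambda>x. \<bar>x\<bar> \<le> r) xs))"
      by (rule Suc_diff_le)
    show ?case
    proof (cases "\<bar>e\<bar> \<le> r")
      case True
      then show ?thesis using Cons good[OF True] by (simp add: algebra_simps)
    next
      case False
      then show ?thesis using Cons any[of e] by (simp add: s algebra_simps)
    qed
  qed simp
  from this[of es] have "(\<Sum>e\<leftarrow>es. (resolvent l M e)\<^sup>2) \<le> real g * (1 / (l - r)\<^sup>2) + real (n - g) * (resolvent l M (real d))\<^sup>2"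
    unfolding g es(2) by simp
  also have "\<dots> \<le> real n * (1 / (l - r)\<^sup>2) + real (n - g) * (resolvent l M (real d))\<^sup>2"
    using gle n by (intro add_right_mono mult_right_mono) auto
  finally show "(\<Sum>v\<in>verts G. \<Sum>y\<in>verts G. (green G l M v y)\<^sup>2)
      \<le> real (card (verts G)) / (l - r)\<^sup>2 + real (card (verts G) - g) * (resolvent l M (real d))\<^sup>2"
    unfolding trace n by simp
qed

section \<open>Short cycles with a branch\<close>

lemma walk_rev:
  assumes "simple_graph G" "walk G u p v"
  shows "walk G v (rev p) u"
proof -
  have "successively (\<lambda>x y. adj G y x) p"
    using assms(2) simple_graph_adjD(4)[OF assms(1)] by (auto simp: walk_def intro: successively_mono)
  then show ?thesis using assms(2) by (auto simp: walk_def hd_rev last_rev successively_rev)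
qed

lemma nbhd_sym:
  assumes "simple_graph G" "v \<in> verts G" "u \<in> verts (nbhd r G v)"
  shows "v \<in> verts (nbhd r G u)"
proof -
  obtain p where p: "walk G v p u" "length p - 1 \<le> r" using assms(3) by (auto simp: verts_nbhd graph_dist_le_iff)
  have "walk G u (rev p) v" by (rule walk_rev[OF assms(1) p(1)])
  then show ?thesis using p(2) assms(2) by (auto simp: verts_nbhd graph_dist_le_iff intro!: exI[of _ "rev p"])
qed

lemma nbhd_Suc_subset:
  assumes "simple_graph G"
  shows "verts (nbhd (Suc r) G v) \<subseteq> (\<Union>u\<in>verts (nbhd r G v). insert u (nbrs G u))"
proof
  fix u assume u: "u \<in> verts (nbhd (Suc r) G v)"
  then obtain p where p: "walk G v p u" "length p - 1 \<le> Suc r" by (auto simp: verts_nbhd graph_dist_le_iff)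
  show "u \<in> (\<Union>u\<in>verts (nbhd r G v). insert u (nbrs G u))"
  proof (cases "length p - 1 \<le> r")
    case True
    then have "u \<in> verts (nbhd r G v)" using u p by (auto simp: verts_nbhd graph_dist_le_iff)
    then show ?thesis by blast
  next
    case False
    define q where "q = butlast p"
    have "p \<noteq> []" "last p = u" using p(1) by (auto simp: walk_def)
    then have q: "p = q @ [u]" unfolding q_def by (metis append_butlast_last_id)
    have "q \<noteq> []" using False q by auto
    note q = q this
    have wq: "walk G v q (last q)" and au: "adj G (last q) u"
      using p(1) q by (auto simp: walk_def successively_append_iff)
    have "last q \<in> verts G" "length q - 1 \<le> r" using simple_graph_adjD(1)[OF assms au] p(2) q by auto
    then have "last q \<in> verts (nbhd r G v)" using wq unfolding verts_nbhd graph_dist_le_iff by blast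
    then show ?thesis using au by auto
  qed
qed

lemma card_nbhd_le:
  assumes G: "simple_graph G" "loc_finite G" and deg: "\<And>x. card (nbrs G x) \<le> d"
  shows "finite (verts (nbhd r G v)) \<and> card (verts (nbhd r G v)) \<le> Suc d ^ r"
proof (induction r)
  case 0
  have sub: "verts (nbhd 0 G v) \<subseteq> {v}"
  proof
    fix u assume "u \<in> verts (nbhd 0 G v)"
    then obtain p where "walk G v p u" "length p - 1 \<le> 0" by (auto simp: verts_nbhd graph_dist_le_iff)
    then show "u \<in> {v}" by (cases p) (auto simp: walk_def)
  qed
  from finite_subset[OF sub] card_mono[OF _ sub] show ?case by simp
next
  case (Suc r)
  let ?B = "verts (nbhd r G v)"
  let ?U = "\<Union>u\<in>?B. insert u (nbrs G u)"
  have fin: "finite ?U" using Suc G by auto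
  have "card (insert u (nbrs G u)) \<le> Suc d" for u
    using card_insert_le_m1[of "Suc d" "nbrs G u" u] deg[of u] by simp
  then have "card ?U \<le> card ?B * Suc d"
    using Suc card_UN_le[of ?B "\<lambda>u. insert u (nbrs G u)"] sum_bounded_above[of ?B "\<lambda>u. card (insert u (nbrs G u))" "Suc d"]
    by (auto intro: order_trans)
  also have "\<dots> \<le> Suc d ^ r * Suc d" using Suc by (intro mult_le_mono1) blast
  finally have "card ?U \<le> Suc d ^ Suc r" by (simp add: mult.commute)
  then show ?case
    using nbhd_Suc_subset[OF G(1), of r v] fin by (meson card_mono finite_subset order_trans)
qed

lemma nbhd_simple: "simple_graph G \<Longrightarrow> simple_graph (nbhd r G v)"
  by (auto simp: simple_graph_def nbhd_def induced_def)

lemma nbhd_adj: "adj (nbhd r G v) x y \<Longrightarrow> adj G x y"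
  by (auto simp: nbhd_def induced_def)

lemma walk_append:
  assumes "walk G u p v" "walk G v q w"
  shows "walk G u (p @ tl q) w"
proof (cases "tl q = []")
  case True
  then have "q = [v]" using assms(2) by (cases q) (auto simp: walk_def)
  then show ?thesis using assms by (auto simp: walk_def)
next
  case False
  then obtain a q' where "q = v # a # q'" using assms(2)
    by (cases q rule: remdups_adj.cases) (auto simp: walk_def)
  then show ?thesis using assms by (auto simp: walk_def successively_append_iff)
qed

lemma nbhd_connected:
  assumes G: "simple_graph G" and v: "v \<in> verts G"
  shows "graph_connected (nbhd r G v)"
proof -
  let ?H = "nbhd r G v"
  have H: "simple_graph ?H" by (rule nbhd_simple[OF G])
  have root: "\<exists>p. walk ?H v p u" if u: "u \<in> verts ?H" for u
  proof -
    obtain p where p: "walk G v p u" "length p - 1 \<le> r" using u by (auto simp: verts_nbhd graph_dist_le_iff)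
    \<comment> \<open>An initial segment of a short walk is short, so the walk does not leave the
      ball.\<close>
    have inball: "x \<in> verts ?H" if x: "x \<in> set p" for x
    proof -
      obtain as bs where ab: "p = as @ x # bs" using split_list[OF x] by blast
      have "successively (adj G) ((as @ [x]) @ bs)" using p(1) ab by (simp add: walk_def)
      then have "successively (adj G) (as @ [x])" unfolding successively_append_iff[of _ "as @ [x]"] by blast
      moreover have "hd (as @ [x]) = v" using p(1) ab by (cases as) (auto simp: walk_def)
      ultimately have "walk G v (as @ [x]) x" using p(1) ab by (auto simp: walk_def)
      moreover have "length (as @ [x]) - 1 \<le> r" using p(2) ab by simp
      moreover have "x \<in> verts G" using p(1) x by (auto simp: walk_def)
      ultimately show ?thesis unfolding verts_nbhd graph_dist_le_iff by blast
    qed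
    have "adj ?H x y" if "adj G x y" "x \<in> set p" "y \<in> set p" for x y
      using that inball[OF that(2)] inball[OF that(3)] by (auto simp: nbhd_def induced_def)
    moreover have "successively (adj G) p" using p(1) by (simp add: walk_def)
    ultimately have "successively (adj ?H) p" by (auto simp: successively_conv_nth)
    then show ?thesis using p(1) inball by (auto simp: walk_def)
  qed
  have "v \<in> verts ?H" using v walk_single[OF v] by (auto simp: verts_nbhd graph_dist_le_iff intro!: exI[of _ "[v]"])
  moreover have "\<exists>p. walk ?H x p y" if xy: "x \<in> verts ?H" "y \<in> verts ?H" for x y
  proof -
    obtain p q where "walk ?H v p x" "walk ?H v q y" using root xy by blast
    then show ?thesis using walk_append walk_rev[OF H] by metis
  qed
  ultimately show ?thesis by (auto simp: graph_connected_def)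
qed

text \<open>Balls are connected, so failing to be a tree means containing a cycle. Its vertices are
  distinct and lie in the ball, whose size bounds the length uniformly in \<open>G\<close>.\<close>

lemma short_cycle:
  assumes G: "simple_graph G" "loc_finite G" and deg: "\<And>x. card (nbrs G x) \<le> d" and v: "v \<in> verts G"
    and no: "\<not> is_tree (nbhd r G v)"
  obtains c where "graph_cycle G c" "set c \<subseteq> verts (nbhd r G v)" "length c \<le> Suc d ^ r"
proof -
  let ?H = "nbhd r G v"
  obtain c where c: "graph_cycle ?H c"
    using no nbhd_simple[OF G(1)] nbhd_connected[OF G(1) v] by (auto simp: is_tree_def)
  have sub: "set c \<subseteq> verts ?H" using c by (auto simp: graph_cycle_def walk_def)
  have "length c = card (set c)" using c by (simp add: graph_cycle_def distinct_card)
  also have "\<dots> \<le> card (verts ?H)" using sub card_nbhd_le[OF G deg] by (intro card_mono) auto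
  also have "\<dots> \<le> Suc d ^ r" using card_nbhd_le[OF G deg] by blast
  finally have "length c \<le> Suc d ^ r" .
  moreover have "graph_cycle G c"
    using c sub by (auto simp: graph_cycle_def walk_def verts_nbhd intro: nbhd_adj successively_mono)
  ultimately show ?thesis using that sub by blast
qed

section \<open>Cycles with an infinite branch\<close>

lemma graph_cycle_rotate:
  assumes "graph_cycle G (as @ bs)" "bs \<noteq> []"
  shows "graph_cycle G (bs @ as)"
  using assms by (cases "as = []") (auto simp: graph_cycle_def walk_def successively_append_iff)

lemma graph_cycle_rev:
  assumes "simple_graph G" "graph_cycle G c"
  shows "graph_cycle G (rev c)"
proof -
  have "walk G (hd c) c (last c)" "c \<noteq> []" using assms(2) by (auto simp: graph_cycle_def)
  then show ?thesis using assms walk_rev[OF assms(1)] simple_graph_adjD(4)[OF assms(1)]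
    by (auto simp: graph_cycle_def hd_rev last_rev)
qed

text \<open>Running around the cycle for ever never backtracks: with at least three vertices, the
  second next one differs from the present one.\<close>

lemma graph_cycle_inf_arc:
  assumes c: "graph_cycle G c" and i: "i < length c"
  shows "inf_arc G (c ! i) (c ! ((i + 1) mod length c))"
proof -
  let ?k = "length c"
  have k: "?k \<ge> 3" and dist: "distinct c" and suc: "successively (adj G) c" and last: "adj G (last c) (hd c)"
    using c by (auto simp: graph_cycle_def walk_def)
  have step: "adj G (c ! i) (c ! ((i + 1) mod ?k))" if "i < ?k" for i
  proof (cases "i + 1 = ?k")
    case True
    then have "c ! i = last c" using k by (metis add_diff_cancel_right' last_conv_nth list.size(3) not_numeral_le_zero)
    moreover have "c ! ((i + 1) mod ?k) = hd c" unfolding True using k by (cases c) auto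
    ultimately show ?thesis using last by simp
  next
    case False
    then have "i + 1 < ?k" using that by simp
    then show ?thesis using suc by (simp add: successively_conv_nth)
  qed
  define Q where "Q u v \<longleftrightarrow> (\<exists>i<?k. u = c ! i \<and> v = c ! ((i + 1) mod ?k))" for u v
  show ?thesis
  proof (rule inf_arc_coinduct[of Q])
    show "Q (c ! i) (c ! ((i + 1) mod ?k))" using i by (auto simp: Q_def)
    fix u v assume "Q u v"
    then obtain i where i: "i < ?k" "u = c ! i" "v = c ! ((i + 1) mod ?k)" by (auto simp: Q_def)
    let ?j = "(i + 1) mod ?k"
    have "?k > 0" using k by linarith
    then have j: "?j < ?k" "(?j + 1) mod ?k < ?k" by (rule mod_less_divisor)+
    have ne: "(?j + 1) mod ?k \<noteq> i"
    proof -
      have "(?j + 1) mod ?k = (i + 2) mod ?k" by (simp add: mod_Suc_eq)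
      moreover have "(i + 2) mod ?k \<noteq> i"
      proof (cases "i + 2 < ?k")
        case True then show ?thesis by simp
      next
        case False
        then have "(i + 2) mod ?k = i + 2 - ?k" using i(1) k by (simp add: mod_if)
        then show ?thesis using k False by arith
      qed
      ultimately show ?thesis by simp
    qed
    have "c ! ((?j + 1) mod ?k) \<noteq> u" using i(1,2) j ne dist by (simp add: nth_eq_iff_index_eq)
    moreover have "adj G v (c ! ((?j + 1) mod ?k))" using step[OF j(1)] i(3) by simp
    moreover have "Q v (c ! ((?j + 1) mod ?k))" using i(3) j(1) by (auto simp: Q_def)
    ultimately show "adj G u v \<and> (\<exists>c\<in>succs G u v. Q v c)" using step[OF i(1)] i(2,3) by auto
  qed
qed

lemma nb_walk_extendable:
  assumes "simple_graph G"
  shows "nb_walk G (c # b # q) \<Longrightarrow> extendable G (length q) c b"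
proof (induction q arbitrary: c b)
  case Nil
  then show ?case using simple_graph_adjD[OF assms] by simp
next
  case (Cons e q)
  have "nb_walk G (b # e # q)" "adj G b c" "c \<noteq> e" using Cons.prems by auto
  moreover have "adj G b e" using nb_walk_ConsD(2)[OF assms \<open>nb_walk G (b # e # q)\<close>] simple_graph_adjD[OF assms] by blast
  ultimately show ?case using Cons.IH[of b e] simple_graph_adjD[OF assms \<open>adj G b c\<close>] by auto
qed

text \<open>If every arc leaving \<open>c\<close> died out within \<open>N0\<close> steps, all
  vertices would lie within distance \<open>Suc N0\<close> of \<open>c\<close>, too few for
  \<open>big\<close>. This is how the growth of the graphs rules out a cycle with nothing but finite
  trees attached.\<close>

lemma cycle_inf_branch:
  assumes G: "simple_graph G" "loc_finite G" "graph_connected G" and deg: "\<And>x. card (nbrs G x) \<le> d"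
    and N0: "\<And>x b. extendable G N0 x b \<Longrightarrow> inf_arc G x b"
    and c: "graph_cycle G c" and big: "card (verts G) > length c * Suc d ^ Suc N0"
  obtains x b where "x \<in> set c" "b \<notin> set c" "inf_arc G x b"
proof -
  have "\<exists>x b. x \<in> set c \<and> b \<notin> set c \<and> inf_arc G x b"
  proof (rule ccontr)
    assume no: "\<not> ?thesis"
    have cV: "set c \<subseteq> verts G" "c \<noteq> []" using c by (auto simp: graph_cycle_def walk_def)
    have close: "\<exists>x\<in>set c. y \<in> verts (nbhd (Suc N0) G x)" if y: "y \<in> verts G" for y
    proof -
      \<comment> \<open>A shortest non-backtracking walk from \<open>c\<close> to \<open>y\<close>
        leaves \<open>c\<close> with its first step.\<close>
      define P where "P q \<longleftrightarrow> nb_walk G q \<and> hd q \<in> set c \<and> last q = y" for q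
      obtain p where "walk G (hd c) p y" using G(3) y cV hd_in_set[of c] unfolding graph_connected_def by blast
      from walk_imp_nb_walk[OF G(1) this] have "\<exists>q. P q" unfolding P_def using cV hd_in_set[of c] by metis
      then obtain q0 where "P q0" ..
      from ex_has_least_nat[of P, OF this, of length]
      obtain q where q: "P q" and least: "\<And>q'. P q' \<Longrightarrow> length q \<le> length q'" by blast
      have nb: "nb_walk G q" "hd q \<in> set c" "last q = y" using q by (auto simp: P_def)
      have len: "length q - 1 \<le> Suc N0"
      proof (cases q rule: remdups_adj.cases)
        case (3 x b q')
        have nbt: "nb_walk G (b # q')" using nb_walk_ConsD(1)[OF G(1), of x b q'] nb(1) 3 by simp
        have "b \<notin> set c"
        proof
          assume "b \<in> set c"
          then have "P (b # q')" unfolding P_def using nbt nb(3) 3 by simp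
          from least[OF this] 3 show False by simp
        qed
        then have "\<not> inf_arc G x b" using no nb(2) 3 by auto
        then have ne: "\<not> extendable G N0 x b" using N0 by blast
        have ext: "extendable G (length q') x b" using nb_walk_extendable[OF G(1), of x b q'] nb(1) 3 by simp
        have "\<not> N0 \<le> length q'" using ne extendable_antimono[OF _ ext, of N0] by blast
        then show ?thesis using 3 by simp
      qed auto
      have "walk G (hd q) q y"
        using nb nb_walk_verts[OF G(1) nb(1)] nb_walk_successively[OF G(1) nb(1)] nb_walk_not_Nil[OF nb(1)]
        by (auto simp: walk_def)
      then have "y \<in> verts (nbhd (Suc N0) G (hd q))" using len y unfolding verts_nbhd graph_dist_le_iff by blast
      then show ?thesis using nb(2) by blast
    qed
    have "card (verts G) \<le> card (\<Union>x\<in>set c. verts (nbhd (Suc N0) G x))"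
      using close card_nbhd_le[OF G(1,2) deg] by (intro card_mono) auto
    also have "\<dots> \<le> (\<Sum>x\<in>set c. card (verts (nbhd (Suc N0) G x)))" by (rule card_UN_le) simp
    also have "\<dots> \<le> of_nat (card (set c)) * Suc d ^ Suc N0"
      using card_nbhd_le[OF G(1,2) deg] by (intro sum_bounded_above) blast
    also have "\<dots> \<le> length c * Suc d ^ Suc N0" using card_length[of c] by (intro mult_le_mono1) simp
    finally show False using big by simp
  qed
  then show ?thesis using that by blast
qed

text \<open>Besides what the detour construction asks for, \<open>x\<close> gets three different
  core neighbours, \<open>y\<close>, \<open>b\<close> and \<open>last s\<close>, as the Harnack
  inequality requires of a branching point.\<close>

definition loop_at :: "'a sgraph \<Rightarrow> nat \<Rightarrow> 'a \<Rightarrow> 'a \<Rightarrow> 'a \<Rightarrow> 'a list \<Rightarrow> bool" where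
  "loop_at G L y x b s \<longleftrightarrow> (\<exists>s'. s = x # y # s') \<and> nb_walk G (s @ [x]) \<and> length s \<le> L \<and>
     last s \<noteq> y \<and> last s \<noteq> b \<and> b \<noteq> y \<and> core_arc G x y \<and> core_arc G x b \<and> core_arc G x (last s)"

definition bad_at :: "'a sgraph \<Rightarrow> nat \<Rightarrow> 'a \<Rightarrow> 'a \<Rightarrow> 'a \<Rightarrow> bool" where
  "bad_at G L y x b \<longleftrightarrow> (\<exists>s. loop_at G L y x b s)"

definition branch_points :: "'a sgraph \<Rightarrow> nat \<Rightarrow> 'a set" where
  "branch_points G L = {x. \<exists>y b. bad_at G L y x b}"

lemma distinct_nb_walk:
  assumes "simple_graph G"
  shows "s \<noteq> [] \<Longrightarrow> distinct s \<Longrightarrow> set s \<subseteq> verts G \<Longrightarrow> successively (adj G) s \<Longrightarrow> nb_walk G s"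
proof (induction s rule: induct_list012)
  case (3 x y zs)
  then have "nb_walk G (y # zs)" "adj G y x" using simple_graph_adjD(4)[OF assms] by auto
  then show ?case using 3 by (cases zs) auto
qed auto

text \<open>Rotate the cycle to begin at \<open>x\<close>; \<open>y\<close> and the last vertex are
  then its two neighbours on the cycle, and \<open>b\<close> is a third direction. Arcs out of
  \<open>x\<close> along the cycle are infinite by running around it either way, and each arc into
  \<open>x\<close> is infinite because it can continue onto the cycle.\<close>

lemma cycle_branch_point:
  assumes G: "simple_graph G" and c: "graph_cycle G c" and x: "x \<in> set c" and b: "b \<notin> set c" "inf_arc G x b"
  shows "x \<in> branch_points G (length c)"
proof -
  obtain as bs where ab: "c = as @ x # bs" using split_list[OF x] by blast
  define s where "s = x # bs @ as"
  have s: "graph_cycle G s" using graph_cycle_rotate[of G as "x # bs"] c ab by (simp add: s_def)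
  have k: "length s \<ge> 3" and dist: "distinct s" and suc: "successively (adj G) s" and last: "adj G (last s) (hd s)"
    and V: "set s \<subseteq> verts G"
    using s by (auto simp: graph_cycle_def walk_def)
  obtain y s' where ys: "s = x # y # s'" "s' \<noteq> []"
    using k unfolding s_def by (cases "bs @ as") (auto simp: Suc_le_eq)
  let ?z = "last s"
  have zs: "?z \<in> set s'" using ys by simp
  have zy: "?z \<noteq> y" "?z \<noteq> x" using zs dist ys by auto
  have setc: "set s = set c" by (auto simp: s_def ab)
  have "y \<in> set s" "?z \<in> set s" using ys by simp_all
  then have bne: "b \<noteq> y" "b \<noteq> ?z" using b(1) unfolding setc by blast+
  have nb: "nb_walk G (s @ [x])"
  proof -
    have e: "butlast s @ [?z] = s" using ys by simp
    have sne: "s \<noteq> []" using ys by simp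
    have "nb_walk G (butlast s @ ?z # [x])"
    proof (rule nb_walk_append[OF G])
      show "nb_walk G (butlast s @ [?z])" unfolding e by (rule distinct_nb_walk[OF G sne dist V suc])
      show "nb_walk G [?z, x]" using last simple_graph_adjD(4)[OF G] ys by simp
      have "last (butlast s) \<in> set (y # butlast s')"
        using ys last_in_set[of "y # butlast s'"] by simp
      then show "last (butlast s) \<noteq> hd [x]" using dist ys by (auto dest: in_set_butlastD)
    qed
    moreover have "butlast s @ ?z # [x] = (butlast s @ [?z]) @ [x]" by simp
    ultimately show ?thesis unfolding e by simp
  qed
  have i1: "inf_arc G x y" using graph_cycle_inf_arc[OF s, of 0] k ys by simp
  have i2: "inf_arc G ?z x"
  proof -
    have "length s - 1 + 1 = length s" "s ! (length s - 1) = ?z" using ys by (auto simp: last_conv_nth)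
    then show ?thesis using graph_cycle_inf_arc[OF s, of "length s - 1"] k ys by auto
  qed
  have i3: "inf_arc G x ?z"
  proof -
    note sr = graph_cycle_rev[OF G s]
    have "rev s \<noteq> []" using ys by simp
    moreover have "last (rev s) = x" unfolding last_rev using ys by simp
    ultimately have "length (rev s) - 1 + 1 = length (rev s)" "rev s ! (length (rev s) - 1) = x" "rev s ! 0 = ?z"
      using last_conv_nth[of "rev s"] hd_conv_nth[of "rev s"] by (auto simp: hd_rev)
    then show ?thesis using graph_cycle_inf_arc[OF sr, of "length (rev s) - 1"] k ys by auto
  qed
  have i4: "inf_arc G y x"
    by (rule inf_arcI[OF _ _ i3]) (use simple_graph_adjD(4)[OF G inf_arc_adj[OF i1]] inf_arc_adj[OF i3] zy in auto)
  have i5: "inf_arc G b x"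
    by (rule inf_arcI[OF _ _ i1]) (use simple_graph_adjD(4)[OF G inf_arc_adj[OF b(2)]] inf_arc_adj[OF i1] bne in auto)
  have "length s \<le> length c" by (simp add: s_def ab)
  then have "loop_at G (length c) y x b s"
    unfolding loop_at_def core_arc_def using ys(1) nb zy(1) bne(1) bne(2)[symmetric] i1 i2 i3 i4 i5 b(2) by blast
  then show ?thesis by (auto simp: branch_points_def bad_at_def)
qed

lemma loop_at_mono: "loop_at G L y x b s \<Longrightarrow> L \<le> L' \<Longrightarrow> loop_at G L' y x b s"
  by (auto simp: loop_at_def)

lemma branch_points_mono: "L \<le> L' \<Longrightarrow> branch_points G L \<subseteq> branch_points G L'"
  by (auto simp: branch_points_def bad_at_def intro: loop_at_mono)

lemma branch_points_subset:
  assumes "simple_graph G"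
  shows "branch_points G L \<subseteq> verts G"
proof
  fix x assume "x \<in> branch_points G L"
  then obtain y where "core_arc G x y" by (auto simp: branch_points_def bad_at_def loop_at_def)
  from simple_graph_adjD(1)[OF assms core_arc_adj[OF this]] show "x \<in> verts G" .
qed

text \<open>A short cycle near \<open>v\<close> carries a branch point within distance
  \<open>r\<close> of \<open>v\<close>, and each branch point is that close to at most (d + 1)^r
  vertices. The same power bounds the length of the cycle, hence of the loop.\<close>

lemma nontree_card_le:
  assumes G: "simple_graph G" "finite (verts G)" "graph_connected G" and deg: "\<And>x. card (nbrs G x) \<le> d"
    and N0: "\<And>x b. extendable G N0 x b \<Longrightarrow> inf_arc G x b"
    and big: "card (verts G) > Suc d ^ r * Suc d ^ Suc N0"
  shows "card {v \<in> verts G. \<not> is_tree (nbhd r G v)} \<le> card (branch_points G (Suc d ^ r)) * Suc d ^ r"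
proof -
  have lf: "loc_finite G" using G nbrs_subset_verts[OF G(1)] by (auto simp: loc_finite_def intro: finite_subset)
  let ?X = "branch_points G (Suc d ^ r)"
  have XV: "?X \<subseteq> verts G" by (rule branch_points_subset[OF G(1)])
  have finX: "finite ?X" using XV G(2) by (rule finite_subset)
  have sub: "{v \<in> verts G. \<not> is_tree (nbhd r G v)} \<subseteq> (\<Union>x\<in>?X. verts (nbhd r G x))"
  proof
    fix v assume "v \<in> {v \<in> verts G. \<not> is_tree (nbhd r G v)}"
    then have v: "v \<in> verts G" "\<not> is_tree (nbhd r G v)" by auto
    obtain c where c: "graph_cycle G c" "set c \<subseteq> verts (nbhd r G v)" "length c \<le> Suc d ^ r"
      by (rule short_cycle[OF G(1) lf deg v])
    have "length c * Suc d ^ Suc N0 \<le> Suc d ^ r * Suc d ^ Suc N0" by (rule mult_le_mono1[OF c(3)])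
    then have bigc: "card (verts G) > length c * Suc d ^ Suc N0" using big by linarith
    obtain x b where xb: "x \<in> set c" "b \<notin> set c" "inf_arc G x b"
      by (rule cycle_inf_branch[OF G(1) lf G(3) deg N0 c(1) bigc])
    have "x \<in> branch_points G (length c)" by (rule cycle_branch_point[OF G(1) c(1) xb])
    then have "x \<in> ?X" by (rule subsetD[OF branch_points_mono[OF c(3)]])
    moreover have "v \<in> verts (nbhd r G x)" using nbhd_sym[OF G(1) v(1)] c(2) xb(1) by blast
    ultimately show "v \<in> (\<Union>x\<in>?X. verts (nbhd r G x))" by blast
  qed
  have "card {v \<in> verts G. \<not> is_tree (nbhd r G v)} \<le> card (\<Union>x\<in>?X. verts (nbhd r G x))"
    using finX card_nbhd_le[OF G(1) lf deg] by (intro card_mono sub) auto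
  also have "\<dots> \<le> (\<Sum>x\<in>?X. card (verts (nbhd r G x)))" by (rule card_UN_le[OF finX])
  also have "\<dots> \<le> of_nat (card ?X) * Suc d ^ r"
    using card_nbhd_le[OF G(1) lf deg] by (intro sum_bounded_above) blast
  finally show ?thesis by simp
qed

section \<open>Sequences of finite graphs with a common universal cover\<close>

lemma branch_tendsto:
  assumes "\<And>x b. adj G x b \<Longrightarrow> (\<lambda>N. w N x b) \<longlonglongrightarrow> v x b" "adj G x b"
  shows "(\<lambda>N. branch G (w N) K x b) \<longlonglongrightarrow> branch G v K x b"
  using assms(2)
proof (induction K arbitrary: x b)
  case (Suc K)
  have "(\<lambda>N. w N x b * (1 + (\<Sum>c\<in>succs G x b. branch G (w N) K b c)))
      \<longlonglongrightarrow> v x b * (1 + (\<Sum>c\<in>succs G x b. branch G v K b c))"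
    by (intro tendsto_intros assms(1) Suc) auto
  then show ?case by simp
qed simp

lemma exp_dominates_quartic:
  assumes "(c::real) > 0"
  obtains B0 where "B0 \<ge> 1" "\<And>B. B \<ge> B0 \<Longrightarrow> a * (b * B ^ 4 + 1) < exp (c * B)"
proof -
  define k where "k = \<bar>a\<bar> * (\<bar>b\<bar> + 1)"
  have "filterlim (\<lambda>B. exp (c * B) / B ^ 4) at_top at_top" using assms by real_asymp
  then have "eventually (\<lambda>B. k < exp (c * B) / B ^ 4) at_top" by (simp add: filterlim_at_top_dense)
  then obtain B1 where B1: "\<And>B. B \<ge> B1 \<Longrightarrow> k < exp (c * B) / B ^ 4"
    by (auto simp: eventually_at_top_linorder)
  show ?thesis
  proof (rule that[of "max 1 B1"])
    fix B assume B: "B \<ge> max 1 B1"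
    then have B4: "B ^ 4 \<ge> 1" by simp
    have "b * B ^ 4 + 1 \<le> \<bar>b\<bar> * B ^ 4 + B ^ 4" using B4 by (intro add_mono mult_right_mono) auto
    moreover have "- (\<bar>b\<bar> * B ^ 4 + B ^ 4) \<le> b * B ^ 4 + 1"
    proof -
      have "- \<bar>b\<bar> * B ^ 4 \<le> b * B ^ 4" using B4 by (intro mult_right_mono) linarith+
      then show ?thesis using B4 by simp
    qed
    ultimately have "\<bar>b * B ^ 4 + 1\<bar> \<le> (\<bar>b\<bar> + 1) * B ^ 4" by (simp add: distrib_right abs_le_iff)
    then have "\<bar>a\<bar> * \<bar>b * B ^ 4 + 1\<bar> \<le> \<bar>a\<bar> * ((\<bar>b\<bar> + 1) * B ^ 4)" by (rule mult_left_mono) simp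
    then have "a * (b * B ^ 4 + 1) \<le> k * B ^ 4"
      unfolding k_def using abs_ge_self[of "a * (b * B ^ 4 + 1)"] by (simp add: abs_mult mult.assoc)
    also have "\<dots> < exp (c * B)" using B1[of B] B B4 by (simp add: less_divide_eq)
    finally show "a * (b * B ^ 4 + 1) < exp (c * B)" .
  qed simp
qed

locale common_cover =
  fixes G :: "nat \<Rightarrow> 'a sgraph" and T :: "'b sgraph" and \<pi> :: "nat \<Rightarrow> 'b \<Rightarrow> 'a"
  assumes simple: "\<And>n. simple_graph (G n)" and finite: "\<And>n. finite (verts (G n))"
    and connected: "\<And>n. graph_connected (G n)"
    and tree: "is_tree T" and infinite: "infinite (verts T)" and cover: "\<And>n. cover_map (\<pi> n) T (G n)"
begin

text \<open>\<open>d\<close> bounds the degrees of \<open>G 0\<close>, hence those of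
  \<open>T\<close> and of every \<open>G n\<close>. \<open>A\<close> will be the price of reversing
  paths in \<open>G 0\<close>, and \<Lambda> is the top of the range of energies in use.\<close>

definition d :: nat where "d = card (verts (G 0))"
definition \<rho> :: real where "\<rho> = graph_spectral_radius T"
definition \<Lambda> :: real where "\<Lambda> = \<rho> + 1"
definition A :: nat where "A = card (arcs (G 0))"

lemma simple_T: "simple_graph T"
  using tree by (simp add: is_tree_def)

lemma nbrs_T: "finite (nbrs T x) \<and> card (nbrs T x) \<le> d"
proof (cases "x \<in> verts T")
  case True
  then have bij: "bij_betw (\<pi> 0) (nbrs T x) (nbrs (G 0) (\<pi> 0 x))"
    by (rule cover_map_bij_nbrs[OF simple_T simple cover])
  have sub: "nbrs (G 0) (\<pi> 0 x) \<subseteq> verts (G 0)" by (rule nbrs_subset_verts[OF simple])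
  have "finite (nbrs T x)"
    using bij_betw_finite[OF bij] finite_subset[OF sub finite] by blast
  moreover have "card (nbrs T x) \<le> d"
    unfolding bij_betw_same_card[OF bij] d_def by (rule card_mono[OF finite sub])
  ultimately show ?thesis by blast
next
  case False
  then have "nbrs T x = {}" using simple_graph_adjD(1)[OF simple_T] by auto
  then show ?thesis by simp
qed

lemma loc_finite_T: "loc_finite T"
  using nbrs_T by (simp add: loc_finite_def)

lemma card_nbrs_T: "card (nbrs T x) \<le> d"
  using nbrs_T by blast

lemma card_nbrs: "card (nbrs (G n) x) \<le> d"
proof (cases "x \<in> verts (G n)")
  case True
  obtain x' where x': "x' \<in> verts T" "\<pi> n x' = x" by (rule cover_map_lift_vertex[OF cover True])
  have "bij_betw (\<pi> n) (nbrs T x') (nbrs (G n) (\<pi> n x'))"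
    by (rule cover_map_bij_nbrs[OF simple_T simple cover x'(1)])
  then show ?thesis using bij_betw_same_card card_nbrs_T x'(2) by metis
next
  case False
  then have "nbrs (G n) x = {}" using simple_graph_adjD(1)[OF simple] by auto
  then show ?thesis by simp
qed

lemma arc_lift:
  assumes "adj (G n) x b"
  obtains x' b' where "adj T x' b'" "\<pi> n x' = x" "\<pi> n b' = b"
proof -
  have "x \<in> verts (G n)" by (rule simple_graph_adjD[OF simple assms])
  then obtain x' where x': "x' \<in> verts T" "\<pi> n x' = x" by (rule cover_map_lift_vertex[OF cover])
  have "adj (G n) (\<pi> n x') b" using assms x' by simp
  then obtain b' where "adj T x' b'" "\<pi> n b' = b" by (rule cover_map_lift_nbr[OF simple_T simple cover x'(1)])
  then show ?thesis using that x' by blast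
qed

lemma \<rho>_nonneg: "\<rho> \<ge> 0"
  unfolding \<rho>_def by (rule spectral_radius_nonneg[OF simple_T loc_finite_T card_nbrs_T])

lemma \<Lambda>_ge_1: "\<Lambda> \<ge> 1"
  using \<rho>_nonneg by (simp add: \<Lambda>_def)

lemma passage_T_le: "l > \<rho> \<Longrightarrow> adj T x b \<Longrightarrow> passage T l N x b \<le> l"
  unfolding \<rho>_def by (rule passage_le[OF simple_T loc_finite_T card_nbrs_T])

lemma passage_bounds:
  assumes l: "l > \<rho>" "l \<le> \<Lambda>" and N: "N \<ge> 1" and xb: "adj (G n) x b"
  shows "1 / \<Lambda> \<le> passage (G n) l N x b" "passage (G n) l N x b \<le> \<Lambda>"
proof -
  obtain x' b' where x': "adj T x' b'" "\<pi> n x' = x" "\<pi> n b' = b" by (rule arc_lift[OF xb])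
  have eq: "passage (G n) l N x b = passage T l N x' b'"
    using passage_cover[OF simple_T simple[of n] cover[of n] x'(1)] x' by simp
  have l0: "l > 0" using l \<rho>_nonneg by simp
  have "1 / \<Lambda> \<le> 1 / l" using l l0 by (simp add: frac_le)
  also have "\<dots> \<le> passage T l N x' b'" by (rule passage_ge[OF l0 N])
  finally show "1 / \<Lambda> \<le> passage (G n) l N x b" unfolding eq .
  show "passage (G n) l N x b \<le> \<Lambda>" unfolding eq using passage_T_le[OF l(1) x'(1), of N] l(2) by linarith
qed

text \<open>\<open>B\<close> is the supremum of the exact branch sums at \<open>l\<close>; it is
  finite by the difference quotient against an energy strictly between \<rho> and \<open>l\<close>.
  An arc and a depth \<open>K\<close> that nearly attain it survive the truncation at some finite
  \<open>N\<close>, so that from here on only finitely many walks matter.\<close>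

lemma near_maximal_branch:
  assumes l: "l > \<rho>" "l \<le> \<Lambda>"
  obtains B N K x0 b0 where "B > 0" "N \<ge> 1" "adj T x0 b0"
    "B / 2 \<le> branch T (\<lambda>x b. (passage T l N x b)\<^sup>2) K x0 b0"
    "\<And>K x b. adj T x b \<Longrightarrow> branch T (\<lambda>x b. (passage T l N x b)\<^sup>2) K x b \<le> B"
    "1 \<le> 4 * \<Lambda> ^ 3 * (l - \<rho>) * B\<^sup>2"
proof -
  let ?m = "passage_lim T l"
  let ?H = "branch T (\<lambda>x b. (?m x b)\<^sup>2)"
  define l1 where "l1 = (\<rho> + l) / 2"
  have l1: "\<rho> < l1" "l1 < l" using l by (auto simp: l1_def)
  have pos: "l > 0" "l1 > 0" using l1 \<rho>_nonneg by auto
  have bnd: "passage T l N x b \<le> \<Lambda>" "passage T l1 N x b \<le> \<Lambda>" if "adj T x b" for N x b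
    using passage_T_le[OF l(1) that, of N] passage_T_le[OF l1(1) that, of N] l l1 by linarith+
  have mpos: "?m x b > 0" if "adj T x b" for x b
  proof -
    have "1 / l > 0" using pos by simp
    moreover have "?m x b \<ge> 1 / l" by (rule passage_lim_ge[OF pos(1) bnd(1) that])
    ultimately show ?thesis by linarith
  qed
  have up: "?H K x b \<le> \<Lambda> / (l - l1)" if xb: "adj T x b" for K x b
  proof -
    have "(l - l1) * ?H K x b \<le> passage_lim T l1 x b - ?m x b"
      using l1(2) by (intro branch_le_passage_diff[OF pos(2) _ bnd(2) bnd(1) xb]) auto
    also have "\<dots> \<le> \<Lambda>" using passage_lim_le[OF pos(2) bnd(2) xb] mpos[OF xb] by linarith
    finally show ?thesis using l1(2) by (simp add: le_divide_eq mult.commute)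
  qed
  define S where "S = {?H K x b | K x b. adj T x b}"
  obtain x1 b1 where arc: "adj T x1 b1" by (rule infinite_tree_arc[OF tree infinite])
  have S1: "?H 1 x1 b1 \<in> S" using arc by (auto simp: S_def simp del: branch.simps)
  have bdd: "bdd_above S" using up by (auto simp: S_def bdd_above_def simp del: branch.simps)
  define B where "B = Sup S"
  have HB: "?H K x b \<le> B" if "adj T x b" for K x b
    unfolding B_def using that by (intro cSup_upper bdd) (auto simp: S_def simp del: branch.simps)
  have "?H 1 x1 b1 > 0" using mpos[OF arc] by simp
  then have B0: "B > 0" using HB[OF arc, of 1] by linarith
  have "1 / (4 * \<Lambda> ^ 3 * B\<^sup>2) \<le> l - \<rho>"
    unfolding \<rho>_def
    by (rule spectral_gap_of_branch_bound[OF tree loc_finite_T infinite card_nbrs_T _ l(2) B0 HB])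
       (use l in \<open>simp add: \<rho>_def\<close>)
  moreover have "4 * \<Lambda> ^ 3 * B\<^sup>2 > 0" using B0 \<Lambda>_ge_1 by simp
  ultimately have gap: "1 \<le> 4 * \<Lambda> ^ 3 * (l - \<rho>) * B\<^sup>2" by (simp add: divide_le_eq mult_ac)
  have "B / 2 < Sup S" using B0 by (simp add: B_def)
  moreover have "S \<noteq> {}" using S1 by blast
  ultimately obtain s where "s \<in> S" "B / 2 < s" using less_cSupD by blast
  then obtain K x0 b0 where K: "adj T x0 b0" "B / 2 < ?H K x0 b0" by (auto simp: S_def)
  have "(\<lambda>N. branch T (\<lambda>x b. (passage T l N x b)\<^sup>2) K x0 b0) \<longlonglongrightarrow> ?H K x0 b0"
    by (intro branch_tendsto[OF _ K(1)] tendsto_intros passage_tendsto[OF pos(1) bnd(1)])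
  from order_tendstoD(1)[OF this K(2)]
  obtain N0 where N0: "\<And>N. N \<ge> N0 \<Longrightarrow> B / 2 < branch T (\<lambda>x b. (passage T l N x b)\<^sup>2) K x0 b0"
    by (auto simp: eventually_sequentially)
  define N where "N = max 1 N0"
  show ?thesis
  proof (rule that[OF B0 _ K(1) _ _ gap])
    show "N \<ge> 1" by (simp add: N_def)
    show "B / 2 \<le> branch T (\<lambda>x b. (passage T l N x b)\<^sup>2) K x0 b0" using N0[of N] by (simp add: N_def)
    fix K x b assume xb: "adj T x b"
    have "branch T (\<lambda>x b. (passage T l N x b)\<^sup>2) K x b \<le> ?H K x b"
      using passage_nonneg[OF pos(1)] passage_le_lim[OF pos(1) bnd(1)]
      by (intro branch_mono_weight[OF _ xb]) (auto intro!: power_mono)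
    then show "branch T (\<lambda>x b. (passage T l N x b)\<^sup>2) K x b \<le> B" using HB[OF xb, of K] by linarith
  qed
qed

section \<open>Transfer of estimates from \<open>G 0\<close> to all graphs\<close>

lemma branch_transfer:
  assumes w: "\<And>n x b. adj T x b \<Longrightarrow> w n (\<pi> n x) (\<pi> n b) = v x b" and xb: "adj T x b"
  shows "branch (G n) (w n) K (\<pi> n x) (\<pi> n b) = branch (G m) (w m) K (\<pi> m x) (\<pi> m b)"
proof -
  have "branch (G n) (w n) K (\<pi> n x) (\<pi> n b) = branch T v K x b" for n
    by (rule branch_cover[OF simple_T simple cover xb]) (rule w)
  then show ?thesis by simp
qed

text \<open>The inequality is proved in \<open>G 0\<close> alone, which makes \<kappa> and
  \<open>D\<close> independent of \<open>n\<close>. Three core arcs at a vertex of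
  \<open>G n\<close> are lifted to one vertex of \<open>T\<close> and projected to
  \<open>G 0\<close>, where they stay different because cover maps are injective on
  neighbours.\<close>

lemma harnack:
  assumes C: "C \<ge> 1"
  obtains D \<kappa> where "(\<kappa>::real) > 0" "\<And>w v K x0 b0 n x u1 u2 u3.
      (\<And>n x b. adj T x b \<Longrightarrow> w n (\<pi> n x) (\<pi> n b) = v x b) \<Longrightarrow>
      (\<And>x b. adj (G 0) x b \<Longrightarrow> 1 / C \<le> w 0 x b \<and> w 0 x b \<le> C) \<Longrightarrow> adj (G 0) x0 b0 \<Longrightarrow>
      core_arc (G n) x u1 \<Longrightarrow> core_arc (G n) x u2 \<Longrightarrow> core_arc (G n) x u3 \<Longrightarrow>
      u1 \<noteq> u2 \<Longrightarrow> u1 \<noteq> u3 \<Longrightarrow> u2 \<noteq> u3 \<Longrightarrow>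
      \<kappa> * (1 + branch (G 0) (w 0) K x0 b0) \<le> 1 + branch (G n) (w n) (K + D) x u1"
proof (rule branch_harnack[OF simple[of 0] finite connected C])
  fix D and \<kappa> :: real
  assume \<kappa>: "\<kappa> > 0" and H: "\<And>w K x0 b0 x u1 u2 u3.
      (\<And>x b. adj (G 0) x b \<Longrightarrow> 1 / C \<le> w x b \<and> w x b \<le> C) \<Longrightarrow> adj (G 0) x0 b0 \<Longrightarrow>
      core_arc (G 0) x u1 \<Longrightarrow> core_arc (G 0) x u2 \<Longrightarrow> core_arc (G 0) x u3 \<Longrightarrow> u1 \<noteq> u2 \<Longrightarrow> u1 \<noteq> u3 \<Longrightarrow> u2 \<noteq> u3 \<Longrightarrow>
      \<kappa> * (1 + branch (G 0) w K x0 b0) \<le> 1 + branch (G 0) w (K + D) x u1"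
  show thesis
  proof (rule that[OF \<kappa>, of D])
    fix w :: "nat \<Rightarrow> 'a \<Rightarrow> 'a \<Rightarrow> real" and v K x0 b0 n x u1 u2 u3
    assume w: "\<And>n x b. adj T x b \<Longrightarrow> w n (\<pi> n x) (\<pi> n b) = v x b"
      and wC: "\<And>x b. adj (G 0) x b \<Longrightarrow> 1 / C \<le> w 0 x b \<and> w 0 x b \<le> C" and xb0: "adj (G 0) x0 b0"
      and core: "core_arc (G n) x u1" "core_arc (G n) x u2" "core_arc (G n) x u3"
      and ne: "u1 \<noteq> u2" "u1 \<noteq> u3" "u2 \<noteq> u3"
    have "x \<in> verts (G n)" by (rule simple_graph_adjD[OF simple core_arc_adj[OF core(1)]])
    then obtain x' where x': "x' \<in> verts T" "\<pi> n x' = x" by (rule cover_map_lift_vertex[OF cover])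
    have lift: "\<exists>u'. adj T x' u' \<and> \<pi> n u' = u \<and> core_arc (G 0) (\<pi> 0 x') (\<pi> 0 u')" if u: "core_arc (G n) x u" for u
    proof -
      have "adj (G n) (\<pi> n x') u" using core_arc_adj[OF u] x' by simp
      then obtain u' where u': "adj T x' u'" "\<pi> n u' = u" by (rule cover_map_lift_nbr[OF simple_T simple cover x'(1)])
      have "core_arc T x' u'" using core_arc_cover[OF simple_T simple[of n] cover[of n] u'(1)] u u' x' by simp
      then show ?thesis using core_arc_cover[OF simple_T simple[of 0] cover[of 0] u'(1)] u' by auto
    qed
    obtain v1 v2 v3 where v: "adj T x' v1" "\<pi> n v1 = u1" "core_arc (G 0) (\<pi> 0 x') (\<pi> 0 v1)"
      "adj T x' v2" "\<pi> n v2 = u2" "core_arc (G 0) (\<pi> 0 x') (\<pi> 0 v2)"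
      "adj T x' v3" "\<pi> n v3 = u3" "core_arc (G 0) (\<pi> 0 x') (\<pi> 0 v3)"
      using lift[OF core(1)] lift[OF core(2)] lift[OF core(3)] by blast
    have inj: "inj_on (\<pi> 0) (nbrs T x')"
      using cover_map_bij_nbrs[OF simple_T simple[of 0] cover[of 0] x'(1)] by (simp add: bij_betw_def)
    have ne': "\<pi> 0 a \<noteq> \<pi> 0 b" if "adj T x' a" "adj T x' b" "a \<noteq> b" for a b
      using inj_onD[OF inj, of a b] that by auto
    have "\<kappa> * (1 + branch (G 0) (w 0) K x0 b0) \<le> 1 + branch (G 0) (w 0) (K + D) (\<pi> 0 x') (\<pi> 0 v1)"
      by (rule H[OF wC xb0 v(3,6,9) ne'[OF v(1,4)] ne'[OF v(1,7)] ne'[OF v(4,7)]])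
         (use v(2,5,8) ne in auto)
    also have "branch (G 0) (w 0) (K + D) (\<pi> 0 x') (\<pi> 0 v1) = branch (G n) (w n) (K + D) x u1"
      using branch_transfer[of w v x' v1 0 "K + D" n, OF w v(1)] x' v by simp
    finally show "\<kappa> * (1 + branch (G 0) (w 0) K x0 b0) \<le> 1 + branch (G n) (w n) (K + D) x u1" .
  qed
qed

lemma card_arcs_le: "card (arcs (G n)) \<le> card (verts (G n)) * d"
proof -
  have eq: "arcs (G n) = Sigma (verts (G n)) (nbrs (G n))"
    using simple_graph_adjD(1)[OF simple] by (auto simp: arcs_def)
  have "card (arcs (G n)) = (\<Sum>x\<in>verts (G n). card (nbrs (G n) x))"
    unfolding eq using finite finite_subset[OF nbrs_subset_verts[OF simple] finite] by (intro card_SigmaI) auto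
  also have "\<dots> \<le> of_nat (card (verts (G n))) * d" by (intro sum_bounded_above card_nbrs)
  finally show ?thesis by simp
qed

lemma A_pos: "A \<ge> 1"
proof -
  obtain x b where "adj T x b" by (rule infinite_tree_arc[OF tree infinite])
  then have "(\<pi> 0 x, \<pi> 0 b) \<in> arcs (G 0)" using cover_map_adj[OF cover] by (simp add: arcs_def)
  then show ?thesis unfolding A_def using finite_arcs[OF simple finite, of 0]
    by (metis One_nat_def Suc_leI card_gt_0_iff empty_iff)
qed

text \<open>At a branch point the past and the future of a bad passage each weigh at least
  \<open>h\<close>, so bad passages have mass at least \<delta> h^2 / l^2 per vertex, against at
  most (1 + d B) / l^2 for all paths; the quotient is the mean in the exponent. Paths are summed by
  their pasts, so \<open>up\<close> concerns the reversed weights.\<close>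

lemma branch_points_green:
  assumes l: "l > \<rho>" "l \<le> \<Lambda>" and N: "N \<ge> 1" and B: "B > 0" and h: "h > 0"
    and up: "\<And>K x b. adj (G n) x b \<Longrightarrow> branch (G n) (\<lambda>x b. (passage (G n) l N b x)\<^sup>2) K x b \<le> B"
    and big: "\<And>x u1 u2 u3. core_arc (G n) x u1 \<Longrightarrow> core_arc (G n) x u2 \<Longrightarrow> core_arc (G n) x u3 \<Longrightarrow>
      u1 \<noteq> u2 \<Longrightarrow> u1 \<noteq> u3 \<Longrightarrow> u2 \<noteq> u3 \<Longrightarrow>
      h \<le> branch (G n) (\<lambda>x b. (passage (G n) l N x b)\<^sup>2) K x u1 \<and>
      h \<le> branch (G n) (\<lambda>x b. (passage (G n) l N b x)\<^sup>2) K x u1"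
    and dens: "\<delta> * real (card (verts (G n))) \<le> real (card (branch_points (G n) L))" and \<delta>: "\<delta> \<ge> 0"
    and M: "1 + passage_cost N * (Suc L * Suc (K + K)) \<le> M"
  shows "real (card (verts (G n))) / l\<^sup>2 * exp (ln (1 + (1 / \<Lambda>) ^ L) * (\<delta> * h\<^sup>2 / (1 + real d * B)))
    \<le> (\<Sum>v\<in>verts (G n). \<Sum>y\<in>verts (G n). (green (G n) l M v y)\<^sup>2)"
proof -
  have l0: "l > 0" using l \<rho>_nonneg by simp
  note simple_n = simple[of n]
  interpret detour_graph "G n" "bad_at (G n) L" "\<lambda>y x b. SOME s. loop_at (G n) L y x b s" L
  proof
    fix y x b assume "bad_at (G n) L y x b"
    then have "loop_at (G n) L y x b (SOME s. loop_at (G n) L y x b s)" unfolding bad_at_def by (rule someI_ex)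
    then show "\<exists>s. (SOME s. loop_at (G n) L y x b s) = x # y # s \<and> nb_walk (G n) ((SOME s. loop_at (G n) L y x b s) @ [x]) \<and>
      last (SOME s. loop_at (G n) L y x b s) \<noteq> y \<and> last (SOME s. loop_at (G n) L y x b s) \<noteq> b \<and>
      length (SOME s. loop_at (G n) L y x b s) \<le> L" unfolding loop_at_def by blast
  qed (rule simple finite)+
  let ?w = "passage (G n) l N" and ?n = "real (card (verts (G n)))"
  let ?Z = "\<Sum>p\<in>paths (K + K). (nb_weight l ?w p)\<^sup>2"
  let ?X = "\<Sum>p\<in>paths (K + K). (nb_weight l ?w p)\<^sup>2 * real (bad_count p)"
  let ?S = "\<lambda>f. \<Sum>(x, b)\<in>arcs (G n). \<Sum>y\<in>succs (G n) b x. of_bool (bad_at (G n) L y x b) * f x b y"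
  have fin: "finite (arcs (G n))" by (rule finite_arcs[OF simple_n finite])
  have adjsym: "adj (G n) b x" if "adj (G n) x b" for x b using simple_graph_adjD(4)[OF simple_n that] .
  have cnt: "real (card (branch_points (G n) L)) \<le> ?S (\<lambda>_ _ _. 1)"
  proof -
    define E where "E = {(x, b) \<in> arcs (G n). \<exists>y. bad_at (G n) L y x b}"
    have finE: "finite E" using fin by (rule finite_subset[rotated]) (auto simp: E_def)
    have "branch_points (G n) L \<subseteq> fst ` E"
    proof
      fix x assume "x \<in> branch_points (G n) L"
      then obtain y b where yb: "bad_at (G n) L y x b" by (auto simp: branch_points_def)
      then have "core_arc (G n) x b" by (auto simp: bad_at_def loop_at_def)
      then have "(x, b) \<in> E" using core_arc_adj yb by (auto simp: E_def arcs_def)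
      then show "x \<in> fst ` E" by force
    qed
    then have "card (branch_points (G n) L) \<le> card (fst ` E)" using finE by (intro card_mono) auto
    also have "\<dots> \<le> card E" by (rule card_image_le[OF finE])
    finally have "real (card (branch_points (G n) L)) \<le> (\<Sum>e\<in>E. 1)" by simp
    also have "\<dots> \<le> (\<Sum>(x, b)\<in>E. \<Sum>y\<in>succs (G n) b x. of_bool (bad_at (G n) L y x b) * 1)"
    proof (rule sum_mono)
      fix e assume "e \<in> E"
      then obtain x b y where e: "e = (x, b)" "bad_at (G n) L y x b" by (auto simp: E_def)
      then have "core_arc (G n) x y" "y \<noteq> b" by (auto simp: bad_at_def loop_at_def)
      then have y: "y \<in> succs (G n) b x" using core_arc_adj by auto
      have "(1::real) = of_bool (bad_at (G n) L y x b)" using e by simp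
      also have "\<dots> \<le> (\<Sum>y\<in>succs (G n) b x. of_bool (bad_at (G n) L y x b))"
        using y loc_finite by (intro member_le_sum) auto
      finally show "1 \<le> (case e of (x, b) \<Rightarrow> \<Sum>y\<in>succs (G n) b x. of_bool (bad_at (G n) L y x b) * (1::real))"
        using e by simp
    qed
    also have "\<dots> \<le> ?S (\<lambda>_ _ _. 1)"
      using fin by (intro sum_mono2) (auto simp: E_def intro!: sum_nonneg)
    finally show ?thesis .
  qed
  have Xge: "real (card (branch_points (G n) L)) * (h\<^sup>2 / l\<^sup>2) \<le> ?X"
  proof -
    have "real (card (branch_points (G n) L)) * (h\<^sup>2 / l\<^sup>2) \<le> ?S (\<lambda>_ _ _. 1) * (h\<^sup>2 / l\<^sup>2)"
      using cnt by (intro mult_right_mono) auto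
    also have "\<dots> = ?S (\<lambda>_ _ _. h / l\<^sup>2 * h)"
      by (simp add: sum_distrib_right sum_divide_distrib split_def power2_eq_square)
    also have "\<dots> \<le> ?S (\<lambda>x b y. branch (G n) (\<lambda>x b. (?w b x)\<^sup>2) K x y / l\<^sup>2 * branch (G n) (\<lambda>x b. (?w x b)\<^sup>2) K x b)"
    proof (rule sum_mono, clarify, rule sum_mono)
      fix x b y
      show "of_bool (bad_at (G n) L y x b) * (h / l\<^sup>2 * h) \<le> of_bool (bad_at (G n) L y x b) *
        (branch (G n) (\<lambda>x b. (?w b x)\<^sup>2) K x y / l\<^sup>2 * branch (G n) (\<lambda>x b. (?w x b)\<^sup>2) K x b)"
      proof (cases "bad_at (G n) L y x b")
        case True
        then obtain s where s: "core_arc (G n) x y" "core_arc (G n) x b" "core_arc (G n) x (last s)"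
          "last s \<noteq> y" "last s \<noteq> b" "b \<noteq> y" by (auto simp: bad_at_def loop_at_def)
        have "h \<le> branch (G n) (\<lambda>x b. (?w b x)\<^sup>2) K x y" using big[OF s(1,2,3)] s(4-6) by auto
        moreover have "h \<le> branch (G n) (\<lambda>x b. (?w x b)\<^sup>2) K x b" using big[OF s(2,1,3)] s(4-6) by auto
        ultimately show ?thesis using True h by (auto intro!: mult_mono divide_right_mono)
      qed simp
    qed
    also have "\<dots> \<le> ?X" by (rule sum_bad_paths_ge)
    finally show ?thesis .
  qed
  have Zle: "?Z \<le> ?n * (1 + real d * B) / l\<^sup>2"
  proof -
    have "?Z = ?n / l\<^sup>2 + (\<Sum>(x, b)\<in>arcs (G n). branch (G n) (\<lambda>x b. (?w b x)\<^sup>2) (K + K) b x / l\<^sup>2)"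
      unfolding sum_paths
      by (intro arg_cong2[of _ _ _ _ "(+)"] sum.cong) (auto simp: sum_weight_paths_to arcs_def power_divide)
    also have "(\<Sum>(x, b)\<in>arcs (G n). branch (G n) (\<lambda>x b. (?w b x)\<^sup>2) (K + K) b x / l\<^sup>2) \<le> (\<Sum>e\<in>arcs (G n). B / l\<^sup>2)"
      using up adjsym by (intro sum_mono) (auto simp: arcs_def intro!: divide_right_mono)
    also have "\<dots> = real (card (arcs (G n))) * (B / l\<^sup>2)" by simp
    also have "\<dots> \<le> ?n * real d * (B / l\<^sup>2)"
      using card_arcs_le[of n] B by (intro mult_right_mono) (auto simp flip: of_nat_mult)
    finally show ?thesis by (simp add: add_divide_distrib distrib_left mult_ac)
  qed
  let ?a = "\<delta> * h\<^sup>2 / (1 + real d * B)"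
  have den: "1 + real d * B > 0" using B by (simp add: add_pos_nonneg)
  have "?a * ?Z \<le> ?a * (?n * (1 + real d * B) / l\<^sup>2)"
    using Zle \<delta> den by (intro mult_left_mono) auto
  also have "\<dots> = (\<delta> * ?n) * (h\<^sup>2 / l\<^sup>2)"
  proof -
    have "(\<delta> * h\<^sup>2 / q) * (?n * q / l\<^sup>2) = (\<delta> * ?n) * (h\<^sup>2 / l\<^sup>2)" if "q > 0" for q
      using that by simp
    from this[OF den] show ?thesis .
  qed
  also have "\<dots> \<le> real (card (branch_points (G n) L)) * (h\<^sup>2 / l\<^sup>2)" using dens by (intro mult_right_mono) auto
  also have "\<dots> \<le> ?X" by (rule Xge)
  finally have aZ: "?a * ?Z \<le> ?X" .
  have e: "0 < 1 / \<Lambda>" "1 / \<Lambda> \<le> 1" using \<Lambda>_ge_1 by auto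
  show ?thesis by (rule sum_green_sq_exp[OF l0 e passage_bounds(1)[OF l N] M aZ])
qed

lemma branch_points_sparse:
  assumes ramanujan: "(\<lambda>n. real (size {# x \<in># eigenvalues_mset (G n). \<bar>x\<bar> \<le> \<rho> #}) / real (card (verts (G n)))) \<longlonglongrightarrow> 1"
    and \<delta>: "\<delta> > 0"
  shows "\<forall>\<^sub>F n in sequentially. real (card (branch_points (G n) L)) < \<delta> * real (card (verts (G n)))"
proof -
  define C where "C = \<Lambda>\<^sup>2"
  have C: "C \<ge> 1" using \<Lambda>_ge_1 by (simp add: C_def)
  show ?thesis
  proof (rule harnack[OF C])
    fix D and \<kappa> :: real
    assume \<kappa>: "\<kappa> > 0" and harn: "\<And>w v K x0 b0 n x u1 u2 u3.
        (\<And>n x b. adj T x b \<Longrightarrow> w n (\<pi> n x) (\<pi> n b) = v x b) \<Longrightarrow>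
        (\<And>x b. adj (G 0) x b \<Longrightarrow> 1 / C \<le> w 0 x b \<and> w 0 x b \<le> C) \<Longrightarrow> adj (G 0) x0 b0 \<Longrightarrow>
        core_arc (G n) x u1 \<Longrightarrow> core_arc (G n) x u2 \<Longrightarrow> core_arc (G n) x u3 \<Longrightarrow>
        u1 \<noteq> u2 \<Longrightarrow> u1 \<noteq> u3 \<Longrightarrow> u2 \<noteq> u3 \<Longrightarrow>
        \<kappa> * (1 + branch (G 0) (w 0) K x0 b0) \<le> 1 + branch (G n) (w n) (K + D) x u1"
    \<comment> \<open>For the reversed weights the near-maximal arc is only known to carry B / (2
      A), hence the 2 and the \<open>A\<close>; the factor 1 + C absorbs the summand 1 in the
      Harnack inequality.\<close>
    define \<kappa>1 where "\<kappa>1 = \<kappa> / (2 * real A * (1 + C))"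
    have A: "real A \<ge> 1" using A_pos by simp
    have \<kappa>1: "\<kappa>1 > 0" using \<kappa> A C by (simp add: \<kappa>1_def)
    define \<theta> where "\<theta> = ln (1 + (1 / \<Lambda>) ^ L)"
    have \<theta>: "\<theta> > 0" unfolding \<theta>_def using \<Lambda>_ge_1 by (intro ln_gt_zero) simp
    \<comment> \<open>With h = \<kappa>1 B and B \<ge> 1 the exponent will be at least c B, and
      \<open>c\<close> is fixed before \<open>l\<close> is chosen.\<close>
    define c where "c = \<theta> * (\<delta> * \<kappa>1\<^sup>2 / (1 + real d * real A))"
    have c: "c > 0" unfolding c_def using \<theta> \<delta> \<kappa>1 by (intro mult_pos_pos divide_pos_pos) (auto intro!: add_pos_nonneg)
    obtain B0 where B0: "B0 \<ge> 1" "\<And>B. B \<ge> B0 \<Longrightarrow> \<Lambda>\<^sup>2 * (16 * \<Lambda> ^ 6 * B ^ 4 + 1) < exp (c * B)"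
      by (rule exp_dominates_quartic[OF c], rule that, assumption)
    \<comment> \<open>The gap inequality 1 \<le> 4 \<Lambda>^3 t B^2 then forces B \<ge> B0, so that
      the exponential wins.\<close>
    define t where "t = min 1 (1 / (4 * \<Lambda> ^ 3 * B0\<^sup>2))"
    have t: "t > 0" "t \<le> 1" "t \<le> 1 / (4 * \<Lambda> ^ 3 * B0\<^sup>2)" using \<Lambda>_ge_1 B0(1) by (auto simp: t_def)
    define l where "l = \<rho> + t"
    have l: "l > \<rho>" "l \<le> \<Lambda>" "l - \<rho> = t" using t by (auto simp: l_def \<Lambda>_def)
    have l0: "l > 0" using l \<rho>_nonneg by simp
    obtain B N K x0 b0 where B: "B > 0" and N: "N \<ge> 1" and x0: "adj T x0 b0"
      and half: "B / 2 \<le> branch T (\<lambda>x b. (passage T l N x b)\<^sup>2) K x0 b0"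
      and up: "\<And>K x b. adj T x b \<Longrightarrow> branch T (\<lambda>x b. (passage T l N x b)\<^sup>2) K x b \<le> B"
      and gap: "1 \<le> 4 * \<Lambda> ^ 3 * (l - \<rho>) * B\<^sup>2"
      by (rule near_maximal_branch[OF l(1,2)], rule that, assumption+)
    have L3: "4 * \<Lambda> ^ 3 > 0" using \<Lambda>_ge_1 by simp
    have BB0: "B \<ge> B0"
    proof -
      have "4 * \<Lambda> ^ 3 * t * B0\<^sup>2 \<le> 1" using t(3) L3 B0(1) by (simp add: le_divide_eq mult_ac)
      also have "1 \<le> 4 * \<Lambda> ^ 3 * t * B\<^sup>2" using gap l(3) by simp
      finally have "B0\<^sup>2 \<le> B\<^sup>2" using L3 t(1) by simp
      then show ?thesis by (rule power2_le_imp_le) (use B in linarith)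
    qed
    have B1: "B \<ge> 1" using BB0 B0(1) by simp
    let ?w = "\<lambda>n x b. (passage (G n) l N x b)\<^sup>2" and ?r = "\<lambda>n x b. (passage (G n) l N b x)\<^sup>2"
    have w: "?w n (\<pi> n x) (\<pi> n b) = (passage T l N x b)\<^sup>2" if "adj T x b" for n x b
      using passage_cover[OF simple_T simple[of n] cover[of n] that] by simp
    have r: "?r n (\<pi> n x) (\<pi> n b) = (passage T l N b x)\<^sup>2" if "adj T x b" for n x b
      using passage_cover[OF simple_T simple[of n] cover[of n] simple_graph_adjD(4)[OF simple_T that]] by simp
    have sq: "1 / C \<le> p\<^sup>2 \<and> p\<^sup>2 \<le> C" if "1 / \<Lambda> \<le> p" "p \<le> \<Lambda>" for p
    proof -
      have i0: "0 \<le> 1 / \<Lambda>" using \<Lambda>_ge_1 by simp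
      then have "0 \<le> p" using that(1) by linarith
      then have "(1 / \<Lambda>)\<^sup>2 \<le> p\<^sup>2" "p\<^sup>2 \<le> \<Lambda>\<^sup>2" using that i0 by (simp_all only: power_mono)
      then show ?thesis by (simp add: C_def power_divide)
    qed
    have wC: "1 / C \<le> ?w n x b \<and> ?w n x b \<le> C" if "adj (G n) x b" for n x b
      by (rule sq[OF passage_bounds[OF l(1,2) N that]])
    have rC: "1 / C \<le> ?r n x b \<and> ?r n x b \<le> C" if "adj (G n) x b" for n x b
      by (rule sq[OF passage_bounds[OF l(1,2) N simple_graph_adjD(4)[OF simple that]]])
    have nn: "branch (G n) (?r n) K x b \<ge> 0" if "adj (G n) x b" for n K x b
      using that by (intro branch_nonneg) auto
    have upw: "branch (G 0) (?w 0) K x b \<le> B" if xb: "adj (G 0) x b" for K x b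
    proof -
      obtain x' b' where x': "adj T x' b'" "\<pi> 0 x' = x" "\<pi> 0 b' = b" by (rule arc_lift[OF xb])
      have "branch (G 0) (?w 0) K (\<pi> 0 x') (\<pi> 0 b') = branch T (\<lambda>x b. (passage T l N x b)\<^sup>2) K x' b'"
        by (rule branch_cover[OF simple_T simple cover x'(1)]) (rule w)
      then show ?thesis using up[OF x'(1), of K] x' by simp
    qed
    have fin0: "finite (arcs (G 0))" by (rule finite_arcs[OF simple finite])
    \<comment> \<open>A single reversed sum is at most the total over \<open>G 0\<close>, which
      equals the total of the forward sums.\<close>
    have upr0: "branch (G 0) (?r 0) K x b \<le> real A * B" if xb: "adj (G 0) x b" for K x b
    proof -
      have "branch (G 0) (?r 0) K x b = (case (x, b) of (x, b) \<Rightarrow> branch (G 0) (?r 0) K x b)" by simp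
      also have "\<dots> \<le> (\<Sum>(x, b)\<in>arcs (G 0). branch (G 0) (?r 0) K x b)"
        using xb fin0 nn[of 0] by (intro member_le_sum) (auto simp: arcs_def)
      also have "\<dots> = (\<Sum>(x, b)\<in>arcs (G 0). branch (G 0) (?w 0) K x b)"
        by (rule sum_branch_reverse[OF simple finite, symmetric])
      also have "\<dots> \<le> (\<Sum>e\<in>arcs (G 0). B)" using upw by (intro sum_mono) (auto simp: arcs_def)
      finally show ?thesis by (simp add: A_def)
    qed
    have upr: "branch (G n) (?r n) K x b \<le> real A * B" if xb: "adj (G n) x b" for n K x b
    proof -
      obtain x' b' where x': "adj T x' b'" "\<pi> n x' = x" "\<pi> n b' = b" by (rule arc_lift[OF xb])
      have "branch (G n) (?r n) K (\<pi> n x') (\<pi> n b') = branch (G 0) (?r 0) K (\<pi> 0 x') (\<pi> 0 b')"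
        by (rule branch_transfer[where w="?r" and v="\<lambda>x b. (passage T l N b x)\<^sup>2", OF r x'(1)])
      also have "\<dots> \<le> real A * B" using cover_map_adj[OF cover x'(1)] by (rule upr0)
      finally show ?thesis using x' by simp
    qed
    have arc0: "adj (G 0) (\<pi> 0 x0) (\<pi> 0 b0)" by (rule cover_map_adj[OF cover x0])
    have half_w: "B / 2 \<le> branch (G 0) (?w 0) K (\<pi> 0 x0) (\<pi> 0 b0)"
    proof -
      have "branch (G 0) (?w 0) K (\<pi> 0 x0) (\<pi> 0 b0) = branch T (\<lambda>x b. (passage T l N x b)\<^sup>2) K x0 b0"
        by (rule branch_cover[OF simple_T simple cover x0]) (rule w)
      then show ?thesis using half by simp
    qed
    \<comment> \<open>By the same identity of totals, some arc carries at least the average.\<close>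
    obtain x1 b1 where arc1: "adj (G 0) x1 b1" and half_r: "B / (2 * real A) \<le> branch (G 0) (?r 0) K x1 b1"
    proof -
      have "\<exists>e\<in>arcs (G 0). B / (2 * real A) \<le> (case e of (x, b) \<Rightarrow> branch (G 0) (?r 0) K x b)"
      proof (rule ccontr)
        assume "\<not> ?thesis"
        then have lt: "(case e of (x, b) \<Rightarrow> branch (G 0) (?r 0) K x b) < B / (2 * real A)" if "e \<in> arcs (G 0)" for e
          using that by force
        have ne: "arcs (G 0) \<noteq> {}" using arc0 by (auto simp: arcs_def)
        have "B / 2 \<le> (case (\<pi> 0 x0, \<pi> 0 b0) of (x, b) \<Rightarrow> branch (G 0) (?w 0) K x b)" using half_w by simp
        also have "\<dots> \<le> (\<Sum>(x, b)\<in>arcs (G 0). branch (G 0) (?w 0) K x b)"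
          using arc0 fin0 by (intro member_le_sum) (auto simp: arcs_def intro!: branch_nonneg)
        also have "\<dots> = (\<Sum>(x, b)\<in>arcs (G 0). branch (G 0) (?r 0) K x b)"
          by (rule sum_branch_reverse[OF simple finite])
        also have "\<dots> < (\<Sum>e\<in>arcs (G 0). B / (2 * real A))" by (rule sum_strict_mono[OF fin0 ne lt])
        also have "\<dots> = B / 2" using A by (simp add: A_def[symmetric])
        finally show False by simp
      qed
      then show ?thesis using that by (auto simp: arcs_def)
    qed
    have K1: "K \<ge> 1" using half_w B by (cases K) auto
    define h where "h = \<kappa>1 * B"
    have h: "h > 0" using \<kappa>1 B by (simp add: h_def)
    have boost: "h \<le> s" if s: "\<kappa> * (1 + p) \<le> 1 + s" "B / (2 * real A) \<le> p" "1 / C \<le> s" for p s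
    proof -
      have "1 \<le> C * s" using s(3) C by (simp add: divide_le_eq mult.commute)
      then have "1 + s \<le> (1 + C) * s" by (simp add: distrib_right)
      moreover have "\<kappa> * (B / (2 * real A)) \<le> \<kappa> * (1 + p)" using s(2) \<kappa> by (intro mult_left_mono) auto
      ultimately have "\<kappa> * (B / (2 * real A)) \<le> (1 + C) * s" using s(1) by linarith
      moreover have C1: "1 + C > 0" using C by linarith
      ultimately have "\<kappa> * (B / (2 * real A)) / (1 + C) \<le> s" unfolding pos_divide_le_eq[OF C1] by (simp only: mult.commute)
      then show ?thesis by (simp add: h_def \<kappa>1_def)
    qed
    have ge1: "1 / C \<le> branch (G n) v (K + D) x b" if v: "\<And>x b. adj (G n) x b \<Longrightarrow> 1 / C \<le> v x b" and xb: "adj (G n) x b" for n v x b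
    proof -
      have v0: "v x b \<ge> 0" if "adj (G n) x b" for x b
      proof -
        have "1 / C > 0" using C by simp
        then show ?thesis using v[OF that] by linarith
      qed
      have "1 / C \<le> branch (G n) v (Suc 0) x b" using v[OF xb] by simp
      also have "\<dots> \<le> branch (G n) v (K + D) x b" by (rule branch_mono[OF v0 xb]) (use K1 in auto)
      finally show ?thesis .
    qed
    have hA: "B / (2 * real A) \<le> B / 2" by (rule divide_left_mono) (use A B in auto)
    have big: "h \<le> branch (G n) (?w n) (K + D) x u1 \<and> h \<le> branch (G n) (?r n) (K + D) x u1"
      if core: "core_arc (G n) x u1" "core_arc (G n) x u2" "core_arc (G n) x u3"
        and ne: "u1 \<noteq> u2" "u1 \<noteq> u3" "u2 \<noteq> u3" for n x u1 u2 u3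
    proof
      have xu: "adj (G n) x u1" by (rule core_arc_adj[OF core(1)])
      have "\<kappa> * (1 + branch (G 0) (?w 0) K (\<pi> 0 x0) (\<pi> 0 b0)) \<le> 1 + branch (G n) (?w n) (K + D) x u1"
        by (rule harn[where w="?w" and v="\<lambda>x b. (passage T l N x b)\<^sup>2", OF w wC arc0 core ne])
      then show "h \<le> branch (G n) (?w n) (K + D) x u1"
        by (rule boost) (use half_w hA in linarith, rule ge1[OF _ xu], use wC in blast)
      have "\<kappa> * (1 + branch (G 0) (?r 0) K x1 b1) \<le> 1 + branch (G n) (?r n) (K + D) x u1"
        by (rule harn[where w="?r" and v="\<lambda>x b. (passage T l N b x)\<^sup>2", OF r rC arc1 core ne])
      then show "h \<le> branch (G n) (?r n) (K + D) x u1"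
        by (rule boost) (use half_r in linarith, rule ge1[OF _ xu], use rC in blast)
    qed
    \<comment> \<open>\<open>M\<close>, and with it \<open>R\<close>, is fixed before
      \<open>n\<close>; the proportion of exceptional eigenvalues tends to zero and is multiplied by
      the constant \<open>R\<close>.\<close>
    define M where "M = 1 + passage_cost N * (Suc L * Suc ((K + D) + (K + D)))"
    define R where "R = (resolvent l M (real d))\<^sup>2"
    let ?g = "\<lambda>n. size {# x \<in># eigenvalues_mset (G n). \<bar>x\<bar> \<le> \<rho> #}"
    have "(\<lambda>n. (1 - real (?g n) / real (card (verts (G n)))) * R) \<longlonglongrightarrow> (1 - 1) * R"
      by (intro tendsto_intros ramanujan)
    then have "\<forall>\<^sub>F n in sequentially. (1 - real (?g n) / real (card (verts (G n)))) * R < 1"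
      by (rule order_tendstoD) simp
    then show ?thesis
    proof eventually_elim
      case (elim n)
      let ?n = "real (card (verts (G n)))"
      have "verts (G n) \<noteq> {}" using connected[of n] by (auto simp: graph_connected_def)
      then have n0: "?n > 0" using finite[of n] by (simp add: card_gt_0_iff)
      show ?case
      proof (rule ccontr)
        assume "\<not> ?case"
        then have dens: "\<delta> * ?n \<le> real (card (branch_points (G n) L))" by simp
        have AB: "real A * B > 0" using A B by simp
        let ?a = "\<delta> * h\<^sup>2 / (1 + real d * (real A * B))"
        have "?n / l\<^sup>2 * exp (\<theta> * ?a) \<le> (\<Sum>v\<in>verts (G n). \<Sum>y\<in>verts (G n). (green (G n) l M v y)\<^sup>2)"
          unfolding \<theta>_def
        proof (rule branch_points_green[where K="K + D", OF l(1,2) N AB h])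
          show "branch (G n) (?r n) K x b \<le> real A * B" if "adj (G n) x b" for K x b
            using that by (rule upr)
          show "h \<le> branch (G n) (?w n) (K + D) x u1 \<and> h \<le> branch (G n) (?r n) (K + D) x u1"
            if "core_arc (G n) x u1" "core_arc (G n) x u2" "core_arc (G n) x u3" "u1 \<noteq> u2" "u1 \<noteq> u3" "u2 \<noteq> u3"
            for x u1 u2 u3 using that by (rule big)
          show "\<delta> * ?n \<le> real (card (branch_points (G n) L))" by (rule dens)
        qed (use \<delta> in \<open>auto simp: M_def\<close>)
        also have "\<dots> \<le> ?n / (l - \<rho>)\<^sup>2 + real (card (verts (G n)) - ?g n) * R"
          unfolding R_def by (rule sum_green_sq_le(2)[OF simple finite card_nbrs \<rho>_nonneg l(1)])
        also have "real (card (verts (G n)) - ?g n) = ?n * (1 - real (?g n) / ?n)"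
          using sum_green_sq_le(1)[OF simple finite card_nbrs \<rho>_nonneg l(1), of n] n0
          by (simp add: of_nat_diff right_diff_distrib)
        finally have "?n * (exp (\<theta> * ?a) / l\<^sup>2) \<le> ?n * (1 / t\<^sup>2 + (1 - real (?g n) / ?n) * R)"
          unfolding l(3) by (simp add: distrib_left mult.assoc)
        then have "exp (\<theta> * ?a) / l\<^sup>2 \<le> 1 / t\<^sup>2 + (1 - real (?g n) / ?n) * R"
          by (rule mult_left_le_imp_le[OF _ n0])
        then have "exp (\<theta> * ?a) / l\<^sup>2 < 1 / t\<^sup>2 + 1" using elim by linarith
        then have e1: "exp (\<theta> * ?a) < l\<^sup>2 * (1 / t\<^sup>2 + 1)" using l0 by (simp add: divide_less_eq mult.commute)
        \<comment> \<open>Squaring the gap inequality produces the fourth power of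
          \<open>B\<close>.\<close>
        have "1 / t \<le> 4 * \<Lambda> ^ 3 * B\<^sup>2" using gap l(3) t(1) by (simp add: divide_le_eq mult_ac)
        then have "(1 / t)\<^sup>2 \<le> (4 * \<Lambda> ^ 3 * B\<^sup>2)\<^sup>2" using t(1) by (intro power_mono) auto
        also have "(4 * \<Lambda> ^ 3 * B\<^sup>2)\<^sup>2 = 16 * \<Lambda> ^ 6 * B ^ 4" by (simp add: power_mult_distrib flip: power_mult)
        finally have e2: "1 / t\<^sup>2 \<le> 16 * \<Lambda> ^ 6 * B ^ 4" by (simp add: power_divide)
        have e3: "l\<^sup>2 \<le> \<Lambda>\<^sup>2" using l l0 by (intro power_mono) auto
        have "l\<^sup>2 * (1 / t\<^sup>2 + 1) \<le> \<Lambda>\<^sup>2 * (16 * \<Lambda> ^ 6 * B ^ 4 + 1)"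
          using e2 e3 by (intro mult_mono) auto
        also have "\<dots> < exp (c * B)" by (rule B0(2)[OF BB0])
        also have "c * B \<le> \<theta> * ?a"
        proof -
          have "1 + real d * (real A * B) \<le> (1 + real d * real A) * B" using B1 by (simp add: distrib_right)
          then have "\<delta> * h\<^sup>2 / ((1 + real d * real A) * B) \<le> ?a"
            using \<delta> A B by (intro divide_left_mono mult_pos_pos add_pos_nonneg) auto
          moreover have "\<delta> * h\<^sup>2 / ((1 + real d * real A) * B) = \<delta> * \<kappa>1\<^sup>2 / (1 + real d * real A) * B"
            using B by (simp add: h_def power_mult_distrib power2_eq_square)
          ultimately have "\<theta> * (\<delta> * \<kappa>1\<^sup>2 / (1 + real d * real A) * B) \<le> \<theta> * ?a" using \<theta> by (intro mult_left_mono) auto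
          then show ?thesis by (simp add: c_def mult.assoc)
        qed
        finally show False using e1 by simp
      qed
    qed
  qed
qed

text \<open>Extendability is a property of the lifted arc in \<open>T\<close>, and every such arc
  projects to one of finitely many arcs of \<open>G 0\<close>; the sum of their failure depths
  serves all graphs at once.\<close>

lemma extendable_bound:
  "\<exists>N0. \<forall>n x b. extendable (G n) N0 x b \<longrightarrow> inf_arc (G n) x b"
proof -
  have "\<forall>e\<in>arcs (G 0). \<exists>N. \<not> inf_arc (G 0) (fst e) (snd e) \<longrightarrow> \<not> extendable (G 0) N (fst e) (snd e)"
    by (auto simp: inf_arc_def)
  from bchoice[OF this] obtain f where f: "\<And>e. e \<in> arcs (G 0) \<Longrightarrow>
    \<not> inf_arc (G 0) (fst e) (snd e) \<Longrightarrow> \<not> extendable (G 0) (f e) (fst e) (snd e)" by blast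
  define N0 where "N0 = (\<Sum>e\<in>arcs (G 0). f e)"
  have fin: "finite (arcs (G 0))" by (rule finite_arcs[OF simple finite])
  show ?thesis
  proof (intro exI allI impI)
    fix n x b assume ext: "extendable (G n) N0 x b"
    obtain x' b' where x': "adj T x' b'" "\<pi> n x' = x" "\<pi> n b' = b" by (rule arc_lift[OF extendable_adj[OF ext]])
    let ?e = "(\<pi> 0 x', \<pi> 0 b')"
    have e: "?e \<in> arcs (G 0)" using cover_map_adj[OF cover x'(1)] by (simp add: arcs_def)
    have "extendable (G 0) N0 (\<pi> 0 x') (\<pi> 0 b')"
      using ext x' extendable_cover[OF simple_T simple[of n] cover[of n] x'(1)] extendable_cover[OF simple_T simple[of 0] cover[of 0] x'(1)]
      by auto
    moreover have "f ?e \<le> N0" unfolding N0_def by (rule member_le_sum[OF e _ fin]) simp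
    ultimately have "extendable (G 0) (f ?e) (fst ?e) (snd ?e)" using extendable_antimono by fastforce
    then have "inf_arc (G 0) (\<pi> 0 x') (\<pi> 0 b')" using f[OF e] by auto
    then show "inf_arc (G n) x b"
      using x' inf_arc_cover[OF simple_T simple[of n] cover[of n] x'(1)] inf_arc_cover[OF simple_T simple[of 0] cover[of 0] x'(1)]
      by auto
  qed
qed

lemma tree_nbhds:
  assumes ramanujan: "(\<lambda>n. real (size {# x \<in># eigenvalues_mset (G n). \<bar>x\<bar> \<le> graph_spectral_radius T #}) / real (card (verts (G n)))) \<longlonglongrightarrow> 1"
    and size: "filterlim (\<lambda>n. card (verts (G n))) at_top sequentially"
  shows "(\<lambda>n. real (card {v \<in> verts (G n). is_tree (nbhd r (G n) v)}) / real (card (verts (G n)))) \<longlonglongrightarrow> 1"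
proof (rule LIMSEQ_I)
  fix \<epsilon> :: real assume \<epsilon>: "\<epsilon> > 0"
  obtain N0 where N0: "\<And>n x b. extendable (G n) N0 x b \<Longrightarrow> inf_arc (G n) x b"
    using extendable_bound by blast
  let ?V = "Suc d ^ r"
  \<comment> \<open>\<open>?V\<close> is the loss in passing from branch points to the vertices near
    them, so the density is prescribed smaller by this factor.\<close>
  have "\<epsilon> / real ?V > 0" using \<epsilon> by simp
  from branch_points_sparse[OF ramanujan[folded \<rho>_def] this, of ?V]
  have sparse: "\<forall>\<^sub>F n in sequentially. real (card (branch_points (G n) ?V)) < \<epsilon> / real ?V * real (card (verts (G n)))" .
  have large: "\<forall>\<^sub>F n in sequentially. card (verts (G n)) > ?V * Suc d ^ Suc N0"
    using size[unfolded filterlim_at_top, THEN spec, of "Suc (?V * Suc d ^ Suc N0)"] by (simp only: Suc_le_eq)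
  from sparse large have "\<forall>\<^sub>F n in sequentially.
    norm (real (card {v \<in> verts (G n). is_tree (nbhd r (G n) v)}) / real (card (verts (G n))) - 1) < \<epsilon>"
  proof eventually_elim
    case (elim n)
    let ?n = "card (verts (G n))"
    let ?t = "{v \<in> verts (G n). is_tree (nbhd r (G n) v)}" and ?f = "{v \<in> verts (G n). \<not> is_tree (nbhd r (G n) v)}"
    have n0: "real ?n > 0" using elim(2) by simp
    have "card ?f \<le> card (branch_points (G n) ?V) * ?V"
      by (rule nontree_card_le[OF simple finite connected card_nbrs N0 elim(2)])
    then have "real (card ?f) \<le> real (card (branch_points (G n) ?V)) * real ?V" by (metis of_nat_le_iff of_nat_mult)
    also have "\<dots> < \<epsilon> / real ?V * real ?n * real ?V" using elim(1) by (intro mult_strict_right_mono) auto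
    finally have lt: "real (card ?f) < \<epsilon> * real ?n" by simp
    have "verts (G n) = ?t \<union> ?f" "?t \<inter> ?f = {}" by auto
    then have "?n = card ?t + card ?f" using finite[of n] card_Un_disjoint[of ?t ?f] by auto
    then have "real (card ?t) / real ?n - 1 = - (real (card ?f) / real ?n)" using n0 by (simp add: field_simps)
    then show ?case using lt n0 by (simp add: divide_less_eq)
  qed
  then show "\<exists>no. \<forall>n\<ge>no. norm (real (card {v \<in> verts (G n). is_tree (nbhd r (G n) v)}) / real (card (verts (G n))) - 1) < \<epsilon>"
    by (simp add: eventually_sequentially)
qed

end

theorem theorem1:
  fixes G :: "nat \<Rightarrow> 'a sgraph" and T :: "'b sgraph"
  assumes simple: "\<And>n. simple_graph (G n)"
    and finite: "\<And>n. finite (verts (G n))"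
    and connected: "\<And>n. graph_connected (G n)"
    and cover: "\<And>n. universal_cover T (G n)"
    and weakly_ramanujan:
      "(\<lambda>n. real (size {# x \<in># eigenvalues_mset (G n). \<bar>x\<bar> \<le> graph_spectral_radius T #})
            / real (card (verts (G n)))) \<longlonglongrightarrow> 1"
    and size_unbounded: "filterlim (\<lambda>n. card (verts (G n))) at_top sequentially"
  shows "\<forall>r::nat. r > 0 \<longrightarrow>
      (\<lambda>n. real (card {v \<in> verts (G n). is_tree (nbhd r (G n) v)})
            / real (card (verts (G n)))) \<longlonglongrightarrow> 1"
proof -
  have "\<forall>n. \<exists>\<pi>. cover_map \<pi> T (G n)" using cover by (auto simp: universal_cover_def)
  from choice[OF this] obtain \<pi> where \<pi>: "\<And>n. cover_map (\<pi> n) T (G n)" by blast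
  \<comment> \<open>A finite \<open>T\<close> could not be mapped onto graphs of unbounded
    size.\<close>
  have "infinite (verts T)"
  proof
    assume fin: "finite (verts T)"
    have "card (verts (G n)) \<le> card (verts T)" for n
    proof -
      have "\<pi> n ` verts T = verts (G n)" using \<pi>[of n] unfolding cover_map_def by blast
      then show ?thesis using card_image_le[OF fin, of "\<pi> n"] by simp
    qed
    moreover have "\<forall>\<^sub>F n in sequentially. card (verts (G n)) > card (verts T)"
      using size_unbounded[unfolded filterlim_at_top, THEN spec, of "Suc (card (verts T))"]
      by (simp only: Suc_le_eq)
    then obtain n where "card (verts (G n)) > card (verts T)"
      using eventually_happens'[OF sequentially_bot] by blast
    ultimately show False by (simp add: not_less[symmetric])
  qed
  then interpret common_cover G T \<pi>
    using assms \<pi> by unfold_locales (auto simp: universal_cover_def)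
  show ?thesis using tree_nbhds[OF weakly_ramanujan size_unbounded] by blast
qed

end
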